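(* Let $X$ be a locally compact Polish space and $\sigma$ a non-atomic Radon measure on $X$. Let $\alpha:X\to\mathbb R_+$ and $\beta:X\to[0,\infty)$ be measurable functions such that $\alpha\beta$ and $\beta$ belong to $L^1_{\mathrm{loc}}(X,\sigma)$, and let $$dm(x,s)=\frac{\beta(x)e^{-\frac{s}{\alpha(x)}}}{s}\,d\sigma(x)\,ds$$ on $X\times\mathbb R_+$. Let $Y:=\{x\in X\mid\beta(x)>0\}$. Then, for each $\theta\in C_0(X\to\mathbb R_+)$, the Radon--Nikodym derivative of $\mu_m^\theta$ with respect to $\mu_m$ is given by $$\frac{d\mu_m^\theta}{d\mu_m}(\eta)=\exp\left[\int_Y(1-\theta^{-1}(x))\frac1{\alpha(x)}\,d\eta(x)-\int_Y\log(\theta(x))\,\beta(x)\,d\sigma(x)\right].$$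
   Context: $\mathbb R_+=(0,\infty)$. $\mathcal B_0(X)$ is the collection of Borel subsets of $X$ with compact closure; $L^1_{\mathrm{loc}}(X,\sigma)$ is the space of measurable $f:X\to\mathbb R$ with $\int_A|f|\,d\sigma<\infty$ for each $A\in\mathcal B_0(X)$. $\mathbb M(X)$ is the set of Radon measures on $X$ (finite on compact sets) with the vague topology and its Borel $\sigma$-algebra. $\mathbb K(X)\subset\mathbb M(X)$ is the set of discrete Radon measures $\eta=\sum_i s_i\delta_{x_i}$ with $s_i>0$, the $x_i\in X$ distinct and at most countably many (the zero measure included), with the trace $\sigma$-algebra. For a measure $m$ on $X\times\mathbb R_+$ with $m(\{x\}\times\mathbb R_+)=0$ for all $x\in X$ and $\int_{A\times\mathbb R_+}\min\{s,1\}\,dm(x,s)<\infty$ for all $A\in\mathcal B_0(X)$, $\mu_m$ denotes the unique probability measure on $\mathbb K(X)$ with Fourier transform $\int_{\mathbb K(X)}e^{i\int f\,d\eta}\,d\mu_m(\eta)=\exp\left[\int_X\int_{\mathbb R_+}(e^{isf(x)}-1)\,dm(x,s)\right]$ for all continuous compactly supported $f:X\to\mathbb R$. (The $m$ of the claim satisfies these conditions.) $C_0(X\to\mathbb R_+)$ is the group (under pointwise multiplication) of continuous functions $\theta:X\to\mathbb R_+$ equal to $1$ outside a compact set; $\theta^{-1}(x)=1/\theta(x)$. It acts on $\mathbb M(X)$ by $\eta\mapsto\theta\eta$, where $\theta\eta$ has density $\theta$ with respect to $\eta$; this maps $\mathbb K(X)$ into itself. $\mu_m^\theta$ is the pushforward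 of $\mu_m$ under $\eta\mapsto\theta\eta$. *)

theory Defs
  imports "HOL-Probability.Probability"
begin

definition rel_compact_borel :: "'a::topological_space set set" where
  "rel_compact_borel = {A \<in> sets borel. compact (closure A)}"

definition L1_loc :: "'a::topological_space measure \<Rightarrow> ('a \<Rightarrow> real) set" where
  "L1_loc \<sigma> = {f \<in> borel_measurable borel.
     \<forall>A \<in> rel_compact_borel. (\<integral>\<^sup>+x\<in>A. ennreal \<bar>f x\<bar> \<partial>\<sigma>) < \<infinity>}"

definition compact_support_continuous :: "('a::topological_space \<Rightarrow> real) set" where
  "compact_support_continuous =
     {f. continuous_on UNIV f \<and> compact (closure {x. f x \<noteq> 0})}"

definition radon_measures :: "'a::topological_space measure set" where
  "radon_measures = {\<eta>. sets \<eta> = sets borel \<and> (\<forall>K. compact K \<longrightarrow> emeasure \<eta> K < \<infinity>)}"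

text \<open>No measurable set of positive measure is an atom.  For Radon measures on a locally compact
  Polish space this amounts to all singletons being null sets.\<close>

definition nonatomic :: "'a measure \<Rightarrow> bool" where
  "nonatomic \<sigma> \<longleftrightarrow> (\<forall>A \<in> sets \<sigma>. 0 < emeasure \<sigma> A \<longrightarrow>
     (\<exists>B \<in> sets \<sigma>. B \<subseteq> A \<and> 0 < emeasure \<sigma> B \<and> emeasure \<sigma> B < emeasure \<sigma> A))"

text \<open>The coarsest topology on the Radon measures making \<open>\<eta> \<mapsto> \<integral>f d\<eta>\<close> continuous for each continuous
  compactly supported \<open>f\<close>.\<close>

definition vague_topology :: "'a::topological_space measure topology" where
  "vague_topology = topology_generated_by
     {{\<eta> \<in> radon_measures. (LINT x|\<eta>. f x) \<in> U} | f U.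
        f \<in> compact_support_continuous \<and> open U}"

definition radon_space :: "'a::topological_space measure measure" where
  "radon_space = sigma radon_measures {U. openin vague_topology U}"

text \<open>The measure \<open>distr (point_measure D s) borel (\<lambda>x. x)\<close> is the sum over \<open>x \<in> D\<close> of \<open>s x\<close> times the
  Dirac measure at \<open>x\<close>: \<open>point_measure D s\<close> has this value on every subset of \<open>D\<close>, and
  \<open>distr\<close> transports it to the Borel sets.  The atoms are distinct because \<open>D\<close> is a set.\<close>

definition discrete_radon_measures :: "'a::topological_space measure set" where
  "discrete_radon_measures = {\<eta> \<in> radon_measures.
     \<exists>D s. countable D \<and> (\<forall>x\<in>D. 0 < s x) \<and>
       \<eta> = distr (point_measure D (\<lambda>x. ennreal (s x))) borel (\<lambda>x. x)}"

definition discrete_radon_space :: "'a::topological_space measure measure" where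
  "discrete_radon_space = restrict_space radon_space discrete_radon_measures"

text \<open>\<open>\<mu>\<close> is the law \<open>\<mu>\<^sub>m\<close> of the random discrete measure with intensity \<open>m\<close>; at most one \<open>\<mu>\<close>
  satisfies this.\<close>

definition is_mu :: "('a::topological_space \<times> real) measure \<Rightarrow> 'a measure measure \<Rightarrow> bool" where
  "is_mu m \<mu> \<longleftrightarrow> prob_space \<mu> \<and> sets \<mu> = sets discrete_radon_space \<and>
     (\<forall>f \<in> compact_support_continuous.
        (CLINT \<eta>|\<mu>. exp (\<i> * complex_of_real (LINT x|\<eta>. f x))) =
        exp (CLINT (x, s)|m. exp (\<i> * complex_of_real (s * f x)) - 1))"

definition gamma_intensity ::
  "('a \<Rightarrow> real) \<Rightarrow> ('a \<Rightarrow> real) \<Rightarrow> 'a measure \<Rightarrow> ('a \<times> real) measure" where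
  "gamma_intensity \<alpha> \<beta> \<sigma> =
     density (\<sigma> \<Otimes>\<^sub>M restrict_space lborel {0<..})
       (\<lambda>(x, s). ennreal (\<beta> x * exp (- s / \<alpha> x) / s))"

definition C0_pos :: "('a::topological_space \<Rightarrow> real) set" where
  "C0_pos = {\<theta>. continuous_on UNIV \<theta> \<and> (\<forall>x. 0 < \<theta> x) \<and>
     (\<exists>K. compact K \<and> (\<forall>x. x \<notin> K \<longrightarrow> \<theta> x = 1))}"

definition act :: "('a \<Rightarrow> real) \<Rightarrow> 'a measure \<Rightarrow> 'a measure" where
  "act \<theta> \<eta> = density \<eta> (\<lambda>x. ennreal (\<theta> x))"

definition pushforward_act ::
  "('a::topological_space \<Rightarrow> real) \<Rightarrow> 'a measure measure \<Rightarrow> 'a measure measure" where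
  "pushforward_act \<theta> \<mu> = distr \<mu> discrete_radon_space (act \<theta>)"

end

theory Submission
  imports Defs "HOL-Complex_Analysis.Complex_Analysis"
begin

text \<open>
Write \<open>\<langle>\<eta>, f\<rangle>\<close> for \<open>\<integral>f d\<eta>\<close>.  Multiplying every atom of \<open>\<eta>\<close> by \<open>\<theta>\<close> moves a point \<open>(x, s)\<close> of the intensity \<open>m\<close> to
\<open>(x, \<theta>(x) s)\<close>.  As \<open>ds/s\<close> is invariant under scaling, this replaces \<open>\<alpha>\<close> by \<open>\<alpha>\<theta>\<close> in the density of \<open>m\<close>, that is,
it multiplies this density by \<open>e\<^bsup>s h(x)\<^esup>\<close> with \<open>h = (1 - 1/\<theta>)/\<alpha>\<close>.  For laws whose characteristic functional
is the exponential of an integral over \<open>m\<close>, such a tilt of \<open>m\<close> amounts to the density \<open>exp(\<langle>\<eta>, h\<rangle> - c)\<close>,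
where \<open>c = \<integral>(e\<^bsup>s h(x)\<^esup> - 1) dm(x, s)\<close>.  Frullani's integral gives \<open>c = \<integral>log \<theta> \<cdot> \<beta> d\<sigma>\<close>.

(Off \<open>Y\<close>, where \<open>m\<close> has no mass, \<open>h\<close> is taken to be 0.)

The difficulty is that \<open>h\<close> and \<open>exp \<langle>\<eta>, h\<rangle>\<close> may be unbounded, that \<open>h\<close> need not be continuous, and that the
hypothesis describes only the expectations of \<open>exp(i\<langle>\<eta>, f\<rangle>)\<close> for test functions \<open>f\<close>.  The unboundedness is
avoided by splitting \<open>h = p - q\<close> into positive and negative part and by proving instead the equality
  \<open>e\<^bsup>-\<langle>\<eta>, p\<rangle>\<^esup> d\<mu>\<^sup>\<theta>(\<eta>) = e\<^bsup>-c - \<langle>\<eta>, q\<rangle>\<^esup> d\<mu>(\<eta>)\<close>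
of two finite measures, which is equivalent because both factors are positive.  This is
\<open>pushforward_act_eq_density\<close>; it rests on three facts.

\<^item> \<open>characteristic_functional_unique\<close>: a finite measure on the discrete Radon measures is determined by its
characteristic functional on test functions.  Second countability of the vague topology shows that the
Borel sets are generated by the maps \<open>\<eta> \<mapsto> \<langle>\<eta>, f\<rangle>\<close>, and the finite-dimensional distributions are handled one
coordinate at a time by Levy's uniqueness theorem on the line.

\<^item> \<open>laplace_functional\<close>: the formula for the characteristic functional persists for the expectation of \<open>exp(i\<langle>\<eta>, f\<rangle> - \<langle>\<eta>, k\<rangle>)\<close>, for all \<open>f\<close> and all
\<open>k \<ge> 0\<close> that are integrable with respect to the first moment measure \<open>\<Gamma> = \<alpha>\<beta>\<sigma>\<close>.  First, the mean of
\<open>\<langle>\<eta>, g\<rangle>\<close> is at most \<open>\<integral>g d\<Gamma>\<close> for \<open>g \<ge> 0\<close> (\<open>mean_nn_integral_le\<close>); hence both sides of the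
formula for the characteristic functional are continuous in \<open>L\<^sup>1(\<Gamma>)\<close>, in which test functions are dense
(\<open>csc_dense_L1\<close>).  Then both sides are analytic in \<open>z\<close> after replacing \<open>k\<close> by \<open>z k\<close>, and they agree on the
imaginary axis, so they agree on the right half plane (\<open>half_plane_boundary_uniqueness\<close>).

\<^item> \<open>\<Psi>_scaling\<close>: the computation with \<open>m\<close> just described, done pointwise in \<open>x\<close>.
\<close>

section \<open>Compactly supported continuous functions and exhaustions\<close>

abbreviation (input) C\<^sub>c :: "('a::topological_space \<Rightarrow> real) set" where
  "C\<^sub>c \<equiv> compact_support_continuous"

abbreviation (input) \<M> :: "'a::topological_space measure set" where
  "\<M> \<equiv> radon_measures"

abbreviation (input) \<K> :: "'a::topological_space measure set" where
  "\<K> \<equiv> discrete_radon_measures"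

text \<open>
The unqualified names denote the corresponding facts about the Henstock-Kurzweil integral.
\<close>

lemmas bochner_cong = Bochner_Integration.integral_cong
lemmas bochner_bound = Bochner_Integration.integrable_bound
lemmas bochner_nonneg = Bochner_Integration.integral_nonneg
lemmas bochner_diff = Bochner_Integration.integral_diff
lemmas bochner_integrable_diff = Bochner_Integration.integrable_diff
lemmas bochner_integrable_add = Bochner_Integration.integrable_add
lemmas bochner_add = Bochner_Integration.integral_add

lemma cscI:
  fixes f :: "'a::t2_space \<Rightarrow> real"
  assumes "continuous_on UNIV f" "compact K" "\<And>x. x \<notin> K \<Longrightarrow> f x = 0"
  shows "f \<in> C\<^sub>c"
proof -
  have "closure {x. f x \<noteq> 0} \<subseteq> K"
    using assms by (intro closure_minimal compact_imp_closed) auto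
  then have "compact (K \<inter> closure {x. f x \<noteq> 0})"
    using assms by (intro compact_Int_closed) auto
  then show ?thesis
    using assms(1) \<open>closure {x. f x \<noteq> 0} \<subseteq> K\<close>
    by (simp add: compact_support_continuous_def Int_absorb1)
qed

lemma cscE:
  fixes f :: "'a::t2_space \<Rightarrow> real"
  assumes "f \<in> C\<^sub>c"
  obtains K where "continuous_on UNIV f" "compact K" "\<And>x. x \<notin> K \<Longrightarrow> f x = 0"
proof (rule that)
  show "continuous_on UNIV f" "compact (closure {x. f x \<noteq> 0})"
    using assms by (auto simp: compact_support_continuous_def)
  show "f x = 0" if "x \<notin> closure {x. f x \<noteq> 0}" for x
    using that closure_subset[of "{x. f x \<noteq> 0}"] by auto
qed

lemma csc_cmult_add:
  fixes f g :: "'a::t2_space \<Rightarrow> real"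
  assumes "f \<in> C\<^sub>c" "g \<in> C\<^sub>c"
  shows "(\<lambda>x. a * f x + b * g x) \<in> C\<^sub>c"
proof -
  from assms(1) obtain K where "continuous_on UNIV f" "compact K" "\<And>x. x \<notin> K \<Longrightarrow> f x = 0"
    by (metis cscE)
  moreover from assms(2) obtain L where "continuous_on UNIV g" "compact L" "\<And>x. x \<notin> L \<Longrightarrow> g x = 0"
    by (metis cscE)
  ultimately show ?thesis
    by (intro cscI[where K = "K \<union> L"] continuous_intros) auto
qed

lemma csc_zero: "(\<lambda>x::'a::t2_space. 0) \<in> C\<^sub>c"
  by (rule cscI[where K = "{}"]) auto

lemma csc_mult:
  fixes f g :: "'a::t2_space \<Rightarrow> real"
  assumes "continuous_on UNIV g" "f \<in> C\<^sub>c"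
  shows "(\<lambda>x. g x * f x) \<in> C\<^sub>c"
  using assms(2)
proof (rule cscE)
  fix K assume "continuous_on UNIV f" "compact K" "\<And>x. x \<notin> K \<Longrightarrow> f x = 0"
  then show ?thesis
    using assms(1) by (intro cscI[where K = K] continuous_intros) auto
qed

lemma csc_max:
  fixes f g :: "'a::t2_space \<Rightarrow> real"
  assumes "f \<in> C\<^sub>c" "g \<in> C\<^sub>c"
  shows "(\<lambda>x. max (f x) (g x)) \<in> C\<^sub>c"
proof -
  from assms(1) obtain K where "continuous_on UNIV f" "compact K" "\<And>x. x \<notin> K \<Longrightarrow> f x = 0"
    by (metis cscE)
  moreover from assms(2) obtain L where "continuous_on UNIV g" "compact L" "\<And>x. x \<notin> L \<Longrightarrow> g x = 0"
    by (metis cscE)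
  ultimately show ?thesis
    by (intro cscI[where K = "K \<union> L"] continuous_intros) auto
qed

lemma csc_measurable:
  "f \<in> C\<^sub>c \<Longrightarrow> f \<in> borel_measurable borel"
  by (auto simp: compact_support_continuous_def intro: borel_measurable_continuous_onI)

lemma csc_bounded:
  fixes f :: "'a::t2_space \<Rightarrow> real"
  assumes "f \<in> C\<^sub>c"
  obtains C where "0 < C" "\<And>x. \<bar>f x\<bar> \<le> C"
  using assms
proof (rule cscE)
  fix K assume K: "continuous_on UNIV f" "compact K" "\<And>x. x \<notin> K \<Longrightarrow> f x = 0"
  have "bounded (f ` K)"
    using K by (intro compact_imp_bounded compact_continuous_image) (auto intro: continuous_on_subset)
  then obtain C where "C > 0" "\<And>x. x \<in> K \<Longrightarrow> \<bar>f x\<bar> \<le> C"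
    by (auto simp: bounded_pos)
  then show thesis
    using K(3) that[of C] by force
qed

lemma csc_integrable:
  fixes f :: "'a::t2_space \<Rightarrow> real"
  assumes "\<eta> \<in> \<M>" "f \<in> C\<^sub>c"
  shows "integrable \<eta> f"
proof -
  have [measurable_cong]: "sets \<eta> = sets borel"
    using assms by (auto simp: radon_measures_def)
  have [measurable]: "f \<in> borel_measurable borel"
    by (rule csc_measurable[OF assms(2)])
  obtain C where C: "0 < C" "\<And>x. \<bar>f x\<bar> \<le> C"
    using csc_bounded[OF assms(2)] by metis
  obtain K where K: "compact K" "\<And>x. x \<notin> K \<Longrightarrow> f x = 0"
    using cscE[OF assms(2)] by metis
  have [measurable]: "K \<in> sets borel"
    using K by (auto intro: borel_closed compact_imp_closed)
  have "integrable \<eta> (indicator K :: _ \<Rightarrow> real)"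
    using assms K by (auto simp: radon_measures_def integrable_indicator_iff Int_absorb2)
  then have "integrable \<eta> (\<lambda>x. C * indicator K x)"
    by simp
  then show ?thesis
    by (rule bochner_bound)
       (use C K in \<open>auto simp: indicator_def split: if_splits\<close>)
qed

text \<open>
The distance to the complement, capped at 1.  The whole space is treated separately because
\<open>infdist x {} = 0\<close>; the cap keeps the function monotone in \<open>U\<close> when \<open>U\<close> becomes the whole space.
\<close>

definition depth :: "'a::metric_space set \<Rightarrow> 'a \<Rightarrow> real" where
  "depth U x = (if U = UNIV then 1 else min 1 (infdist x (- U)))"

definition ramp :: "nat \<Rightarrow> 'a::metric_space set \<Rightarrow> 'a \<Rightarrow> real" where
  "ramp n U x = min 1 (real n * depth U x)"

lemma depth_nonneg: "0 \<le> depth U x"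
  by (simp add: depth_def infdist_nonneg)

lemma depth_outside: "x \<notin> U \<Longrightarrow> depth U x = 0"
  by (auto simp: depth_def)

lemma depth_pos: "open U \<Longrightarrow> x \<in> U \<Longrightarrow> 0 < depth U x"
  by (auto simp: depth_def closed_Compl intro!: infdist_pos_not_in_closed)

lemma depth_mono: "U \<subseteq> V \<Longrightarrow> depth U x \<le> depth V x"
proof -
  assume "U \<subseteq> V"
  then have "infdist x (- U) \<le> infdist x (- V)" if "V \<noteq> UNIV"
    using that by (intro infdist_mono) auto
  with \<open>U \<subseteq> V\<close> show ?thesis
    by (auto simp: depth_def min.coboundedI2)
qed

lemma continuous_depth: "continuous_on UNIV (depth U)"
  by (cases "U = UNIV") (auto simp: depth_def[abs_def] intro!: continuous_intros)

lemma ramp_bounds: "0 \<le> ramp n U x" "ramp n U x \<le> 1"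
  by (auto simp: ramp_def depth_nonneg)

lemma ramp_outside: "x \<notin> U \<Longrightarrow> ramp n U x = 0"
  by (simp add: ramp_def depth_outside)

lemma ramp_mono: "m \<le> n \<Longrightarrow> U \<subseteq> V \<Longrightarrow> ramp m U x \<le> ramp n V x"
  unfolding ramp_def by (intro min.mono order_refl mult_mono depth_mono depth_nonneg) auto

lemma continuous_ramp: "continuous_on UNIV (ramp n U)"
  unfolding ramp_def[abs_def] by (intro continuous_intros continuous_depth)

lemma ramp_eventually_one:
  assumes "open U" "x \<in> U"
  obtains N where "\<And>n. n \<ge> N \<Longrightarrow> ramp n U x = 1"
proof -
  obtain N :: nat where N: "1 / depth U x \<le> real N"
    using real_arch_simple by blast
  have "1 \<le> real n * depth U x" if "n \<ge> N" for n
    using N that depth_pos[OF assms] by (simp add: pos_divide_le_eq)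
      (meson depth_nonneg mult_right_mono of_nat_le_iff order_trans)
  then show thesis
    by (intro that[of N]) (simp add: ramp_def)
qed

lemma csc_ramp:
  assumes "compact (closure U)"
  shows "ramp n U \<in> C\<^sub>c"
  by (rule cscI[OF continuous_ramp assms])
     (meson closure_subset in_mono ramp_outside)

text \<open>
The relatively compact open sets cover the space; by the Lindelof property countably many suffice, and
their finite unions increase.
\<close>

lemma locally_compact_exhaustion:
  assumes "locally_compact_space (euclidean :: 'a::polish_space topology)"
  obtains E :: "nat \<Rightarrow> 'a::polish_space set" where
    "\<And>n. open (E n)" "\<And>n. compact (closure (E n))" "incseq E" "(\<Union>n. E n) = UNIV"
proof -
  define \<F> where "\<F> = {U::'a set. open U \<and> compact (closure U)}"
  have cov: "\<Union>\<F> = UNIV"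
  proof -
    have "\<exists>U\<in>\<F>. x \<in> U" for x
    proof -
      obtain U K where U: "open U" "compact K" "x \<in> U" "U \<subseteq> K"
        using assms by (simp add: locally_compact_space_def) metis
      then have "closure U \<subseteq> K"
        by (intro closure_minimal compact_imp_closed)
      with U have "compact (closure U)"
        by (metis closed_closure compact_Int_closed inf.absorb_iff2)
      with U show ?thesis by (auto simp: \<F>_def)
    qed
    then show ?thesis by auto
  qed
  obtain \<G> where \<G>: "\<G> \<subseteq> \<F>" "countable \<G>" "\<Union>\<G> = \<Union>\<F>"
    by (rule Lindelof[of \<F>]) (auto simp: \<F>_def)
  have "\<G> \<noteq> {}" using \<G> cov by auto
  define E where "E n = (\<Union>i\<le>n. from_nat_into \<G> i)" for n
  have F: "from_nat_into \<G> i \<in> \<F>" for i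
    using \<G> \<open>\<G> \<noteq> {}\<close> by (meson from_nat_into in_mono)
  show thesis
  proof
    show "open (E n)" for n using F by (auto simp: E_def \<F>_def)
    show "compact (closure (E n))" for n
    proof -
      have "closure (E n) \<subseteq> (\<Union>i\<le>n. closure (from_nat_into \<G> i))"
        using closure_subset by (intro closure_minimal closed_UN) (fastforce simp: E_def)+
      moreover have "compact (\<Union>i\<le>n. closure (from_nat_into \<G> i))"
        using F by (intro compact_UN) (auto simp: \<F>_def)
      ultimately show ?thesis
        by (metis closed_closure compact_Int_closed inf.absorb_iff2)
    qed
    show "incseq E" by (force simp: incseq_def E_def)
    have "(\<Union>n. E n) = \<Union>(range (from_nat_into \<G>))"
      by (auto simp: E_def)
    then show "(\<Union>n. E n) = UNIV"
      using \<G> \<open>\<G> \<noteq> {}\<close> cov by (simp add: range_from_nat_into)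
  qed
qed

locale exhaustion =
  fixes E :: "nat \<Rightarrow> 'a::polish_space set"
  assumes open_E: "\<And>n. open (E n)"
    and compact_E: "\<And>n. compact (closure (E n))"
    and incseq_E: "incseq E"
    and UN_E: "(\<Union>n. E n) = UNIV"
begin

lemma sets_E [measurable, simp]: "E n \<in> sets borel"
  using open_E by auto

lemma E_mono: "m \<le> n \<Longrightarrow> E m \<subseteq> E n"
  using incseq_E by (auto simp: incseq_def)

lemma in_E: obtains N where "\<And>n. n \<ge> N \<Longrightarrow> x \<in> E n"
  using UN_E E_mono by (metis UNIV_I UN_iff in_mono)

lemma E_finite: "\<eta> \<in> \<M> \<Longrightarrow> emeasure \<eta> (E n) < \<infinity>"
proof -
  assume "\<eta> \<in> \<M>"
  then have s: "sets \<eta> = sets borel" and "emeasure \<eta> (closure (E n)) < \<infinity>"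
    using compact_E by (auto simp: radon_measures_def)
  moreover have "emeasure \<eta> (E n) \<le> emeasure \<eta> (closure (E n))"
    by (intro emeasure_mono closure_subset) (auto simp: s)
  ultimately show ?thesis by (metis le_less_trans)
qed

text \<open>
For open \<open>U\<close> these test functions increase to the indicator of \<open>U\<close> as \<open>n\<close> grows.
\<close>

definition bump :: "nat \<Rightarrow> 'a set \<Rightarrow> 'a \<Rightarrow> real" where
  "bump n U = ramp n (U \<inter> E n)"

lemma csc_ramp_Int: "ramp m (U \<inter> E n) \<in> C\<^sub>c"
proof (rule csc_ramp)
  have "closure (U \<inter> E n) \<subseteq> closure (E n)" by (intro closure_mono) auto
  then show "compact (closure (U \<inter> E n))"
    using compact_E by (metis closed_closure compact_Int_closed inf.absorb_iff2)
qed

lemma csc_bump: "bump n U \<in> C\<^sub>c"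
  unfolding bump_def by (rule csc_ramp_Int)

lemma bump_mono: "m \<le> n \<Longrightarrow> bump m U x \<le> bump n U x"
  unfolding bump_def by (intro ramp_mono) (use E_mono in auto)

lemma bump_bounds: "0 \<le> bump n U x" "bump n U x \<le> 1"
  by (auto simp: bump_def ramp_bounds)

lemma bump_eventually:
  assumes "open U"
  obtains N where "\<And>n. n \<ge> N \<Longrightarrow> bump n U x = indicator U x"
proof (cases "x \<in> U")
  case True
  obtain N where N: "\<And>n. n \<ge> N \<Longrightarrow> x \<in> E n" using in_E[of x] by metis
  obtain M where M: "\<And>n. n \<ge> M \<Longrightarrow> ramp n (U \<inter> E N) x = 1"
    using ramp_eventually_one[of "U \<inter> E N" x] assms open_E N True by (metis IntI le_refl open_Int)
  show ?thesis
  proof (rule that[of "max M N"])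
    fix n assume n: "max M N \<le> n"
    then have "1 \<le> bump n U x"
      using ramp_mono[of n n "U \<inter> E N" "U \<inter> E n" x] M[of n] E_mono[of N n]
      by (auto simp: bump_def)
    then show "bump n U x = indicator U x"
      using bump_bounds(2)[of n U x] True by simp
  qed
next
  case False
  show ?thesis
    by (rule that[of 0]) (use False in \<open>auto simp: bump_def ramp_outside\<close>)
qed

lemma bump_LIMSEQ:
  assumes "open U"
  shows "(\<lambda>n. bump n U x) \<longlonglongrightarrow> indicator U x"
proof -
  obtain N where "\<And>n. n \<ge> N \<Longrightarrow> bump n U x = indicator U x"
    using bump_eventually[OF assms, of x] by metis
  then show ?thesis
    by (intro tendsto_eventually) (auto simp: eventually_sequentially)
qed

text \<open>
Countably many functions dominate all test functions: by compactness, one of the increasing functions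
\<open>bump n UNIV\<close> is at least 1/2 on the support.
\<close>

lemma csc_dominated:
  fixes f :: "'a \<Rightarrow> real"
  assumes "f \<in> C\<^sub>c"
  obtains c n :: nat where "\<And>x. \<bar>f x\<bar> \<le> real c * bump n UNIV x"
proof -
  obtain C where C: "0 < C" "\<And>x. \<bar>f x\<bar> \<le> C" using csc_bounded[OF assms] by metis
  obtain K where K: "compact K" "\<And>x. x \<notin> K \<Longrightarrow> f x = 0" using cscE[OF assms] by metis
  have "open {x. 1/2 < bump n UNIV x}" for n
    using csc_bump[of n UNIV]
    by (intro open_Collect_less continuous_intros) (auto simp: compact_support_continuous_def)
  moreover have "K \<subseteq> (\<Union>n. {x. 1/2 < bump n UNIV x})"
  proof
    fix x
    obtain N where "\<And>n. n \<ge> N \<Longrightarrow> bump n UNIV x = indicator UNIV x"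
      using bump_eventually[OF open_UNIV, of x] by metis
    then show "x \<in> (\<Union>n. {x. 1/2 < bump n UNIV x})"
      by (auto intro!: exI[of _ N])
  qed
  ultimately obtain S where S: "finite S" "K \<subseteq> (\<Union>n\<in>S. {x. 1/2 < bump n UNIV x})"
    using compactE_image[OF K(1), of UNIV "\<lambda>n. {x. 1/2 < bump n UNIV x}"] by auto
  define n where "n = Max (insert 0 S)"
  obtain c :: nat where c: "2 * C \<le> real c" using real_arch_simple by blast
  show thesis
  proof (rule that[of c n])
    fix x show "\<bar>f x\<bar> \<le> real c * bump n UNIV x"
    proof (cases "x \<in> K")
      case True
      then obtain i where "i \<in> S" "1/2 < bump i UNIV x" using S by auto
      moreover have "bump i UNIV x \<le> bump n UNIV x"
        using \<open>i \<in> S\<close> S by (intro bump_mono) (auto simp: n_def)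
      ultimately have "C \<le> real c * bump n UNIV x"
        using mult_mono[OF c, of "1/2" "bump n UNIV x"] by auto
      then show ?thesis using C(2)[of x] by auto
    next
      case False
      then show ?thesis using K bump_bounds[of n UNIV x] by auto
    qed
  qed
qed

end

section \<open>Measurability of integrals in the measure variable\<close>

lemma radon_sets: "\<eta> \<in> \<M> \<Longrightarrow> sets \<eta> = sets borel"
  by (simp add: radon_measures_def)

lemma radon_space': "\<eta> \<in> \<M> \<Longrightarrow> space \<eta> = UNIV"
  using sets_eq_imp_space_eq[OF radon_sets] by simp

lemma openin_vague_subset: "openin vague_topology U \<Longrightarrow> U \<subseteq> \<M>"
proof -
  assume "openin vague_topology U"
  then have "U \<subseteq> topspace vague_topology" by (rule openin_subset)
  then show ?thesis by (auto simp: vague_topology_def)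
qed

lemma space_radon_space [simp]: "space radon_space = \<M>"
  unfolding radon_space_def using openin_vague_subset
  by (intro space_measure_of) auto

lemma sets_radon_space: "sets radon_space = sigma_sets \<M> {U. openin vague_topology U}"
  unfolding radon_space_def using openin_vague_subset
  by (intro sets_measure_of) auto

lemma measurable_eval_csc:
  assumes "f \<in> C\<^sub>c"
  shows "(\<lambda>\<eta>. LINT x|\<eta>. f x) \<in> borel_measurable radon_space"
proof (rule borel_measurableI)
  fix S :: "real set" assume "open S"
  then have "openin vague_topology {\<eta> \<in> \<M>. (LINT x|\<eta>. f x) \<in> S}"
    unfolding vague_topology_def using assms
    by (intro topology_generated_by_Basis) auto
  moreover have "(\<lambda>\<eta>. LINT x|\<eta>. f x) -` S \<inter> space radon_space = {\<eta> \<in> \<M>. (LINT x|\<eta>. f x) \<in> S}"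
    by auto
  ultimately show "(\<lambda>\<eta>. LINT x|\<eta>. f x) -` S \<inter> space radon_space \<in> sets radon_space"
    by (simp add: sets_radon_space)
qed

context exhaustion
begin

text \<open>
This monotone limit carries measurability, and later the bound on the mean, from test functions to open sets.
\<close>

lemma emeasure_open_eq_SUP:
  fixes U :: "'a set"
  assumes "open U" and \<eta>: "\<eta> \<in> \<M>"
  shows "emeasure \<eta> U = (SUP n. ennreal (LINT x|\<eta>. bump n U x))"
proof -
  have [measurable_cong]: "sets \<eta> = sets borel" by (rule radon_sets[OF \<eta>])
  have [measurable]: "U \<in> sets borel" using assms by auto
  have [measurable]: "bump n U \<in> borel_measurable borel" for n
    by (rule csc_measurable[OF csc_bump])
  have "emeasure \<eta> U = (\<integral>\<^sup>+x. indicator U x \<partial>\<eta>)"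
    by simp
  also have "\<dots> = (\<integral>\<^sup>+x. (SUP n. ennreal (bump n U x)) \<partial>\<eta>)"
  proof (rule nn_integral_cong)
    fix x
    have "incseq (\<lambda>n. ennreal (bump n U x))"
      by (auto simp: incseq_def intro!: ennreal_leI bump_mono)
    moreover have "(\<lambda>n. ennreal (bump n U x)) \<longlonglongrightarrow> ennreal (indicator U x)"
      by (intro tendsto_ennrealI bump_LIMSEQ assms)
    ultimately have "ennreal (indicator U x) = (SUP n. ennreal (bump n U x))"
      by (intro LIMSEQ_unique[OF _ LIMSEQ_SUP])
    then show "indicator U x = (SUP n. ennreal (bump n U x))"
      by (simp only: ennreal_indicator)
  qed
  also have "\<dots> = (SUP n. \<integral>\<^sup>+x. ennreal (bump n U x) \<partial>\<eta>)"
    by (intro nn_integral_monotone_convergence_SUP)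
       (auto simp: incseq_def le_fun_def intro!: ennreal_leI bump_mono)
  also have "\<dots> = (SUP n. ennreal (LINT x|\<eta>. bump n U x))"
    by (intro SUP_cong refl nn_integral_eq_integral csc_integrable \<eta> csc_bump)
       (auto simp: bump_bounds)
  finally show ?thesis .
qed

lemma measurable_emeasure_open:
  fixes U :: "'a set"
  assumes "open U"
  shows "(\<lambda>\<eta>. emeasure \<eta> U) \<in> borel_measurable radon_space"
  using measurable_eval_csc[OF csc_bump] emeasure_open_eq_SUP[OF assms]
  by (subst measurable_cong[where g = "\<lambda>\<eta>. SUP n. ennreal (LINT x|\<eta>. bump n U x)"]) auto

text \<open>
Dynkin's argument, localized to \<open>E n\<close> so that complements can be taken by subtracting finite values.
\<close>

lemma measurable_emeasure_E:
  fixes A :: "'a set"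
  assumes "A \<in> sets borel"
  shows "(\<lambda>\<eta>. emeasure \<eta> (A \<inter> E n)) \<in> borel_measurable radon_space"
proof -
  have "Int_stable {S::'a set. open S}" by (auto simp: Int_stable_def)
  moreover have "{S::'a set. open S} \<subseteq> Pow UNIV" by auto
  moreover from assms have "A \<in> sigma_sets UNIV {S. open S}" by (simp add: sets_borel)
  ultimately show ?thesis
  proof (induction rule: sigma_sets_induct_disjoint)
    case (basic A)
    then show ?case by (intro measurable_emeasure_open) (auto simp: open_E)
  next
    case empty
    then show ?case by simp
  next
    case (compl A)
    have A: "A \<in> sets borel" using compl by (simp add: sets_borel)
    have "emeasure \<eta> ((UNIV - A) \<inter> E n) = emeasure \<eta> (E n) - emeasure \<eta> (A \<inter> E n)"
      if "\<eta> \<in> \<M>" for \<eta>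
    proof -
      have s: "sets \<eta> = sets borel" by (rule radon_sets[OF that])
      have "emeasure \<eta> (A \<inter> E n) \<le> emeasure \<eta> (E n)"
        by (intro emeasure_mono) (auto simp: s)
      with E_finite[OF that, of n] have "emeasure \<eta> (A \<inter> E n) \<noteq> \<infinity>"
        by (metis infinity_ennreal_def top.extremum_unique less_irrefl)
      then have "emeasure \<eta> (E n - A \<inter> E n) = emeasure \<eta> (E n) - emeasure \<eta> (A \<inter> E n)"
        using A by (intro emeasure_Diff) (auto simp: s)
      moreover have "E n - A \<inter> E n = (UNIV - A) \<inter> E n" by auto
      ultimately show ?thesis by simp
    qed
    then show ?case
      using measurable_emeasure_open[OF open_E[of n]] compl(2)
      by (subst measurable_cong[where g = "\<lambda>\<eta>. emeasure \<eta> (E n) - emeasure \<eta> (A \<inter> E n)"]) auto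
  next
    case (union A)
    have A: "A i \<in> sets borel" for i using union(2) by (auto simp: sets_borel)
    have "emeasure \<eta> ((\<Union>i. A i) \<inter> E n) = (\<Sum>i. emeasure \<eta> (A i \<inter> E n))"
      if "\<eta> \<in> \<M>" for \<eta>
    proof -
      have s: "sets \<eta> = sets borel" by (rule radon_sets[OF that])
      have "(\<Sum>i. emeasure \<eta> (A i \<inter> E n)) = emeasure \<eta> (\<Union>i. A i \<inter> E n)"
        using A union(1) by (intro suminf_emeasure) (auto simp: s disjoint_family_on_def)
      then show ?thesis by (simp add: Int_UN_distrib2)
    qed
    then show ?case
      using union(3)
      by (subst measurable_cong[where g = "\<lambda>\<eta>. \<Sum>i. emeasure \<eta> (A i \<inter> E n)"]) auto
  qed
qed

lemma emeasure_eq_SUP_E: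
  fixes A :: "'a set"
  assumes "A \<in> sets borel" and \<eta>: "\<eta> \<in> \<M>"
  shows "emeasure \<eta> A = (SUP n. emeasure \<eta> (A \<inter> E n))"
proof -
  have "(SUP n. emeasure \<eta> (A \<inter> E n)) = emeasure \<eta> (\<Union>n. A \<inter> E n)"
    using assms(1) incseq_E by (intro SUP_emeasure_incseq) (auto simp: radon_sets[OF \<eta>] incseq_def)
  moreover have "(\<Union>n. A \<inter> E n) = A" using UN_E by auto
  ultimately show ?thesis by simp
qed

lemma measurable_emeasure_radon:
  fixes A :: "'a set"
  assumes "A \<in> sets borel"
  shows "(\<lambda>\<eta>. emeasure \<eta> A) \<in> borel_measurable radon_space"
  using measurable_emeasure_E[OF assms] emeasure_eq_SUP_E[OF assms]
  by (subst measurable_cong[where g = "\<lambda>\<eta>. SUP n. emeasure \<eta> (A \<inter> E n)"]) auto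

lemma nn_integral_SUP_borel:
  fixes U :: "nat \<Rightarrow> 'a \<Rightarrow> ennreal"
  assumes "\<And>i. U i \<in> borel_measurable borel" "incseq U" "sets \<eta> = sets borel"
  shows "(\<integral>\<^sup>+x. (\<Squnion> (range U)) x \<partial>\<eta>) = (SUP i. \<integral>\<^sup>+x. U i x \<partial>\<eta>)"
proof -
  have "(\<integral>\<^sup>+x. (\<Squnion> (range U)) x \<partial>\<eta>) = (\<integral>\<^sup>+x. (SUP i. U i x) \<partial>\<eta>)"
    by (intro nn_integral_cong) (simp add: image_comp)
  also have "\<dots> = (SUP i. \<integral>\<^sup>+x. U i x \<partial>\<eta>)"
    using assms(1) measurable_cong_sets[OF assms(3) refl, of borel]
    by (intro nn_integral_monotone_convergence_SUP assms(2)) blast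
  finally show ?thesis .
qed

lemma measurable_nn_integral_radon:
  fixes f :: "'a \<Rightarrow> ennreal"
  assumes "f \<in> borel_measurable borel"
  shows "(\<lambda>\<eta>. \<integral>\<^sup>+x. f x \<partial>\<eta>) \<in> borel_measurable radon_space"
  using assms
proof (induction rule: borel_measurable_induct)
  case (cong f g)
  have "f = g"
  proof
    fix x show "f x = g x" using cong(3)[of x] by simp
  qed
  then show ?case using cong(4) by (simp only:)
next
  case (set A)
  then show ?case
    using measurable_emeasure_radon[OF set]
    by (subst measurable_cong[where g = "\<lambda>\<eta>. emeasure \<eta> A"]) (auto simp: radon_sets)
next
  case (mult u c)
  then show ?case
    by (subst measurable_cong[where g = "\<lambda>\<eta>. c * (\<integral>\<^sup>+x. u x \<partial>\<eta>)"])
       (auto simp: radon_sets cong: measurable_cong_sets intro!: nn_integral_cmult)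
next
  case (add u v)
  then show ?case
    by (subst measurable_cong[where g = "\<lambda>\<eta>. (\<integral>\<^sup>+x. v x \<partial>\<eta>) + (\<integral>\<^sup>+x. u x \<partial>\<eta>)"])
       (auto simp: radon_sets cong: measurable_cong_sets intro!: nn_integral_add)
next
  case (seq U)
  have "(\<lambda>\<eta>. SUP i. \<integral>\<^sup>+x. U i x \<partial>\<eta>) \<in> borel_measurable radon_space"
    using seq by (intro borel_measurable_SUP) auto
  moreover have "(\<lambda>\<eta>. \<integral>\<^sup>+x. (\<Squnion> (range U)) x \<partial>\<eta>) \<in> borel_measurable radon_space \<longleftrightarrow>
      (\<lambda>\<eta>. SUP i. \<integral>\<^sup>+x. U i x \<partial>\<eta>) \<in> borel_measurable radon_space"
    using seq(1,3) by (intro measurable_cong nn_integral_SUP_borel radon_sets) auto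
  ultimately show ?case by blast
qed

lemma measurable_integral_radon:
  fixes f :: "'a \<Rightarrow> real"
  assumes "f \<in> borel_measurable borel"
  shows "(\<lambda>\<eta>. LINT x|\<eta>. f x) \<in> borel_measurable radon_space"
proof -
  note [measurable] = assms
  have "(LINT x|\<eta>. f x) = (if (\<integral>\<^sup>+x. ennreal \<bar>f x\<bar> \<partial>\<eta>) < \<infinity>
      then enn2real (\<integral>\<^sup>+x. ennreal (f x) \<partial>\<eta>) - enn2real (\<integral>\<^sup>+x. ennreal (- f x) \<partial>\<eta>) else 0)"
    if "\<eta> \<in> \<M>" for \<eta>
  proof -
    have [measurable_cong]: "sets \<eta> = sets borel" by (rule radon_sets[OF that])
    have "integrable \<eta> f \<longleftrightarrow> (\<integral>\<^sup>+x. ennreal \<bar>f x\<bar> \<partial>\<eta>) < \<infinity>"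
      by (simp add: integrable_iff_bounded)
    then show ?thesis
      using real_lebesgue_integral_def[of \<eta> f] not_integrable_integral_eq[of \<eta> f] by auto
  qed
  moreover have "(\<lambda>\<eta>. if (\<integral>\<^sup>+x. ennreal \<bar>f x\<bar> \<partial>\<eta>) < \<infinity>
      then enn2real (\<integral>\<^sup>+x. ennreal (f x) \<partial>\<eta>) - enn2real (\<integral>\<^sup>+x. ennreal (- f x) \<partial>\<eta>) else 0)
      \<in> borel_measurable radon_space"
    using measurable_nn_integral_radon[of "\<lambda>x. ennreal \<bar>f x\<bar>"]
      measurable_nn_integral_radon[of "\<lambda>x. ennreal (f x)"]
      measurable_nn_integral_radon[of "\<lambda>x. ennreal (- f x)"]
    by measurable
  ultimately show ?thesis
    by (subst measurable_cong) auto
qed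

end

section \<open>The vague Borel sets are generated by integrals of test functions\<close>

context exhaustion
begin

text \<open>
A countable family of functions out of which every nonnegative test function is a supremum: rational
multiples of ramps of sets from a fixed countable base of the topology.
\<close>

definition elementary_ramps :: "('a \<Rightarrow> real) set" where
  "elementary_ramps = (\<lambda>(q, m, n, B) x. q * ramp m (B \<inter> E n) x) `
     (({0..} \<inter> \<rat>) \<times> UNIV \<times> UNIV \<times> (SOME \<B>. countable \<B> \<and> topological_basis \<B>))"

text \<open>
The maximum with 0 included, so that the empty list is covered and all values are nonnegative.
\<close>

definition max_list :: "('a \<Rightarrow> real) list \<Rightarrow> 'a \<Rightarrow> real" where
  "max_list gs x = foldr (\<lambda>g r. max (g x) r) gs 0"

lemma max_list_bounds:
  assumes "\<And>g. g \<in> set gs \<Longrightarrow> g x \<le> c" "0 \<le> c"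
  shows "max_list gs x \<le> c"
  using assms by (induction gs) (auto simp: max_list_def)

lemma max_list_ge: "g \<in> set gs \<Longrightarrow> g x \<le> max_list gs x" "0 \<le> max_list gs x"
  by (induction gs) (auto simp: max_list_def max.coboundedI2)

lemma csc_max_list: "set gs \<subseteq> C\<^sub>c \<Longrightarrow> max_list gs \<in> C\<^sub>c"
proof (induction gs)
  case Nil
  then show ?case using csc_zero by (simp add: max_list_def[abs_def])
next
  case (Cons g gs)
  have "max_list (g # gs) = (\<lambda>x. max (g x) (max_list gs x))"
    by (auto simp: max_list_def)
  then show ?case using Cons by (simp add: csc_max)
qed

lemma csc_elementary: "elementary_ramps \<subseteq> C\<^sub>c"
proof
  fix g assume "g \<in> elementary_ramps"
  then obtain q m n B where "g = (\<lambda>x. q * ramp m (B \<inter> E n) x)"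
    by (auto simp: elementary_ramps_def)
  then show "g \<in> C\<^sub>c"
    using csc_cmult_add[OF csc_ramp_Int[of m B n] csc_zero, of q 0] by simp
qed

lemma countable_elementary: "countable elementary_ramps"
  and basis_elementary: "\<And>U x. open U \<Longrightarrow> x \<in> U \<Longrightarrow>
    \<exists>B. B \<in> (SOME \<B>. countable \<B> \<and> topological_basis \<B>) \<and> open B \<and> x \<in> B \<and> B \<subseteq> (U :: 'a set)"
proof -
  let ?B = "SOME \<B>. countable \<B> \<and> topological_basis (\<B>::'a set set)"
  have *: "countable ?B \<and> topological_basis ?B"
    using ex_countable_basis by (rule someI_ex)
  show "countable elementary_ramps"
    unfolding elementary_ramps_def using *
    by (intro countable_image countable_SIGMA) (auto intro: countable_rat)
  show "\<exists>B. B \<in> ?B \<and> open B \<and> x \<in> B \<and> B \<subseteq> U" if "open U" "x \<in> U" for U :: "'a set" and x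
    using * that by (meson topological_basisE topological_basis_open)
qed

lemma elementary_below:
  assumes f: "f \<in> C\<^sub>c" and nn: "\<And>x. 0 \<le> f x"
    and c: "0 \<le> c" "c < f x"
  obtains g where "g \<in> elementary_ramps" "\<And>y. g y \<le> f y" "c < g x"
proof -
  obtain q where q: "q \<in> \<rat>" "c < q" "q < f x"
    using Rats_dense_in_real[OF c(2)] by auto
  have "open {y. q < f y}"
    using f by (intro open_Collect_less continuous_intros) (auto simp: compact_support_continuous_def)
  with q obtain B where B: "B \<in> (SOME \<B>. countable \<B> \<and> topological_basis \<B>)" "open B" "x \<in> B" "B \<subseteq> {y. q < f y}"
    using basis_elementary[of "{y. q < f y}" x] by auto
  obtain n where n: "x \<in> E n" using UN_E by auto
  obtain m where m: "ramp m (B \<inter> E n) x = 1"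
    using ramp_eventually_one[of "B \<inter> E n" x] B n open_E by (metis IntI le_refl open_Int)
  show thesis
  proof (rule that[of "\<lambda>y. q * ramp m (B \<inter> E n) y"])
    show "(\<lambda>y. q * ramp m (B \<inter> E n) y) \<in> elementary_ramps"
      unfolding elementary_ramps_def using q(1,2) c(1) B(1)
      by (intro image_eqI[where x = "(q, m, n, B)"]) auto
    show "q * ramp m (B \<inter> E n) y \<le> f y" for y
    proof (cases "y \<in> B")
      case True
      then have "q < f y" using B by auto
      moreover have "q * ramp m (B \<inter> E n) y \<le> q * 1"
        using q c by (intro mult_left_mono ramp_bounds) auto
      ultimately show ?thesis by simp
    next
      case False
      then show ?thesis by (simp add: ramp_outside nn)
    qed
    show "c < q * ramp m (B \<inter> E n) x" using q m by simp
  qed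
qed

text \<open>
Enumerating the elementary ramps below \<open>f\<close>, their successive maxima increase to \<open>f\<close>, so their integrals
converge by dominated convergence.  Thus a strict lower bound on \<open>\<integral>f d\<eta>\<close> is witnessed by a member of a
countable family of test functions.
\<close>

lemma csc_approx_from_below:
  fixes f :: "'a \<Rightarrow> real"
  assumes f: "f \<in> C\<^sub>c" and nn: "\<And>x. 0 \<le> f x"
    and \<eta>: "\<eta> \<in> \<M>" and a: "a < (LINT x|\<eta>. f x)"
  obtains gs where "gs \<in> lists elementary_ramps" "\<And>x. max_list gs x \<le> f x"
    "a < (LINT x|\<eta>. max_list gs x)"
proof -
  define \<F> where "\<F> = {g \<in> elementary_ramps. \<forall>x. g x \<le> f x}"
  have "(\<lambda>y. 0 * ramp 0 (B \<inter> E 0) y) \<in> \<F>"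
    if "B \<in> (SOME \<B>. countable \<B> \<and> topological_basis \<B>)" for B
  proof -
    have "(\<lambda>y. 0 * ramp 0 (B \<inter> E 0) y) \<in> elementary_ramps"
      unfolding elementary_ramps_def using that
      by (intro image_eqI[where x = "(0, 0, 0, B)"]) auto
    then show ?thesis using nn by (simp add: \<F>_def)
  qed
  then have "\<F> \<noteq> {}"
    using basis_elementary[of UNIV] by blast
  have "countable \<F>" unfolding \<F>_def using countable_elementary by auto
  define g where "g = from_nat_into \<F>"
  have g: "g i \<in> \<F>" for i
    unfolding g_def by (rule from_nat_into[OF \<open>\<F> \<noteq> {}\<close>])
  have g_range: "\<exists>i. g i = h" if "h \<in> \<F>" for h
    unfolding g_def using from_nat_into_surj[OF \<open>countable \<F>\<close> that] .
  define G where "G n = max_list (map g [0..<n])" for n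
  have G_le: "G n x \<le> f x" for n x
    unfolding G_def using g nn by (intro max_list_bounds) (auto simp: \<F>_def)
  have G_nn: "0 \<le> G n x" for n x
    unfolding G_def by (rule max_list_ge)
  have G_csc: "G n \<in> C\<^sub>c" for n
    unfolding G_def using g csc_elementary by (intro csc_max_list) (auto simp: \<F>_def)
  have lim: "(\<lambda>n. G n x) \<longlonglongrightarrow> f x" for x
  proof (rule LIMSEQ_I)
    fix r :: real assume "0 < r"
    show "\<exists>no. \<forall>n\<ge>no. norm (G n x - f x) < r"
    proof (cases "f x = 0")
      case True
      then have "G n x = 0" for n using G_le[of n x] G_nn[of n x] by simp
      with True \<open>0 < r\<close> show ?thesis by simp
    next
      case False
      with nn[of x] have "0 < f x" by simp
      then obtain h where h: "h \<in> elementary_ramps" "\<And>y. h y \<le> f y" "max 0 (f x - r) < h x"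
        using elementary_below[OF f nn, of "max 0 (f x - r)" x] \<open>0 < r\<close> by auto
      then obtain i where i: "g i = h" using g_range[of h] by (auto simp: \<F>_def)
      have "f x - r < G n x" if "n \<ge> Suc i" for n
      proof -
        have "h x \<le> G n x"
          unfolding G_def i[symmetric] using that by (intro max_list_ge) auto
        with h show ?thesis by auto
      qed
      then show ?thesis
        using G_le[of _ x] \<open>0 < r\<close> by (intro exI[of _ "Suc i"]) (simp add: abs_less_iff algebra_simps)
    qed
  qed
  note [measurable_cong] = radon_sets[OF \<eta>]
  have [measurable]: "f \<in> borel_measurable borel" "G n \<in> borel_measurable borel" for n
    using f G_csc by (auto intro: csc_measurable)
  have "(\<lambda>n. LINT x|\<eta>. G n x) \<longlonglongrightarrow> (LINT x|\<eta>. f x)"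
    using lim G_le G_nn
    by (intro integral_dominated_convergence[where w = f] csc_integrable[OF \<eta> f]) auto
  from order_tendstoD(1)[OF this a] obtain n where "a < (LINT x|\<eta>. G n x)"
    by (auto simp: eventually_sequentially)
  then show thesis
    using g G_le by (intro that[of "map g [0..<n]"]) (auto simp: G_def \<F>_def)
qed

text \<open>
Lower bounds on the integrals of finite maxima of elementary ramps, and upper bounds on the integrals of the
dominating functions; all bounds are rational.
\<close>

definition vague_subbase :: "'a measure set set" where
  "vague_subbase =
    (\<lambda>(gs, q). {\<eta> \<in> \<M>. q < (LINT x|\<eta>. max_list gs x)}) ` (lists elementary_ramps \<times> \<rat>) \<union>
    (\<lambda>(c::nat, n, q). {\<eta> \<in> \<M>. (LINT x|\<eta>. real c * bump n UNIV x) < q}) ` (UNIV \<times> UNIV \<times> \<rat>)"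

definition vague_base :: "'a measure set set" where
  "vague_base = (\<lambda>F. \<M> \<inter> \<Inter>F) ` {F. finite F \<and> F \<subseteq> vague_subbase}"

lemma countable_vague_subbase: "countable vague_subbase"
  unfolding vague_subbase_def
  by (intro countable_Un countable_image countable_SIGMA countable_lists countable_elementary countable_rat) auto

lemma countable_vague_base: "countable vague_base"
  unfolding vague_base_def
  by (intro countable_image countable_Collect_finite_subset countable_vague_subbase)

lemma vague_base_Int: "A \<in> vague_base \<Longrightarrow> B \<in> vague_base \<Longrightarrow> A \<inter> B \<in> vague_base"
  unfolding vague_base_def
proof clarify
  fix F G assume "finite F" "F \<subseteq> vague_subbase" "finite G" "G \<subseteq> vague_subbase"
  then show "\<M> \<inter> \<Inter>F \<inter> (\<M> \<inter> \<Inter>G)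
      \<in> (\<lambda>F. \<M> \<inter> \<Inter>F) ` {F. finite F \<and> F \<subseteq> vague_subbase}"
    by (intro image_eqI[where x = "F \<union> G"]) blast+
qed

text \<open>
A signed test function is \<open>f = (f + w) - w\<close> with a dominating \<open>w\<close> from the countable family.  A lower bound for
the integral of \<open>f + w \<ge> 0\<close> and an upper bound for that of \<open>w\<close> are both available in the subbase.
\<close>

lemma vague_base_nbhd:
  fixes f :: "'a \<Rightarrow> real"
  assumes f: "f \<in> C\<^sub>c" and \<eta>: "\<eta> \<in> \<M>"
    and a: "a < (LINT x|\<eta>. f x)"
  shows "\<exists>B \<in> vague_base. \<eta> \<in> B \<and> B \<subseteq> {\<eta> \<in> \<M>. a < (LINT x|\<eta>. f x)}"
proof -
  obtain c n :: nat where dom: "\<And>x. \<bar>f x\<bar> \<le> real c * bump n UNIV x"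
    using csc_dominated[OF f] by metis
  define w where "w = (\<lambda>x. real c * bump n UNIV x)"
  have w: "w \<in> C\<^sub>c"
    using csc_cmult_add[OF csc_bump[of n UNIV] csc_zero, of "real c"] by (simp add: w_def)
  have fw: "(\<lambda>x. f x + w x) \<in> C\<^sub>c"
    using csc_cmult_add[OF f w, of 1 1] by simp
  have add: "(LINT x|\<eta>'. f x + w x) = (LINT x|\<eta>'. f x) + (LINT x|\<eta>'. w x)" if "\<eta>' \<in> \<M>" for \<eta>'
    using csc_integrable[OF that f] csc_integrable[OF that w] by simp
  \<comment> \<open>If the integral of \<open>w\<close> is below \<open>b\<close> and that of \<open>f + w\<close> is above \<open>q > a + b\<close>, then that of \<open>f\<close> is above \<open>a\<close>.\<close>
  obtain b where b: "b \<in> \<rat>" "(LINT x|\<eta>. w x) < b" "b < (LINT x|\<eta>. f x + w x) - a"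
    using Rats_dense_in_real[of "LINT x|\<eta>. w x" "(LINT x|\<eta>. f x + w x) - a"] a add[OF \<eta>] by auto
  obtain q where q: "q \<in> \<rat>" "a + b < q" "q < (LINT x|\<eta>. f x + w x)"
    using Rats_dense_in_real[of "a + b" "LINT x|\<eta>. f x + w x"] b by auto
  have "0 \<le> f x + w x" for x using dom[of x] by (auto simp: w_def)
  then obtain gs where gs: "gs \<in> lists elementary_ramps" "\<And>x. max_list gs x \<le> f x + w x"
      "q < (LINT x|\<eta>. max_list gs x)"
    using csc_approx_from_below[OF fw _ \<eta> q(3)] by metis
  have gs_csc: "max_list gs \<in> C\<^sub>c"
    using gs(1) csc_elementary by (intro csc_max_list) auto
  define B1 where "B1 = {\<eta> \<in> \<M>. q < (LINT x|\<eta>. max_list gs x)}"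
  define B2 where "B2 = {\<eta> \<in> \<M>. (LINT x|\<eta>. w x) < b}"
  have "B1 \<in> vague_subbase"
    unfolding vague_subbase_def B1_def using gs(1) q(1)
    by (intro UnI1 image_eqI[where x = "(gs, q)"]) auto
  moreover have "B2 \<in> vague_subbase"
    unfolding vague_subbase_def B2_def w_def using b(1)
    by (intro UnI2 image_eqI[where x = "(c, n, b)"]) auto
  ultimately have "\<M> \<inter> \<Inter>{B1, B2} \<in> vague_base"
    unfolding vague_base_def by (intro image_eqI[OF refl]) auto
  moreover have "\<eta> \<in> \<M> \<inter> \<Inter>{B1, B2}"
    using \<eta> gs b by (auto simp: B1_def B2_def)
  moreover have "a < (LINT x|\<eta>'. f x)" if "\<eta>' \<in> B1" "\<eta>' \<in> B2" for \<eta>'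
  proof -
    have r: "\<eta>' \<in> \<M>" using that by (simp add: B1_def)
    have "(LINT x|\<eta>'. max_list gs x) \<le> (LINT x|\<eta>'. f x + w x)"
      by (intro integral_mono csc_integrable r gs_csc fw gs(2))
    with that q add[OF r] show ?thesis by (auto simp: B1_def B2_def)
  qed
  ultimately show ?thesis by (intro bexI[of _ "\<M> \<inter> \<Inter>{B1, B2}"]) auto
qed

text \<open>
For a subbasic open set given by a test function \<open>f\<close>, lower bounds for the integrals of \<open>f\<close> and \<open>- f\<close> combine to an
interval; intersections and unions are formal.  So the vague topology is second countable.
\<close>

lemma vague_open_nbhd:
  assumes "openin vague_topology U" "\<eta> \<in> U"
  shows "\<exists>B \<in> vague_base. \<eta> \<in> B \<and> B \<subseteq> (U :: 'a measure set)"
proof -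
  have "generate_topology_on {{\<eta> \<in> \<M>. (LINT x|\<eta>. f x) \<in> U} | f U.
        f \<in> (C\<^sub>c :: ('a \<Rightarrow> real) set) \<and> open U} U"
    using assms(1) by (simp add: vague_topology_def openin_topology_generated_by_iff)
  then show ?thesis using assms(2)
  proof (induction arbitrary: \<eta>)
    case Empty
    then show ?case by simp
  next
    case (Int a b)
    have "\<eta> \<in> a" "\<eta> \<in> b" using Int.prems by auto
    from Int.IH(1)[OF this(1)] Int.IH(2)[OF this(2)]
    obtain A B where AB: "A \<in> vague_base" "\<eta> \<in> A" "A \<subseteq> a" "B \<in> vague_base" "\<eta> \<in> B" "B \<subseteq> b"
      by blast
    then show ?case by (intro bexI[of _ "A \<inter> B"] vague_base_Int) blast+
  next
    case (UN K)
    then obtain k where k: "k \<in> K" "\<eta> \<in> k" by blast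
    from UN.IH[OF this] obtain B where "B \<in> vague_base" "\<eta> \<in> B" "B \<subseteq> k" by blast
    with k show ?case by blast
  next
    case (Basis s)
    then obtain f :: "'a \<Rightarrow> real" and V where f: "f \<in> C\<^sub>c" and V: "open V"
      and s: "s = {\<eta> \<in> \<M>. (LINT x|\<eta>. f x) \<in> V}" by blast
    have \<eta>: "\<eta> \<in> \<M>" and "(LINT x|\<eta>. f x) \<in> V" using Basis s by auto
    then obtain e where e: "e > 0" "\<And>y. dist y (LINT x|\<eta>. f x) < e \<Longrightarrow> y \<in> V"
      using V by (auto simp: open_dist)
    have f': "(\<lambda>x. - f x) \<in> C\<^sub>c"
      using csc_cmult_add[OF f csc_zero, of "-1"] by simp
    obtain A where A: "A \<in> vague_base" "\<eta> \<in> A" "A \<subseteq> {\<eta>' \<in> \<M>. (LINT x|\<eta>. f x) - e < (LINT x|\<eta>'. f x)}"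
      using vague_base_nbhd[OF f \<eta>, of "(LINT x|\<eta>. f x) - e"] e by auto
    obtain B where B: "B \<in> vague_base" "\<eta> \<in> B" "B \<subseteq> {\<eta>' \<in> \<M>. (LINT x|\<eta>. - f x) - e < (LINT x|\<eta>'. - f x)}"
      using vague_base_nbhd[OF f' \<eta>, of "(LINT x|\<eta>. - f x) - e"] e by auto
    have "A \<inter> B \<subseteq> s"
    proof
      fix \<eta>' assume "\<eta>' \<in> A \<inter> B"
      then have \<eta>': "\<eta>' \<in> \<M>" "(LINT x|\<eta>. f x) - e < (LINT x|\<eta>'. f x)"
          "(LINT x|\<eta>'. f x) < (LINT x|\<eta>. f x) + e"
        using A(3) B(3) by auto
      then have "(LINT x|\<eta>'. f x) \<in> V"
        by (intro e(2)) (simp add: dist_real_def abs_less_iff)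
      with \<eta>' show "\<eta>' \<in> s" by (simp add: s)
    qed
    with A B show ?case by (intro bexI[of _ "A \<inter> B"] vague_base_Int) blast+
  qed
qed

text \<open>
Vaguely open sets are countable unions of basic ones, so measurability may be tested on single test functions,
although the \<open>\<sigma>\<close>-algebra is defined by arbitrary open sets.
\<close>

lemma measurable_into_radon_space:
  assumes T: "T \<in> space N \<rightarrow> \<M>"
    and ev: "\<And>f :: 'a \<Rightarrow> real. f \<in> C\<^sub>c \<Longrightarrow> (\<lambda>\<omega>. LINT x|T \<omega>. f x) \<in> borel_measurable N"
  shows "T \<in> measurable N radon_space"
proof (rule measurable_sigma_sets[OF sets_radon_space])
  show "{U. openin vague_topology U} \<subseteq> Pow (\<M> :: 'a measure set)"
    using openin_vague_subset by auto
  show "T \<in> space N \<rightarrow> \<M>" by (rule T)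
  have sub: "{\<omega> \<in> space N. T \<omega> \<in> S} \<in> sets N" if S: "S \<in> vague_subbase" for S
  proof -
    consider (lower) gs q where "gs \<in> lists elementary_ramps"
        "S = {\<eta> \<in> \<M>. q < (LINT x|\<eta>. max_list gs x)}"
      | (upper) c n q where "S = {\<eta> \<in> \<M>. (LINT x|\<eta>. real c * bump n UNIV x) < q}"
    proof -
      from S consider "S \<in> (\<lambda>(gs, q). {\<eta> \<in> \<M>. q < (LINT x|\<eta>. max_list gs x)}) ` (lists elementary_ramps \<times> \<rat>)"
        | "S \<in> (\<lambda>(c::nat, n, q). {\<eta> \<in> \<M>. (LINT x|\<eta>. real c * bump n UNIV x) < q}) ` (UNIV \<times> UNIV \<times> \<rat>)"
        unfolding vague_subbase_def by blast
      then show thesis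
      proof cases
        case 1
        then obtain p where "p \<in> lists elementary_ramps \<times> \<rat>"
          "S = (case p of (gs, q) \<Rightarrow> {\<eta> \<in> \<M>. q < (LINT x|\<eta>. max_list gs x)})" by blast
        then show thesis using lower[of "fst p" "snd p"] by (simp add: case_prod_beta mem_Times_iff)
      next
        case 2
        then obtain p :: "nat \<times> nat \<times> real" where
          "S = (case p of (c, n, q) \<Rightarrow> {\<eta> \<in> \<M>. (LINT x|\<eta>. real c * bump n UNIV x) < q})" by blast
        then show thesis using upper[of "fst p" "fst (snd p)" "snd (snd p)"] by (simp add: case_prod_beta)
      qed
    qed
    then show ?thesis
    proof cases
      case lower
      then have "max_list gs \<in> C\<^sub>c"
        using csc_elementary by (intro csc_max_list) auto
      note [measurable] = ev[OF this]
      have "{\<omega> \<in> space N. T \<omega> \<in> S} = {\<omega> \<in> space N. q < (LINT x|T \<omega>. max_list gs x)}"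
        using T unfolding lower(2) by blast
      also have "\<dots> \<in> sets N" by measurable
      finally show ?thesis .
    next
      case upper
      have "(\<lambda>x. real c * bump n UNIV x) \<in> C\<^sub>c"
        using csc_cmult_add[OF csc_bump[of n UNIV] csc_zero, of "real c" 0] by simp
      note [measurable] = ev[OF this]
      have "{\<omega> \<in> space N. T \<omega> \<in> S} = {\<omega> \<in> space N. (LINT x|T \<omega>. real c * bump n UNIV x) < q}"
        using T unfolding upper by blast
      also have "\<dots> \<in> sets N" by measurable
      finally show ?thesis .
    qed
  qed
  have base: "{\<omega> \<in> space N. T \<omega> \<in> B} \<in> sets N" if B: "B \<in> vague_base" for B
  proof -
    obtain F where F: "finite F" "F \<subseteq> vague_subbase" "B = \<M> \<inter> \<Inter>F"
      using B by (auto simp: vague_base_def)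
    have "{\<omega> \<in> space N. T \<omega> \<in> B} = {\<omega> \<in> space N. \<forall>S\<in>F. T \<omega> \<in> S}"
      using T unfolding F(3) by blast
    also have "\<dots> \<in> sets N"
      using sub F by (intro sets.sets_Collect_finite_All) blast+
    finally show ?thesis .
  qed
  show "T -` U \<inter> space N \<in> sets N" if "U \<in> {U. openin vague_topology U}" for U
  proof -
    from that have U: "openin vague_topology U" by simp
    have "U = \<Union>{B \<in> vague_base. B \<subseteq> U}"
      using vague_open_nbhd[OF U] by blast
    then have "T -` U \<inter> space N = (\<Union>B\<in>{B \<in> vague_base. B \<subseteq> U}. {\<omega> \<in> space N. T \<omega> \<in> B})"
      by blast
    also have "\<dots> \<in> sets N"
    proof (rule sets.countable_UN')
      show "countable {B \<in> vague_base. B \<subseteq> U}"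
        by (rule countable_subset[OF _ countable_vague_base]) blast
    qed (use base in blast)
    finally show "T -` U \<inter> space N \<in> sets N" .
  qed
qed

text \<open>
A \<open>\<inter>\<close>-stable generator for the \<open>\<sigma>\<close>-algebra on the discrete Radon measures.
\<close>

definition cylinders :: "'a measure set set" where
  "cylinders = (\<lambda>L. {\<eta> \<in> \<K>. \<forall>(f, B) \<in> set L. (LINT x|\<eta>. f x) \<in> B}) `
     lists (C\<^sub>c \<times> sets borel)"

lemma space_discrete_radon_space [simp]: "space discrete_radon_space = \<K>"
  by (auto simp: discrete_radon_space_def space_restrict_space discrete_radon_measures_def)

lemma measurable_discrete_radon: 
  "f \<in> measurable radon_space N \<Longrightarrow> f \<in> measurable discrete_radon_space N"
  unfolding discrete_radon_space_def by (rule measurable_restrict_space1)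

lemma Int_stable_cylinders: "Int_stable cylinders"
proof (rule Int_stableI)
  fix A B assume "A \<in> cylinders" "B \<in> cylinders"
  then obtain L M where L: "L \<in> lists (C\<^sub>c \<times> sets borel)"
      "A = {\<eta> \<in> \<K>. \<forall>(f, B) \<in> set L. (LINT x|\<eta>. f x) \<in> B}"
    and M: "M \<in> lists (C\<^sub>c \<times> sets borel)"
      "B = {\<eta> \<in> \<K>. \<forall>(f, B) \<in> set M. (LINT x|\<eta>. f x) \<in> B}"
    by (auto simp: cylinders_def)
  show "A \<inter> B \<in> cylinders"
    unfolding cylinders_def by (rule image_eqI[of _ _ "L @ M"]) (use L M in auto)
qed

lemma sets_discrete_radon_space: "sets discrete_radon_space = sigma_sets \<K> cylinders"
proof
  have sub: "cylinders \<subseteq> Pow \<K>" by (auto simp: cylinders_def)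
  show "sigma_sets \<K> cylinders \<subseteq> sets discrete_radon_space"
  proof (subst space_discrete_radon_space[symmetric], rule sets.sigma_sets_subset, rule subsetI)
    fix A assume "A \<in> cylinders"
    then obtain L where L: "L \<in> lists (C\<^sub>c \<times> sets borel)"
      "A = {\<eta> \<in> \<K>. \<forall>(f, B) \<in> set L. (LINT x|\<eta>. f x) \<in> B}"
      by (auto simp: cylinders_def)
    have "{\<eta> \<in> space discrete_radon_space. \<forall>p \<in> set L. (LINT x|\<eta>. fst p x) \<in> snd p} \<in> sets discrete_radon_space"
    proof (rule sets.sets_Collect_finite_All)
      fix p assume "p \<in> set L"
      with L have p: "fst p \<in> C\<^sub>c" "snd p \<in> sets borel"
        by (auto simp: lists_eq_set)
      note [measurable] = measurable_discrete_radon[OF measurable_eval_csc[OF p(1)]] p(2)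
      show "{\<eta> \<in> space discrete_radon_space. (LINT x|\<eta>. fst p x) \<in> snd p} \<in> sets discrete_radon_space"
        by measurable
    qed simp
    then show "A \<in> sets discrete_radon_space"
      by (simp add: L(2) case_prod_beta)
  qed
  show "sets discrete_radon_space \<subseteq> sigma_sets \<K> cylinders"
  proof
    fix A :: "'a measure set" assume "A \<in> sets discrete_radon_space"
    then obtain B where B: "B \<in> sets radon_space" "A = \<K> \<inter> B"
      by (auto simp: discrete_radon_space_def sets_restrict_space)
    define N where "N = sigma \<K> cylinders"
    have N: "space N = \<K>" "sets N = sigma_sets \<K> cylinders"
      using sub by (auto simp: N_def)
    have "(\<lambda>\<eta>. \<eta>) \<in> measurable N radon_space"
    proof (rule measurable_into_radon_space)
      show "(\<lambda>\<eta>. \<eta>) \<in> space N \<rightarrow> \<M>"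
        by (auto simp: N discrete_radon_measures_def)
      fix f :: "'a \<Rightarrow> real" assume f: "f \<in> C\<^sub>c"
      show "(\<lambda>\<eta>. LINT x|\<eta>. f x) \<in> borel_measurable N"
      proof (rule measurableI)
        fix S :: "real set" assume "S \<in> sets borel"
        then have "{\<eta> \<in> \<K>. \<forall>(f, B) \<in> set [(f, S)]. (LINT x|\<eta>. f x) \<in> B} \<in> cylinders"
          unfolding cylinders_def using f by (intro imageI) auto
        moreover have "{\<eta> \<in> \<K>. \<forall>(f, B) \<in> set [(f, S)]. (LINT x|\<eta>. f x) \<in> B}
           = (\<lambda>\<eta>. LINT x|\<eta>. f x) -` S \<inter> space N" by (auto simp: N)
        ultimately show "(\<lambda>\<eta>. LINT x|\<eta>. f x) -` S \<inter> space N \<in> sets N"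
          by (auto simp: N)
      qed simp
    qed
    from measurable_sets[OF this B(1)] have "B \<inter> \<K> \<in> sets N" by (simp add: N)
    then show "A \<in> sigma_sets \<K> cylinders"
      by (simp add: N B(2) Int_commute)
  qed
qed

end

section \<open>Uniqueness of the characteristic functional\<close>

text \<open>
Levy's theorem is about probability measures; the total masses agree by taking \<open>t = 0\<close>, so it applies after
normalization.
\<close>

lemma finite_measure_char_eqI:
  fixes M N :: "real measure"
  assumes M: "finite_measure M" "sets M = sets borel" and N: "finite_measure N" "sets N = sets borel"
    and eq: "\<And>t. (CLINT x|M. iexp (t * x)) = (CLINT x|N. iexp (t * x))"
  shows "M = N"
proof -
  interpret M: finite_measure M by (rule M)
  interpret N: finite_measure N by (rule N)
  note [measurable_cong] = M(2) N(2)
  have sp: "space M = UNIV" "space N = UNIV"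
    using M N by (auto dest: sets_eq_imp_space_eq)
  define c where "c = measure M UNIV"
  have cN: "measure N UNIV = c"
    using eq[of 0] by (simp add: c_def sp)
  show ?thesis
  proof (cases "c = 0")
    case True
    have "emeasure M A = 0" "emeasure N A = 0" for A
      using M.bounded_measure[of A] N.bounded_measure[of A] True cN
      by (auto simp: c_def sp M.emeasure_eq_measure N.emeasure_eq_measure measure_le_0_iff)
    then show ?thesis by (intro measure_eqI) (simp_all add: M N)
  next
    case False
    then have c: "c > 0" by (simp add: c_def zero_less_measure_iff less_le)
    have dist: "real_distribution (density K (\<lambda>_. ennreal (1 / c)))"
      if "finite_measure K" "sets K = sets borel" "measure K UNIV = c" for K
    proof -
      interpret K: finite_measure K by (rule that)
      have sp: "space K = UNIV" using that(2) by (auto dest: sets_eq_imp_space_eq)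
      have "emeasure (density K (\<lambda>_. ennreal (1 / c))) UNIV = ennreal (1 / c) * emeasure K UNIV"
        using that(2) by (subst emeasure_density_const) auto
      also have "\<dots> = 1"
        using c that(3) by (simp add: K.emeasure_eq_measure ennreal_mult[symmetric])
      finally show ?thesis
        by (intro real_distribution.intro real_distribution_axioms.intro prob_spaceI)
           (simp_all add: sp that(2))
    qed
    have "density M (\<lambda>_. ennreal (1 / c)) = density N (\<lambda>_. ennreal (1 / c))"
    proof (rule Levy_uniqueness)
      show "real_distribution (density M (\<lambda>_. ennreal (1 / c)))" "real_distribution (density N (\<lambda>_. ennreal (1 / c)))"
        using dist[OF M] dist[OF N cN] by (simp_all add: c_def)
      show "char (density M (\<lambda>_. ennreal (1 / c))) = char (density N (\<lambda>_. ennreal (1 / c)))"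
        unfolding char_def using c by (simp add: integral_density eq del: of_real_mult)
    qed
    then have d: "ennreal (1 / c) * emeasure M A = ennreal (1 / c) * emeasure N A" if "A \<in> sets borel" for A
      using that by (metis M(2) N(2) emeasure_density_const)
    show ?thesis
    proof (rule measure_eqI)
      fix A assume "A \<in> sets M"
      then have "ennreal c * (ennreal (1 / c) * emeasure M A) = ennreal c * (ennreal (1 / c) * emeasure N A)"
        using d M by simp
      then show "emeasure M A = emeasure N A"
        using c by (simp add: mult.assoc[symmetric] ennreal_mult[symmetric])
    qed (simp add: M N)
  qed
qed

text \<open>
Levy's theorem for the images under \<open>g\<close> of the measures with density \<open>W\<close>.
\<close>

lemma weighted_vimage_eq:
  fixes W g :: "'b \<Rightarrow> real"
  assumes P: "finite_measure P" and Q: "finite_measure Q" and s: "sets P = sets Q"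
    and [measurable]: "W \<in> borel_measurable P" "g \<in> borel_measurable P" "B \<in> sets borel"
    and W: "\<And>x. 0 \<le> W x" "\<And>x. W x \<le> K"
    and eq: "\<And>t. (CLINT x|P. W x *\<^sub>R iexp (t * g x)) = (CLINT x|Q. W x *\<^sub>R iexp (t * g x))"
  shows "(LINT x|P. W x * indicator B (g x)) = (LINT x|Q. W x * indicator B (g x))"
proof -
  define D where "D R = distr (density R (\<lambda>x. ennreal (W x))) borel g" for R
  have [measurable]: "W \<in> borel_measurable Q" "g \<in> borel_measurable Q"
    using s by (auto cong: measurable_cong_sets)
  have meas[measurable]: "W \<in> borel_measurable R" "g \<in> borel_measurable R" if "sets R = sets P" for R
    using that by (auto cong: measurable_cong_sets)
  have fin: "finite_measure (D R)" if R: "finite_measure R" "sets R = sets P" for R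
  proof -
    interpret R: finite_measure R by (rule R)
    note [measurable] = meas[OF R(2)]
    have "(\<integral>\<^sup>+x. ennreal (W x) \<partial>R) \<le> (\<integral>\<^sup>+x. ennreal K \<partial>R)"
      by (intro nn_integral_mono ennreal_leI W)
    also have "\<dots> < \<infinity>"
      by (simp add: R.emeasure_eq_measure ennreal_mult[symmetric] ennreal_mult_less_top)
    finally have "emeasure (density R (\<lambda>x. ennreal (W x))) (space R) \<noteq> \<infinity>"
      by (simp add: emeasure_density cong: nn_integral_cong_simp)
    then have "finite_measure (density R (\<lambda>x. ennreal (W x)))"
      by (intro finite_measureI) simp
    then show ?thesis
      unfolding D_def by (intro finite_measure.finite_measure_distr) simp_all
  qed
  have int: "(LINT x|D R. F x) = (LINT x|R. W x *\<^sub>R F (g x))"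
    if "sets R = sets P" "F \<in> borel_measurable borel" for R and F :: "real \<Rightarrow> 'c::{banach, second_countable_topology}"
  proof -
    note [measurable] = meas[OF that(1)] that(2)
    show ?thesis
      unfolding D_def by (subst integral_distr) (simp_all add: integral_density W)
  qed
  have "D P = D Q"
  proof (rule finite_measure_char_eqI)
    fix t
    show "(CLINT x|D P. iexp (t * x)) = (CLINT x|D Q. iexp (t * x))"
      using eq[of t] s by (subst (1 2) int) simp_all
  qed (use P Q s fin in \<open>auto simp: D_def\<close>)
  then have "(LINT x|D P. indicator B x :: real) = (LINT x|D Q. indicator B x)" by simp
  then show ?thesis
    using s by (subst (asm) (1 2) int) simp_all
qed

text \<open>
A Cramer-Wold argument by induction on the number of coordinates.  Keeping a free exponential factor
\<open>exp(i f)\<close> in the statement makes the induction work: to add a condition \<open>g \<in> B\<close>, consider the nonnegative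
weights \<open>1\<close>, \<open>1 + cos f\<close> and \<open>1 + sin f\<close> on the event obtained so far.  With such a weight, the characteristic function
of \<open>g\<close> is a combination of integrals of \<open>exp(i (t g \<plusminus> f))\<close>, which are known by the induction hypothesis.
\<close>

lemma cylinder_iexp_eq:
  fixes V :: "('b \<Rightarrow> real) set"
  assumes P: "finite_measure P" and Q: "finite_measure Q" and s: "sets P = sets Q"
    and V: "\<And>f. f \<in> V \<Longrightarrow> f \<in> borel_measurable P"
    and lin: "\<And>f g a b. f \<in> V \<Longrightarrow> g \<in> V \<Longrightarrow> (\<lambda>x. a * f x + b * g x) \<in> V"
    and eq: "\<And>f. f \<in> V \<Longrightarrow> (CLINT x|P. iexp (f x)) = (CLINT x|Q. iexp (f x))"
    and L: "L \<in> lists (V \<times> sets borel)" and f: "f \<in> V"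
  shows "(CLINT x|P. indicator {x \<in> space P. \<forall>(g, B) \<in> set L. g x \<in> B} x *\<^sub>R iexp (f x)) =
         (CLINT x|Q. indicator {x \<in> space P. \<forall>(g, B) \<in> set L. g x \<in> B} x *\<^sub>R iexp (f x))"
  using L f
proof (induction L arbitrary: f rule: list.induct)
  case Nil
  have "space P = space Q" using s by (rule sets_eq_imp_space_eq)
  then have "(CLINT x|P. indicator (space P) x *\<^sub>R iexp (f x)) = (CLINT x|P. iexp (f x))"
       "(CLINT x|Q. indicator (space P) x *\<^sub>R iexp (f x)) = (CLINT x|Q. iexp (f x))"
    by (auto intro!: bochner_cong)
  then show ?case using eq[OF \<open>f \<in> V\<close>] by simp
next
  case (Cons p L)
  obtain g B where p: "p = (g, B)" by (cases p)
  have g: "g \<in> V" and B[measurable]: "B \<in> sets borel" and L: "L \<in> lists (V \<times> sets borel)"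
    using Cons.prems(1) by (auto simp: p)
  define C where "C = {x \<in> space P. \<forall>(g, B) \<in> set L. g x \<in> B}"
  have C[measurable]: "C \<in> sets P"
  proof -
    have "{x \<in> space P. fst p x \<in> snd p} \<in> sets P" if "p \<in> set L" for p
    proof -
      from that L have "fst p \<in> V" and [measurable]: "snd p \<in> sets borel" by (auto simp: lists_eq_set)
      note [measurable] = V[OF this(1)]
      show ?thesis by measurable
    qed
    then have "{x \<in> space P. \<forall>p \<in> set L. fst p x \<in> snd p} \<in> sets P"
      by (intro sets.sets_Collect_finite_All) auto
    then show ?thesis by (simp add: C_def case_prod_beta)
  qed
  note [measurable] = V[OF g] V[OF Cons.prems(2)]
  have IH: "(CLINT x|P. indicator C x *\<^sub>R iexp (h x)) = (CLINT x|Q. indicator C x *\<^sub>R iexp (h x))"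
    if "h \<in> V" for h
    using Cons.IH[OF L that] by (simp add: C_def)
  have bdd: "integrable P F" "integrable Q F"
    if "F \<in> borel_measurable P" "\<And>x. norm (F x) \<le> 2" for F :: "'b \<Rightarrow> 'c::{banach, second_countable_topology}"
  proof -
    have "F \<in> borel_measurable Q" using that(1) measurable_cong_sets[OF s refl, of borel] by blast
    with that show "integrable P F" "integrable Q F"
      by (auto intro: finite_measure.integrable_const_bound[OF P, of _ 2] finite_measure.integrable_const_bound[OF Q, of _ 2])
  qed
  \<comment> \<open>The three nonnegative weights span the real and imaginary parts of the indicator times the exponential.\<close>
  define W where "W a b x = indicator C x * (1 + a * cos (f x) + b * sin (f x))" for a b :: real and x
  have W_bounds: "0 \<le> W a b x" "W a b x \<le> 2"
    if "(a, b) \<in> {(0, 0), (1, 0), (0, 1)}" for a b x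
  proof -
    have "0 \<le> 1 + cos (f x)" "0 \<le> 1 + sin (f x)"
      using cos_ge_minus_one[of "f x"] sin_ge_minus_one[of "f x"] by linarith+
    then show "0 \<le> W a b x" "W a b x \<le> 2"
      using that by (auto simp: W_def indicator_def)
  qed
  have W: "(LINT x|P. W a b x * indicator B (g x)) = (LINT x|Q. W a b x * indicator B (g x))"
    if "(a, b) \<in> {(0, 0), (1, 0), (0, 1)}" for a b
  proof (rule weighted_vimage_eq[OF P Q s])
    show "W a b \<in> borel_measurable P" unfolding W_def[abs_def] by measurable
    show "0 \<le> W a b x" "W a b x \<le> 2" for x
      using W_bounds[OF that] by auto
    fix t
    define h where "h u x = t * g x + u * f x" for u x
    have h: "h u \<in> V" for u unfolding h_def using lin[OF g Cons.prems(2), of t u] .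
    note [measurable] = V[OF h]
    define G where "G u x = (indicator C x :: real) *\<^sub>R iexp (h u x)" for u x
    have decomp: "W a b x *\<^sub>R iexp (t * g x) =
        G 0 x + Complex (a/2) (- b/2) * G 1 x + Complex (a/2) (b/2) * G (-1) x" for x
    proof -
      have "iexp (h 1 x) = iexp (t * g x) * iexp (f x)" "iexp (h (-1) x) = iexp (t * g x) * iexp (- f x)"
        "iexp (h 0 x) = iexp (t * g x)"
      proof -
        have h_eqs: "h 1 x = t * g x + f x" "h (-1) x = t * g x + - f x" "h 0 x = t * g x"
          by (simp_all add: h_def)
        show "iexp (h 1 x) = iexp (t * g x) * iexp (f x)" "iexp (h (-1) x) = iexp (t * g x) * iexp (- f x)"
          "iexp (h 0 x) = iexp (t * g x)"
          unfolding h_eqs of_real_add distrib_left exp_add by (rule refl)+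
      qed
      note e = this
      have ee: "iexp (f x) = Complex (cos (f x)) (sin (f x))"
           "iexp (- f x) = Complex (cos (f x)) (- sin (f x))"
        by (simp_all add: complex_eq_iff Re_exp Im_exp)
      have c: "complex_of_real (1 + a * cos (f x) + b * sin (f x)) =
          1 + Complex (a/2) (- b/2) * iexp (f x) + Complex (a/2) (b/2) * iexp (- f x)"
        unfolding ee by (simp add: complex_eq_iff)
      have *: "k * ((1 + c * z + d * w) * x) = k * x + c * (k * (x * z)) + d * (k * (x * w))"
        for k c d x z w :: complex by (simp add: algebra_simps)
      have "W a b x *\<^sub>R iexp (t * g x) =
          of_real (indicator C x) * (complex_of_real (1 + a * cos (f x) + b * sin (f x)) * iexp (t * g x))"
        by (simp only: W_def scaleR_conv_of_real of_real_mult mult.assoc)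
      then show ?thesis
        unfolding G_def scaleR_conv_of_real e c * .
    qed
    have "(CLINT x|R. W a b x *\<^sub>R iexp (t * g x)) =
        (CLINT x|R. G 0 x) + Complex (a/2) (- b/2) * (CLINT x|R. G 1 x)
        + Complex (a/2) (b/2) * (CLINT x|R. G (-1) x)" if "R = P \<or> R = Q" for R
    proof -
      have m: "G u \<in> borel_measurable P" for u
        unfolding G_def[abs_def] by measurable
      have n: "norm (G u x) \<le> 2" for u x
        by (simp add: G_def indicator_def)
      have i: "integrable R (G u)" for u using bdd[OF m n] that by blast
      show ?thesis unfolding decomp by (simp add: i)
    qed
    moreover have "(CLINT x|P. G u x) = (CLINT x|Q. G u x)" for u
      unfolding G_def by (rule IH[OF h])
    ultimately show "(CLINT x|P. W a b x *\<^sub>R iexp (t * g x)) = (CLINT x|Q. W a b x *\<^sub>R iexp (t * g x))"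
      by simp
  qed measurable
  have split: "(CLINT x|R. indicator {x \<in> space P. \<forall>(g, B) \<in> set (p # L). g x \<in> B} x *\<^sub>R iexp (f x)) =
     Complex ((LINT x|R. W 1 0 x * indicator B (g x)) - (LINT x|R. W 0 0 x * indicator B (g x)))
       ((LINT x|R. W 0 1 x * indicator B (g x)) - (LINT x|R. W 0 0 x * indicator B (g x)))"
    if R: "R = P \<or> R = Q" for R
  proof -
    define F where "F x = (indicator C x :: real) *\<^sub>R (indicator B (g x) :: real) *\<^sub>R iexp (f x)" for x
    have F: "indicator {x \<in> space P. \<forall>(g, B) \<in> set (p # L). g x \<in> B} x *\<^sub>R iexp (f x) = F x" for x
      by (auto simp: indicator_def C_def p F_def)
    have i: "integrable R F"
    proof -
      have m: "F \<in> borel_measurable P"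
        unfolding F_def[abs_def] by measurable
      have n: "norm (F x) \<le> 2" for x
        by (simp add: F_def indicator_def)
      show ?thesis using bdd[OF m n] R by blast
    qed
    have iW: "integrable R (\<lambda>x. W a b x * indicator B (g x))" if "(a, b) \<in> {(0, 0), (1, 0), (0, 1)}" for a b
    proof -
      have m: "(\<lambda>x. W a b x * indicator B (g x)) \<in> borel_measurable P"
        unfolding W_def[abs_def] by measurable
      have n: "norm (W a b x * indicator B (g x)) \<le> 2" for x
        using W_bounds[OF that, of x] by (simp add: indicator_def)
      show ?thesis using R bdd[OF m n] by blast
    qed
    have "Re (F x) = W 1 0 x * indicator B (g x) - W 0 0 x * indicator B (g x)"
         "Im (F x) = W 0 1 x * indicator B (g x) - W 0 0 x * indicator B (g x)" for x
      by (simp_all add: F_def W_def indicator_def Re_exp Im_exp)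
    then have "Re (CLINT x|R. F x) = (LINT x|R. W 1 0 x * indicator B (g x)) - (LINT x|R. W 0 0 x * indicator B (g x))"
      "Im (CLINT x|R. F x) = (LINT x|R. W 0 1 x * indicator B (g x)) - (LINT x|R. W 0 0 x * indicator B (g x))"
      by (simp_all add: integral_Re[OF i, symmetric] integral_Im[OF i, symmetric] iW)
    then show ?thesis unfolding F by (simp only: complex_eq_iff complex.sel) 
  qed
  show ?case
    using W[of 0 0] W[of 1 0] W[of 0 1] split[of P] split[of Q] by simp
qed

context exhaustion
begin

text \<open>
The cylinders form a generator stable under intersection, so the finite-dimensional statement suffices.
\<close>

theorem characteristic_functional_unique:
  assumes P: "finite_measure P" "sets P = sets (discrete_radon_space :: 'a measure measure)"
    and Q: "finite_measure Q" "sets Q = sets (discrete_radon_space :: 'a measure measure)"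
    and eq: "\<And>f :: 'a \<Rightarrow> real. f \<in> C\<^sub>c \<Longrightarrow>
      (CLINT \<eta>|P. iexp (LINT x|\<eta>. f x)) = (CLINT \<eta>|Q. iexp (LINT x|\<eta>. f x))"
  shows "P = Q"
proof -
  interpret P: finite_measure P by (rule P)
  interpret Q: finite_measure Q by (rule Q)
  have sp: "space P = \<K>" "space Q = \<K>"
    using sets_eq_imp_space_eq[OF P(2)] sets_eq_imp_space_eq[OF Q(2)] by auto
  have rad: "\<eta> \<in> \<M>" if "\<eta> \<in> space P" for \<eta>
    using that sp by (auto simp: discrete_radon_measures_def)
  define V where "V = {F \<in> borel_measurable P. \<exists>f \<in> (C\<^sub>c :: ('a \<Rightarrow> real) set).
      \<forall>\<eta> \<in> \<M>. F \<eta> = (LINT x|\<eta>. f x)}"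
  have ev: "(\<lambda>\<eta>. LINT x|\<eta>. f x) \<in> V" if "f \<in> C\<^sub>c" for f :: "'a \<Rightarrow> real"
    using measurable_discrete_radon[OF measurable_eval_csc[OF that]] that
    by (auto simp: V_def measurable_cong_sets[OF P(2) refl])
  have cyl: "emeasure P A = emeasure Q A" if "A \<in> cylinders" for A
  proof -
    have "\<exists>L\<in>lists (C\<^sub>c \<times> sets borel).
        A = {\<eta> \<in> \<K>. \<forall>(f, B) \<in> set L. (LINT x|\<eta>. f x) \<in> B}"
      using that unfolding cylinders_def image_iff .
    then obtain L where L: "L \<in> lists (C\<^sub>c \<times> sets borel)"
      "A = {\<eta> \<in> \<K>. \<forall>(f, B) \<in> set L. (LINT x|\<eta>. f x) \<in> B}"
      by (rule bexE)
    define M where "M = map (\<lambda>(f, B). (\<lambda>\<eta>. LINT x|\<eta>. f x, B)) L"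
    have M: "M \<in> lists (V \<times> sets borel)" using L(1) ev by (auto simp: M_def lists_eq_set)
    have A: "A = {\<eta> \<in> space P. \<forall>(F, B) \<in> set M. F \<eta> \<in> B}" by (auto simp: L(2) M_def sp)
    have 0: "(\<lambda>\<eta>. 0) \<in> V" using ev[OF csc_zero] by simp
    have "(CLINT \<eta>|P. indicator A \<eta> *\<^sub>R iexp 0) = (CLINT \<eta>|Q. indicator A \<eta> *\<^sub>R iexp 0)"
      unfolding A
    proof (rule cylinder_iexp_eq[OF P(1) Q(1) _ _ _ _ M 0])
      show "sets P = sets Q" using P Q by simp
      show "F \<in> borel_measurable P" if "F \<in> V" for F using that by (simp add: V_def)
      show "(\<lambda>\<eta>. a * F \<eta> + b * G \<eta>) \<in> V" if FG: "F \<in> V" "G \<in> V" for F G a b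
      proof -
        obtain f where f: "f \<in> C\<^sub>c" "\<forall>\<eta> \<in> \<M>. F \<eta> = (LINT x|\<eta>. f x)"
          using FG(1) unfolding V_def by blast
        obtain g where g: "g \<in> C\<^sub>c" "\<forall>\<eta> \<in> \<M>. G \<eta> = (LINT x|\<eta>. g x)"
          using FG(2) unfolding V_def by blast
        have "\<forall>\<eta> \<in> \<M>. a * F \<eta> + b * G \<eta> = (LINT x|\<eta>. a * f x + b * g x)"
        proof
          fix \<eta> :: "'a measure" assume \<eta>: "\<eta> \<in> \<M>"
          show "a * F \<eta> + b * G \<eta> = (LINT x|\<eta>. a * f x + b * g x)"
            using csc_integrable[OF \<eta> f(1)] csc_integrable[OF \<eta> g(1)] f(2) g(2) \<eta> by simp
        qed
        then show ?thesis using FG csc_cmult_add[OF f(1) g(1), of a b] unfolding V_def by auto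
      qed
      show "(CLINT \<eta>|P. iexp (F \<eta>)) = (CLINT \<eta>|Q. iexp (F \<eta>))" if F: "F \<in> V" for F
      proof -
        obtain f where f: "f \<in> C\<^sub>c" "\<forall>\<eta> \<in> \<M>. F \<eta> = (LINT x|\<eta>. f x)"
          using F unfolding V_def by blast
        have "(CLINT \<eta>|R. iexp (F \<eta>)) = (CLINT \<eta>|R. iexp (LINT x|\<eta>. f x))" if "R = P \<or> R = Q" for R
          using that f rad sp by (intro bochner_cong) auto
        then show ?thesis using eq[OF f(1)] by auto
      qed
    qed
    moreover have "A \<in> sets P" "A \<in> sets Q"
      using that P(2) Q(2) sets_discrete_radon_space by (auto intro: sigma_sets.Basic)
    moreover have "integrable P (indicator A :: _ \<Rightarrow> real)" "integrable Q (indicator A :: _ \<Rightarrow> real)"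
      using \<open>A \<in> sets P\<close> \<open>A \<in> sets Q\<close> by (auto simp: P.emeasure_eq_measure Q.emeasure_eq_measure)
    ultimately have "complex_of_real (measure P A) = complex_of_real (measure Q A)"
      by (simp add: scaleR_conv_of_real del: of_real_indicator)
    then have "measure P A = measure Q A"
      by (simp only: of_real_eq_iff)
    then show ?thesis by (simp add: P.emeasure_eq_measure Q.emeasure_eq_measure)
  qed
  have "\<K> \<in> cylinders"
    unfolding cylinders_def by (intro image_eqI[where x = "[]"]) auto
  then show ?thesis
    using P Q cyl
    by (intro measure_eqI_generator_eq[OF Int_stable_cylinders, where \<Omega> = \<K> and A = "\<lambda>_. \<K>"])
       (auto simp: sets_discrete_radon_space cylinders_def)
qed

end

section \<open>Laplace transforms in the half plane, and density in L1\<close>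

text \<open>
The exponential is 1-Lipschitz on the left half plane.  The bounds on difference quotients and the continuity
of the exponent below come from this.
\<close>

lemma norm_exp_diff_le:
  fixes z w :: complex
  assumes "Re z \<le> 0" "Re w \<le> 0"
  shows "norm (exp z - exp w) \<le> norm (z - w)"
proof -
  have "norm (exp z - exp w) \<le> 1 * norm (z - w)"
  proof (rule field_differentiable_bound[where S = "{z. Re z \<le> 0}" and f' = exp])
    show "convex {z. Re z \<le> 0}" by (rule convex_halfspace_Re_le)
    show "(exp has_field_derivative exp z) (at z within {z. Re z \<le> 0})" for z :: complex
      by (rule DERIV_subset[OF DERIV_exp]) simp
  qed (use assms in auto)
  then show ?thesis by simp
qed

lemma norm_exp_minus_one_le:
  fixes z :: complex
  assumes "Re z \<le> 0"
  shows "norm (exp z - 1) \<le> norm z"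
  using norm_exp_diff_le[OF assms, of 0] by simp

text \<open>
Differentiation under the integral sign.  The difference quotients are bounded by \<open>b\<close> up to the boundary of the
half plane.  The constant \<open>d\<close> is 0 for expectations; it is 1 for the exponent of the characteristic functional,
where only \<open>exp(\<dots>) - 1\<close> is integrable if the intensity is infinite.
\<close>

lemma laplace_integral_differentiable:
  fixes a b :: "'b \<Rightarrow> real" and d z :: complex
  assumes [measurable]: "a \<in> borel_measurable M" "b \<in> borel_measurable M"
    and b: "\<And>x. x \<in> space M \<Longrightarrow> 0 \<le> b x" "integrable M b"
    and int0: "integrable M (\<lambda>x. exp (\<i> * a x) - d)"
    and z: "0 \<le> Re z"
  shows "integrable M (\<lambda>x. exp (\<i> * a x - z * b x) - d)"
    and "((\<lambda>z. CLINT x|M. exp (\<i> * a x - z * b x) - d) has_field_derivative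
       (CLINT x|M. - b x * exp (\<i> * a x - z * b x))) (at z within {z. 0 \<le> Re z})"
proof -
  let ?e = "\<lambda>(z :: complex) x. exp (\<i> * a x - z * b x)"
  have Re: "Re (\<i> * a x - z * b x) \<le> 0" if "0 \<le> Re z" "x \<in> space M" for z x
    using that b(1) by simp
  have lip: "norm (?e z x - ?e w x) \<le> norm (z - w) * b x"
    if "0 \<le> Re z" "0 \<le> Re w" "x \<in> space M" for z w :: complex and x
  proof -
    have "norm (?e z x - ?e w x) \<le>
        norm ((\<i> * a x - z * b x) - (\<i> * a x - w * b x))"
      using that by (intro norm_exp_diff_le Re)
    also have "(\<i> * a x - z * b x) - (\<i> * a x - w * b x) = (w - z) * b x"
      by (simp add: algebra_simps)
    also have "norm \<dots> = norm (z - w) * b x"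
      using b(1)[OF that(3)] by (simp add: norm_mult norm_minus_commute)
    finally show ?thesis .
  qed
  have int: "integrable M (\<lambda>x. ?e z x - d)" if "0 \<le> Re z" for z :: complex
  proof -
    have "integrable M (\<lambda>x. ?e z x - exp (\<i> * a x))"
    proof (rule bochner_bound)
      show "integrable M (\<lambda>x. norm z * b x)" using b(2) by simp
      show "AE x in M. norm (?e z x - exp (\<i> * a x)) \<le> norm (norm z * b x)"
      proof (rule AE_I2)
        fix x assume "x \<in> space M"
        with lip[OF that, of 0 x] b(1)[of x]
        show "norm (?e z x - exp (\<i> * a x)) \<le> norm (norm z * b x)" by simp
      qed
    qed measurable
    from bochner_integrable_add[OF this int0] show ?thesis by simp
  qed
  show "integrable M (\<lambda>x. ?e z x - d)" by (rule int[OF z])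
  show "((\<lambda>z. CLINT x|M. ?e z x - d) has_field_derivative
       (CLINT x|M. - b x * ?e z x)) (at z within {z. 0 \<le> Re z})"
    unfolding has_field_derivative_iff tendsto_at_iff_sequentially
  proof (intro allI impI)
    fix X assume "\<forall>i. X i \<in> {z. 0 \<le> Re z} - {z}" and lim: "X \<longlonglongrightarrow> z"
    then have X: "0 \<le> Re (X i)" "X i \<noteq> z" for i by auto
    define q where "q i x = (?e (X i) x - ?e z x) / (X i - z)" for i x
    have "(\<lambda>i. CLINT x|M. q i x) \<longlonglongrightarrow> (CLINT x|M. - b x * ?e z x)"
    proof (rule integral_dominated_convergence[where w = b])
      show "q i \<in> borel_measurable M" for i unfolding q_def[abs_def] by measurable
      show "AE x in M. (\<lambda>i. q i x) \<longlonglongrightarrow> - b x * ?e z x"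
      proof (rule AE_I2)
        fix x
        have "((\<lambda>y. ?e y x) has_field_derivative - b x * ?e z x) (at z)"
          by (auto intro!: derivative_eq_intros)
        from this[unfolded has_field_derivative_iff tendsto_at_iff_sequentially, rule_format, of X] X(2) lim
        show "(\<lambda>i. q i x) \<longlonglongrightarrow> - b x * ?e z x"
          by (simp add: comp_def q_def)
      qed
      show "AE x in M. norm (q i x) \<le> b x" for i
      proof (rule AE_I2)
        fix x assume "x \<in> space M"
        from lip[OF X(1)[of i] z this] X(2)[of i] show "norm (q i x) \<le> b x"
          unfolding q_def norm_divide by (subst pos_divide_le_eq) (simp_all add: mult.commute)
      qed
    qed (use b in simp_all)
    moreover have "(CLINT x|M. q i x) = ((CLINT x|M. ?e (X i) x - d) -
        (CLINT x|M. ?e z x - d)) / (X i - z)" for i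
    proof -
      have "(CLINT x|M. ?e (X i) x - d) - (CLINT x|M. ?e z x - d) =
          (CLINT x|M. (?e (X i) x - d) - (?e z x - d))"
        by (rule bochner_diff[symmetric]; rule int) (use X z in auto)
      then show ?thesis unfolding q_def by (simp only: integral_divide_zero) simp
    qed
    ultimately show "((\<lambda>y. ((CLINT x|M. ?e y x - d) -
        (CLINT x|M. ?e z x - d)) / (y - z)) \<circ> X)
        \<longlonglongrightarrow> (CLINT x|M. - b x * ?e z x)"
      by (simp only: comp_def)
  qed
qed

text \<open>
The difference vanishes on the imaginary axis; extended by 0 to the left half plane it is continuous, hence
entire because continuous functions are holomorphic across a line as soon as they are so on both sides.
Being zero on a half plane, it is zero.
\<close>

lemma half_plane_boundary_uniqueness:
  fixes F G :: "complex \<Rightarrow> complex"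
  assumes F: "\<And>z. 0 \<le> Re z \<Longrightarrow> (F has_field_derivative F' z) (at z within {z. 0 \<le> Re z})"
    and G: "\<And>z. 0 \<le> Re z \<Longrightarrow> (G has_field_derivative G' z) (at z within {z. 0 \<le> Re z})"
    and bd: "\<And>t. F (\<i> * of_real t) = G (\<i> * of_real t)"
    and z: "0 \<le> Re z"
  shows "F z = G z"
proof -
  define D where "D z = (if Re z \<le> 0 then 0 else F z - G z)" for z
  have bd': "F z = G z" if "Re z = 0" for z
  proof -
    have "z = \<i> * of_real (Im z)" using that by (simp add: complex_eq_iff)
    then show ?thesis using bd by metis
  qed
  have cont: "continuous_on {z. 0 \<le> Re z} (\<lambda>z. F z - G z)"
    by (intro continuous_on_diff DERIV_continuous_on[of _ F F'] DERIV_continuous_on[of _ G G'])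
       (use F G in auto)
  have "continuous_on UNIV D"
    unfolding D_def
  proof (rule continuous_on_cases_le)
    show "continuous_on {x \<in> UNIV. 0 \<le> Re x} (\<lambda>z. F z - G z)" using cont by simp
  qed (auto intro!: continuous_intros simp: bd')
  moreover have "D holomorphic_on {z. Re z < 0}"
    by (rule holomorphic_transform[of "\<lambda>_. 0"]) (auto simp: D_def)
  moreover have "D holomorphic_on {z. 0 < Re z}"
  proof (rule holomorphic_transform[of "\<lambda>z. F z - G z"])
    have "open {z. 0 < Re z}" by (rule open_halfspace_Re_gt)
    have hol: "H holomorphic_on {z. 0 < Re z}"
      if "\<And>z. 0 \<le> Re z \<Longrightarrow> (H has_field_derivative H' z) (at z within {z. 0 \<le> Re z})" for H H'
      unfolding holomorphic_on_def field_differentiable_def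
    proof (intro ballI exI)
      fix z :: complex assume "z \<in> {z. 0 < Re z}"
      then show "(H has_field_derivative H' z) (at z within {z. 0 < Re z})"
        by (intro DERIV_subset[OF that]) auto
    qed
    have "F holomorphic_on {z. 0 < Re z}" "G holomorphic_on {z. 0 < Re z}"
      by (rule hol, rule F, assumption, rule hol, rule G, assumption)
    then show "(\<lambda>z. F z - G z) holomorphic_on {z. 0 < Re z}"
      by (rule holomorphic_on_diff)
  qed (auto simp: D_def)
  ultimately have hol: "D holomorphic_on UNIV"
    using holomorphic_on_paste_across_line[of UNIV 1 D 0] by (simp add: inner_complex_def)
  have "D z = 0"
    by (rule analytic_continuation_open[of "{z. Re z < 0}" UNIV D "\<lambda>_. 0"])
       (use hol in \<open>auto simp: D_def open_halfspace_Re_lt intro!: exI[of _ "-1"]\<close>)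
  then show ?thesis using z bd'[of z] by (auto simp: D_def split: if_splits)
qed

context exhaustion
begin

text \<open>
The functions that can be approximated form a linear space closed under dominated limits (\<open>P_lin\<close> and \<open>P_lim\<close>).  It
contains the indicators of relatively compact open sets, hence by Dynkin's argument those of all Borel
subsets of \<open>E n\<close>.
\<close>

lemma csc_dense_L1:
  fixes f :: "'a \<Rightarrow> real"
  assumes R: "R \<in> \<M>" and f: "integrable R f" and e: "0 < e"
  shows "\<exists>g \<in> C\<^sub>c. (LINT x|R. \<bar>f x - g x\<bar>) < e"
proof -
  note [measurable_cong] = radon_sets[OF R]
  have sp: "space R = UNIV" by (rule radon_space'[OF R])
  \<comment> \<open>Integrability is part of the property, so that linearity and limits can be used without side conditions.\<close>
  define P where "P f \<longleftrightarrow> integrable R f \<and> (\<forall>e>0. \<exists>g \<in> C\<^sub>c. (LINT x|R. \<bar>f x - g x\<bar>) < e)"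
    for f :: "'a \<Rightarrow> real"
  have P_int: "P f \<Longrightarrow> integrable R f" for f by (simp add: P_def)
  have P_csc: "P f" if "f \<in> C\<^sub>c" for f
    using csc_integrable[OF R that] that by (auto simp: P_def intro!: bexI[of _ f])
  have P_lim: "P f" if "\<And>i::nat. P (s i)" "\<And>x. (\<lambda>i. s i x) \<longlonglongrightarrow> f x" "\<And>i x. \<bar>s i x\<bar> \<le> w x" "integrable R w"
      and [measurable]: "f \<in> borel_measurable R" for s f w
  proof -
    have s: "integrable R (s i)" for i using that(1) by (rule P_int)
    have w0: "\<bar>f x\<bar> \<le> w x" for x
      using that(2)[of x] that(3)[of _ x] by (intro LIMSEQ_le_const2[OF tendsto_rabs]) auto
    have f: "integrable R f"
      by (rule bochner_bound[OF that(4)]) (use w0 in \<open>auto intro!: AE_I2 order_trans[OF w0]\<close>)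
    have "(\<lambda>i. LINT x|R. \<bar>f x - s i x\<bar>) \<longlonglongrightarrow> (LINT x|R. 0)"
    proof (rule integral_dominated_convergence[where w = "\<lambda>x. 2 * w x"])
      show "AE x in R. (\<lambda>i. \<bar>f x - s i x\<bar>) \<longlonglongrightarrow> 0"
      proof (rule AE_I2)
        fix x
        have "(\<lambda>i. \<bar>f x - s i x\<bar>) \<longlonglongrightarrow> \<bar>f x - f x\<bar>"
          by (intro tendsto_intros that(2))
        then show "(\<lambda>i. \<bar>f x - s i x\<bar>) \<longlonglongrightarrow> 0" by simp
      qed
      show "AE x in R. norm \<bar>f x - s i x\<bar> \<le> 2 * w x" for i
      proof (rule AE_I2)
        fix x show "norm \<bar>f x - s i x\<bar> \<le> 2 * w x" using w0[of x] that(3)[of i x] by simp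
      qed
    qed (use s that(4) in auto)
    then have lim: "(\<lambda>i. LINT x|R. \<bar>f x - s i x\<bar>) \<longlonglongrightarrow> 0" by simp
    have "\<exists>g \<in> C\<^sub>c. (LINT x|R. \<bar>f x - g x\<bar>) < e" if "e > 0" for e
    proof -
      obtain i where i: "(LINT x|R. \<bar>f x - s i x\<bar>) < e / 2"
        using order_tendstoD(2)[OF lim, of "e / 2"] \<open>e > 0\<close> by (auto simp: eventually_sequentially)
      obtain g where g: "g \<in> C\<^sub>c" "(LINT x|R. \<bar>s i x - g x\<bar>) < e / 2"
        using \<open>P (s i)\<close> \<open>e > 0\<close> unfolding P_def by (meson half_gt_zero)
      have gi: "integrable R g" by (rule csc_integrable[OF R g(1)])
      have "(LINT x|R. \<bar>f x - g x\<bar>) \<le> (LINT x|R. \<bar>f x - s i x\<bar> + \<bar>s i x - g x\<bar>)"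
        by (intro integral_mono) (use f s gi in auto)
      also have "\<dots> = (LINT x|R. \<bar>f x - s i x\<bar>) + (LINT x|R. \<bar>s i x - g x\<bar>)"
        by (intro bochner_add) (use f s gi in auto)
      finally show ?thesis using i g by (intro bexI[of _ g]) auto
    qed
    then show "P f" using f by (simp add: P_def)
  qed
  have P_lin: "P (\<lambda>x. a * f x + b * g x)" if f: "P f" and g: "P g" for a b f g
  proof -
    have "\<exists>h \<in> C\<^sub>c. (LINT x|R. \<bar>a * f x + b * g x - h x\<bar>) < e" if "e > 0" for e
    proof -
      define \<delta> where "\<delta> = e / (\<bar>a\<bar> + \<bar>b\<bar> + 1)"
      have \<delta>: "\<delta> > 0" "(\<bar>a\<bar> + \<bar>b\<bar>) * \<delta> < e"
        using that by (auto simp: \<delta>_def field_simps add_pos_nonneg intro!: divide_pos_pos)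
      obtain u where u: "u \<in> C\<^sub>c" "(LINT x|R. \<bar>f x - u x\<bar>) < \<delta>"
        using f \<delta> unfolding P_def by blast
      obtain v where v: "v \<in> C\<^sub>c" "(LINT x|R. \<bar>g x - v x\<bar>) < \<delta>"
        using g \<delta> unfolding P_def by blast
      note i = P_int[OF f] P_int[OF g] csc_integrable[OF R u(1)] csc_integrable[OF R v(1)]
      have "(LINT x|R. \<bar>a * f x + b * g x - (a * u x + b * v x)\<bar>) \<le>
          (LINT x|R. \<bar>a\<bar> * \<bar>f x - u x\<bar> + \<bar>b\<bar> * \<bar>g x - v x\<bar>)"
      proof (rule integral_mono)
        fix x
        have "a * f x + b * g x - (a * u x + b * v x) = a * (f x - u x) + b * (g x - v x)"
          by (simp add: algebra_simps)
        also have "\<bar>\<dots>\<bar> \<le> \<bar>a\<bar> * \<bar>f x - u x\<bar> + \<bar>b\<bar> * \<bar>g x - v x\<bar>"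
          using abs_triangle_ineq[of "a * (f x - u x)" "b * (g x - v x)"] by (simp add: abs_mult)
        finally show "\<bar>a * f x + b * g x - (a * u x + b * v x)\<bar> \<le> \<bar>a\<bar> * \<bar>f x - u x\<bar> + \<bar>b\<bar> * \<bar>g x - v x\<bar>" .
      qed (use i in simp_all)
      also have "\<dots> = \<bar>a\<bar> * (LINT x|R. \<bar>f x - u x\<bar>) + \<bar>b\<bar> * (LINT x|R. \<bar>g x - v x\<bar>)"
        using i by simp
      also have "\<dots> \<le> \<bar>a\<bar> * \<delta> + \<bar>b\<bar> * \<delta>"
        using u v by (intro add_mono mult_left_mono) auto
      also have "\<dots> < e" using \<delta> by (simp add: algebra_simps)
      finally show ?thesis
        using csc_cmult_add[OF u(1) v(1), of a b] by (intro bexI[of _ "\<lambda>x. a * u x + b * v x"]) auto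
    qed
    then show ?thesis using P_int[OF f] P_int[OF g] by (simp add: P_def)
  qed
  have iE: "integrable R (\<lambda>x. indicator (E n) x :: real)" for n
    using E_finite[OF R, of n] by (simp add: sp)
  have PE: "P (indicator (A \<inter> E n))" if "A \<in> sets borel" for A n
  proof -
    have "Int_stable {S::'a set. open S}" by (auto simp: Int_stable_def)
    moreover have "{S::'a set. open S} \<subseteq> Pow UNIV" by auto
    moreover from that have "A \<in> sigma_sets UNIV {S. open S}" by (simp add: sets_borel)
    ultimately show ?thesis
    proof (induction rule: sigma_sets_induct_disjoint)
      case (basic A)
      then have op: "open (A \<inter> E n)" using open_E by auto
      then have [measurable]: "A \<inter> E n \<in> sets borel" by auto
      show ?case
      proof (rule P_lim[where s = "\<lambda>k. bump k (A \<inter> E n)" and w = "indicator (E n)"])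
        show "\<bar>bump i (A \<inter> E n) x\<bar> \<le> indicator (E n) x" for i x
          using bump_bounds[of i "A \<inter> E n" x] ramp_outside[of x "A \<inter> E n \<inter> E i"]
          by (auto simp: bump_def indicator_def)
      qed (auto intro: P_csc csc_bump bump_LIMSEQ op iE)
    next
      case empty
      have "indicator ({} \<inter> E n) = (\<lambda>x::'a. 0 :: real)" by auto
      then show ?case using P_csc[OF csc_zero] by simp
    next
      case (compl A)
      have 1: "P (indicator (E n))"
      proof (rule P_lim[where s = "\<lambda>k. bump k (E n)" and w = "indicator (E n)"])
        show "\<bar>bump i (E n) x\<bar> \<le> indicator (E n) x" for i x
          using bump_bounds[of i "E n" x] ramp_outside[of x "E n \<inter> E i"]
          by (auto simp: bump_def indicator_def)
      qed (auto intro: P_csc csc_bump bump_LIMSEQ open_E iE)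
      have "indicator ((UNIV - A) \<inter> E n) = (\<lambda>x. 1 * indicator (E n) x + (-1) * indicator (A \<inter> E n) x :: real)"
        by (auto simp: indicator_def fun_eq_iff)
      then show ?case using P_lin[OF 1 compl(2), of 1 "-1"] by simp
    next
      case (union A)
      have [measurable]: "A i \<in> sets borel" for i using union(2) by (auto simp: sets_borel)
      have disj: "\<And>i j. i \<noteq> j \<Longrightarrow> (A i \<inter> E n) \<inter> (A j \<inter> E n) = {}"
        using union(1) by (auto simp: disjoint_family_on_def)
      have UN: "(\<Union>i. A i) \<inter> E n = (\<Union>i. A i \<inter> E n)" by blast
      have sums: "(\<lambda>i. indicator (A i \<inter> E n) x :: real) sums indicator (\<Union>i. A i \<inter> E n) x" for x
        by (rule indicator_sums) (rule disj)
      show ?case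
      proof (rule P_lim[where s = "\<lambda>k x. \<Sum>i<k. indicator (A i \<inter> E n) x" and w = "indicator (E n)"])
        show "P (\<lambda>x. \<Sum>i<k. indicator (A i \<inter> E n) x)" for k
        proof (induction k)
          case 0
          then show ?case using P_csc[OF csc_zero] by simp
        next
          case (Suc k)
          then show ?case using P_lin[OF Suc union(3)[of k], of 1 1] by simp
        qed
        show "(\<lambda>k. \<Sum>i<k. indicator (A i \<inter> E n) x :: real) \<longlonglongrightarrow> indicator ((\<Union>i. A i) \<inter> E n) x" for x
          using sums[of x] unfolding sums_def UN .
        show "\<bar>\<Sum>i<k. indicator (A i \<inter> E n) x\<bar> \<le> (indicator (E n) x :: real)" for k x
        proof -
          have "(\<Sum>i<k. indicator (A i \<inter> E n) x :: real) \<le> (\<Sum>i. indicator (A i \<inter> E n) x)"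
            using sums[of x] by (intro sum_le_suminf) (auto simp: sums_iff)
          also have "\<dots> = indicator (\<Union>i. A i \<inter> E n) x" using sums[of x] by (simp only: sums_iff)
          also have "\<dots> \<le> indicator (E n) x" by (auto simp: indicator_def)
          finally show ?thesis by (simp add: sum_nonneg)
        qed
        show "integrable R (\<lambda>x. indicator (E n) x :: real)" by (rule iE)
        show "indicator ((\<Union>i. A i) \<inter> E n) \<in> borel_measurable R" by measurable
      qed
    qed
  qed
  have "P f" using f
  proof (induction rule: integrable_induct)
    case (base A c)
    have A[measurable]: "A \<in> sets borel" using base(1) radon_sets[OF R] by simp
    have "P (indicator A)"
    proof (rule P_lim[where s = "\<lambda>n. indicator (A \<inter> E n)" and w = "indicator A"])
      show "(\<lambda>n. indicator (A \<inter> E n) x) \<longlonglongrightarrow> (indicator A x :: real)" for x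
      proof -
        obtain N where "\<And>n. n \<ge> N \<Longrightarrow> x \<in> E n" using in_E[of x] by metis
        then have "\<forall>n\<ge>N. indicator (A \<inter> E n) x = (indicator A x :: real)" by (simp add: indicator_def)
        then show ?thesis by (intro tendsto_eventually) (auto simp: eventually_sequentially)
      qed
      show "\<bar>indicator (A \<inter> E n) x\<bar> \<le> (indicator A x :: real)" for n x by (simp add: indicator_def)
      show "integrable R (indicator A :: _ \<Rightarrow> real)" using base by (simp add: sp)
    qed (use PE[OF A] in auto)
    from P_lin[OF this this, of c 0] show ?case by (simp add: mult.commute)
  next
    case (add f g)
    then show ?case using P_lin[of f g 1 1] by simp
  next
    case (lim f s)
    show ?case
    proof (rule P_lim[where s = s and w = "\<lambda>x. 2 * norm (f x)"])
      show "integrable R (\<lambda>x. 2 * norm (f x))" using lim by simp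
      show "\<bar>s i x\<bar> \<le> 2 * norm (f x)" for i x using lim(3)[of x i] by (simp add: sp)
    qed (use lim in \<open>auto simp: sp\<close>)
  qed
  then show ?thesis using e by (simp add: P_def)
qed

end

section \<open>The first moment of a random measure with given characteristic functional\<close>

text \<open>
A random discrete measure whose characteristic functional is given by an intensity \<open>m\<close> with a locally finite
first moment.  The measure \<open>\<Gamma>\<close> on the space is the first moment of \<open>m\<close> in the second coordinate; only this
moment enters the estimates.
\<close>

locale discrete_law = exhaustion E
  for E :: "nat \<Rightarrow> 'a::polish_space set" +
  fixes m :: "('a \<times> real) measure" and \<mu> :: "'a measure measure" and \<Gamma> :: "'a measure"
  assumes measurable_fst_m [measurable]: "fst \<in> measurable m borel"
    and measurable_snd_m [measurable]: "snd \<in> borel_measurable m"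
    and snd_pos: "\<And>p. p \<in> space m \<Longrightarrow> 0 < snd p"
    and moment: "\<And>g. g \<in> borel_measurable borel \<Longrightarrow>
      (\<integral>\<^sup>+p. ennreal (snd p) * g (fst p) \<partial>m) = (\<integral>\<^sup>+x. g x \<partial>\<Gamma>)"
    and radon_\<Gamma>: "\<Gamma> \<in> \<M>"
    and law: "is_mu m \<mu>"
begin

lemma sets_\<Gamma>: "sets \<Gamma> = sets borel"
  by (rule radon_sets[OF radon_\<Gamma>])

lemma prob_\<mu>: "prob_space \<mu>"
  using law by (simp add: is_mu_def)

sublocale \<mu>: prob_space \<mu>
  by (rule prob_\<mu>)

lemma sets_\<mu>: "sets \<mu> = sets discrete_radon_space"
  using law by (simp add: is_mu_def)

lemma space_\<mu>: "space \<mu> = \<K>"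
  using sets_eq_imp_space_eq[OF sets_\<mu>] by simp

lemma radon_\<mu>: "\<eta> \<in> space \<mu> \<Longrightarrow> \<eta> \<in> \<M>"
  by (simp add: space_\<mu> discrete_radon_measures_def)

lemma measurable_\<mu>_iff: "F \<in> measurable \<mu> N \<longleftrightarrow> F \<in> measurable discrete_radon_space N"
  by (simp add: measurable_cong_sets[OF sets_\<mu> refl])

lemma measurable_integral_\<mu> [measurable]:
  fixes f :: "'a \<Rightarrow> real"
  shows "f \<in> borel_measurable borel \<Longrightarrow> (\<lambda>\<eta>. LINT x|\<eta>. f x) \<in> borel_measurable \<mu>"
  unfolding measurable_\<mu>_iff by (intro measurable_discrete_radon measurable_integral_radon)

lemma measurable_nn_integral_\<mu> [measurable]:
  fixes f :: "'a \<Rightarrow> ennreal"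
  shows "f \<in> borel_measurable borel \<Longrightarrow> (\<lambda>\<eta>. \<integral>\<^sup>+x. f x \<partial>\<eta>) \<in> borel_measurable \<mu>"
  unfolding measurable_\<mu>_iff by (intro measurable_discrete_radon measurable_nn_integral_radon)

text \<open>
The logarithm of the expectation of \<open>exp(\<integral>w d\<eta>)\<close>, for \<open>w\<close> with values in the left half plane
(see \<open>laplace_functional\<close>).
\<close>

definition \<Psi> :: "('a \<Rightarrow> complex) \<Rightarrow> complex" where
  "\<Psi> w = (CLINT p|m. exp (complex_of_real (snd p) * w (fst p)) - 1)"

lemma characteristic_functional_csc:
  assumes "f \<in> C\<^sub>c"
  shows "(CLINT \<eta>|\<mu>. iexp (LINT x|\<eta>. f x)) = exp (\<Psi> (\<lambda>x. \<i> * f x))"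
proof -
  have "(CLINT \<eta>|\<mu>. iexp (LINT x|\<eta>. f x)) = exp (CLINT (x, s)|m. exp (\<i> * complex_of_real (s * f x)) - 1)"
    using law assms by (simp add: is_mu_def)
  also have "(CLINT (x, s)|m. exp (\<i> * complex_of_real (s * f x)) - 1) = \<Psi> (\<lambda>x. \<i> * f x)"
    unfolding \<Psi>_def by (intro bochner_cong) (auto simp: mult_ac)
  finally show ?thesis .
qed

lemma moment_integrable:
  fixes g :: "'a \<Rightarrow> real"
  assumes g: "integrable \<Gamma> g"
  shows "integrable m (\<lambda>p. snd p * \<bar>g (fst p)\<bar>)" "(LINT p|m. snd p * \<bar>g (fst p)\<bar>) = (LINT x|\<Gamma>. \<bar>g x\<bar>)"
proof -
  have g_meas[measurable]: "g \<in> borel_measurable borel"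
    using borel_measurable_integrable[OF g] by (simp add: measurable_cong_sets[OF sets_\<Gamma> refl])
  have "(\<integral>\<^sup>+p. ennreal (snd p * \<bar>g (fst p)\<bar>) \<partial>m) = (\<integral>\<^sup>+p. ennreal (snd p) * ennreal \<bar>g (fst p)\<bar> \<partial>m)"
    by (intro nn_integral_cong) (use snd_pos in \<open>auto simp: ennreal_mult less_imp_le\<close>)
  also have "\<dots> = (\<integral>\<^sup>+x. ennreal \<bar>g x\<bar> \<partial>\<Gamma>)" by (rule moment) measurable
  also have "\<dots> = ennreal (LINT x|\<Gamma>. \<bar>g x\<bar>)"
    using g by (intro nn_integral_eq_integral) auto
  finally have eq: "(\<integral>\<^sup>+p. ennreal (snd p * \<bar>g (fst p)\<bar>) \<partial>m) = ennreal (LINT x|\<Gamma>. \<bar>g x\<bar>)" .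
  have nn: "AE p in m. 0 \<le> snd p * \<bar>g (fst p)\<bar>"
    using snd_pos by (intro AE_I2) (auto simp: less_imp_le)
  show i: "integrable m (\<lambda>p. snd p * \<bar>g (fst p)\<bar>)"
    by (rule integrableI_nonneg[OF _ nn]) (use eq in auto)
  have "ennreal (LINT p|m. snd p * \<bar>g (fst p)\<bar>) = ennreal (LINT x|\<Gamma>. \<bar>g x\<bar>)"
    using eq nn_integral_eq_integral[OF i nn] by simp
  then show "(LINT p|m. snd p * \<bar>g (fst p)\<bar>) = (LINT x|\<Gamma>. \<bar>g x\<bar>)"
    using integral_nonneg_AE[OF nn] by simp
qed

text \<open>
Since \<open>|exp(s w) - exp(s v)| \<le> s |w - v|\<close>, the exponent is continuous for the norm of \<open>L\<^sup>1(\<Gamma>)\<close>.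
\<close>

lemma \<Psi>_Lipschitz:
  assumes [measurable]: "w \<in> borel_measurable borel" "v \<in> borel_measurable borel"
    and w: "\<And>x. Re (w x) \<le> 0" "integrable \<Gamma> w" and v: "\<And>x. Re (v x) \<le> 0" "integrable \<Gamma> v"
  shows "norm (\<Psi> w - \<Psi> v) \<le> (LINT x|\<Gamma>. norm (w x - v x))"
    and "integrable m (\<lambda>p. exp (complex_of_real (snd p) * w (fst p)) - 1)"
proof -
  let ?e = "\<lambda>w p. exp (complex_of_real (snd p) * w (fst p)) - 1"
  have int: "integrable m (\<lambda>p. ?e w p)"
    if [measurable]: "w \<in> borel_measurable borel" and w: "\<And>x. Re (w x) \<le> 0" "integrable \<Gamma> w" for w
  proof (rule bochner_bound)
    show "integrable m (\<lambda>p. snd p * \<bar>norm (w (fst p))\<bar>)"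
      using w by (intro moment_integrable) auto
    show "AE p in m. norm (?e w p) \<le> norm (snd p * \<bar>norm (w (fst p))\<bar>)"
    proof (rule AE_I2)
      fix p assume p: "p \<in> space m"
      have "norm (?e w p) \<le> norm (complex_of_real (snd p) * w (fst p))"
        using w(1)[of "fst p"] snd_pos[OF p] by (intro norm_exp_minus_one_le) (simp add: mult_nonneg_nonpos)
      then show "norm (?e w p) \<le> norm (snd p * \<bar>norm (w (fst p))\<bar>)"
        by (simp add: norm_mult)
    qed
  qed measurable
  show "integrable m (\<lambda>p. ?e w p)" by (rule int) fact+
  have d: "integrable \<Gamma> (\<lambda>x. norm (w x - v x))" using w v by auto
  have "norm (\<Psi> w - \<Psi> v) = norm (CLINT p|m. ?e w p - ?e v p)"
    unfolding \<Psi>_def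
    by (subst bochner_diff[OF int int]) (use w v in auto)
  also have "\<dots> \<le> (LINT p|m. snd p * \<bar>norm (w (fst p) - v (fst p))\<bar>)"
  proof (rule order_trans[OF integral_norm_bound integral_mono])
    show "integrable m (\<lambda>p. snd p * \<bar>norm (w (fst p) - v (fst p))\<bar>)"
      by (rule moment_integrable(1)[OF d])
    show "integrable m (\<lambda>p. norm (?e w p - ?e v p))"
      by (intro integrable_norm bochner_integrable_diff int) fact+
    fix p assume p: "p \<in> space m"
    have "norm (?e w p - ?e v p) \<le> norm (complex_of_real (snd p) * w (fst p) - complex_of_real (snd p) * v (fst p))"
      using w(1)[of "fst p"] v(1)[of "fst p"] snd_pos[OF p] norm_exp_diff_le[of "complex_of_real (snd p) * w (fst p)" "complex_of_real (snd p) * v (fst p)"]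
      by (simp add: mult_nonneg_nonpos)
    also have "complex_of_real (snd p) * w (fst p) - complex_of_real (snd p) * v (fst p) = complex_of_real (snd p) * (w (fst p) - v (fst p))"
      by (simp add: algebra_simps)
    finally show "norm (?e w p - ?e v p) \<le> snd p * \<bar>norm (w (fst p) - v (fst p))\<bar>"
      using snd_pos[OF p] by (simp add: norm_mult)
  qed
  also have "\<dots> = (LINT x|\<Gamma>. norm (w x - v x))" using moment_integrable(2)[OF d] by simp
  finally show "norm (\<Psi> w - \<Psi> v) \<le> (LINT x|\<Gamma>. norm (w x - v x))" .
qed

lemma \<Psi>_zero: "\<Psi> (\<lambda>x. 0) = 0"
  by (simp add: \<Psi>_def)

lemma Re_\<Psi>_le:
  assumes [measurable]: "w \<in> borel_measurable borel"
    and w: "\<And>x. Re (w x) \<le> 0" "integrable \<Gamma> w"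
  shows "Re (\<Psi> w) \<le> 0"
proof -
  have i: "integrable m (\<lambda>p. exp (complex_of_real (snd p) * w (fst p)) - 1)"
    by (rule \<Psi>_Lipschitz(2)[of w w]) (use w in auto)
  have "Re (\<Psi> w) = (LINT p|m. Re (exp (complex_of_real (snd p) * w (fst p)) - 1))"
    unfolding \<Psi>_def by (rule integral_Re[symmetric, OF i])
  also have "\<dots> \<le> (LINT p|m. 0)"
  proof (rule integral_mono)
    fix p assume p: "p \<in> space m"
    have "Re (exp (complex_of_real (snd p) * w (fst p))) \<le> norm (exp (complex_of_real (snd p) * w (fst p)))" by (rule complex_Re_le_cmod)
    also have "\<dots> \<le> 1" using w(1)[of "fst p"] snd_pos[OF p] by (simp add: mult_nonneg_nonpos)
    finally show "Re (exp (complex_of_real (snd p) * w (fst p)) - 1) \<le> 0" by simp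
  qed (use integrable_Re[OF i] in simp_all)
  finally show ?thesis by simp
qed

lemma norm_exp_\<Psi>_diff_le:
  fixes f g :: "'a \<Rightarrow> real"
  assumes [measurable]: "f \<in> borel_measurable borel" "g \<in> borel_measurable borel"
    and f: "integrable \<Gamma> f" and g: "integrable \<Gamma> g"
  shows "norm (exp (\<Psi> (\<lambda>x. \<i> * f x)) - exp (\<Psi> (\<lambda>x. \<i> * g x))) \<le> (LINT x|\<Gamma>. \<bar>f x - g x\<bar>)"
proof -
  have c: "integrable \<Gamma> (\<lambda>x. \<i> * complex_of_real (f x))" "integrable \<Gamma> (\<lambda>x. \<i> * complex_of_real (g x))"
    using f g by auto
  have "norm (exp (\<Psi> (\<lambda>x. \<i> * f x)) - exp (\<Psi> (\<lambda>x. \<i> * g x))) \<le> norm (\<Psi> (\<lambda>x. \<i> * f x) - \<Psi> (\<lambda>x. \<i> * g x))"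
    by (intro norm_exp_diff_le Re_\<Psi>_le) (use c in auto)
  also have "\<dots> \<le> (LINT x|\<Gamma>. norm (\<i> * complex_of_real (f x) - \<i> * complex_of_real (g x)))"
    by (rule \<Psi>_Lipschitz) (use c in auto)
  also have "\<dots> = (LINT x|\<Gamma>. \<bar>f x - g x\<bar>)"
    by (intro bochner_cong refl)
       (simp add: right_diff_distrib[symmetric] norm_mult of_real_diff[symmetric] del: of_real_diff)
  finally show ?thesis .
qed

text \<open>
The characteristic function \<open>\<phi>\<close> of \<open>X = \<integral>f d\<eta> \<ge> 0\<close> satisfies \<open>|\<phi>(t) - 1| \<le> t C\<close> with \<open>C = \<integral>f d\<Gamma>\<close>, so the mean of
\<open>sin(t X)\<close> is at most \<open>t C\<close>.  The sine is not of constant sign, but its integral over \<open>0 \<le> t \<le> l\<close> is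
\<open>(1 - cos(l X))/X \<ge> 0\<close>, whose mean is therefore at most \<open>C l\<^sup>2/2\<close>.  Multiplied by \<open>2/l\<^sup>2\<close> these functions tend to \<open>X\<close> as
\<open>l\<close> tends to 0, and Fatou's lemma gives the bound.  In particular the mean is finite.
\<close>

lemma mean_csc_le:
  assumes f: "f \<in> C\<^sub>c" and nn: "\<And>x. 0 \<le> f x"
  shows "(\<integral>\<^sup>+\<eta>. ennreal (LINT x|\<eta>. f x) \<partial>\<mu>) \<le> ennreal (LINT x|\<Gamma>. f x)"
proof -
  define C where "C = (LINT x|\<Gamma>. f x)"
  define X where "X \<eta> = (LINT x|\<eta>. f x)" for \<eta>
  have [measurable]: "f \<in> borel_measurable borel" by (rule csc_measurable[OF f])
  have X[measurable]: "X \<in> borel_measurable \<mu>" unfolding X_def[abs_def] by measurable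
  have X_nn: "0 \<le> X \<eta>" for \<eta> unfolding X_def by (rule bochner_nonneg) (rule nn)
  have C_nn: "0 \<le> C" unfolding C_def by (rule bochner_nonneg) (rule nn)
  have sin_le: "(LINT \<eta>|\<mu>. sin (t * X \<eta>)) \<le> t * C" if t: "0 \<le> t" for t
  proof -
    have tf: "(\<lambda>x. t * f x) \<in> C\<^sub>c"
      using csc_cmult_add[OF f csc_zero, of t 0] by simp
    have i: "integrable \<mu> (\<lambda>\<eta>. iexp (t * X \<eta>))"
      by (intro \<mu>.integrable_const_bound[of _ 1]) auto
    have "(LINT \<eta>|\<mu>. sin (t * X \<eta>)) = (LINT \<eta>|\<mu>. Im (iexp (t * X \<eta>)))"
      by (simp add: Im_exp)
    also have "\<dots> = Im (CLINT \<eta>|\<mu>. iexp (t * X \<eta>))" by (rule integral_Im[OF i])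
    also have "(CLINT \<eta>|\<mu>. iexp (t * X \<eta>)) = exp (\<Psi> (\<lambda>x. \<i> * complex_of_real (t * f x)))"
      using characteristic_functional_csc[OF tf] by (simp add: X_def)
    also have "Im \<dots> = Im (\<dots> - exp (\<Psi> (\<lambda>x. \<i> * complex_of_real 0)))" by (simp add: \<Psi>_zero)
    also have "\<dots> \<le> norm (exp (\<Psi> (\<lambda>x. \<i> * complex_of_real (t * f x))) - exp (\<Psi> (\<lambda>x. \<i> * complex_of_real 0)))"
      using abs_Im_le_cmod by (rule order_trans[OF abs_ge_self])
    also have "\<dots> \<le> (LINT x|\<Gamma>. \<bar>t * f x - 0\<bar>)"
      by (rule norm_exp_\<Psi>_diff_le) (use csc_integrable[OF radon_\<Gamma> f] in auto)
    also have "\<dots> = t * C"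
      using t nn by (simp add: C_def abs_mult)
    finally show ?thesis .
  qed
  \<comment> \<open>The integral of \<open>sin(t y)\<close> over \<open>0 \<le> t \<le> l\<close>; it is nonnegative for \<open>y \<ge> 0\<close>.\<close>
  define k where "k l y = (if y = 0 then 0 else (1 - cos (l * y)) / y)" for l y :: real
  have k_int: "(LINT t|lborel. sin (t * y) * indicator {0..l} t) = k l y" if "0 \<le> l" for l y
  proof (cases "y = 0")
    case False
    have "(LINT t|lborel. sin (t * y) * indicator {0..l} t) = (- cos (l * y) / y) - (- cos (0 * y) / y)"
    proof (rule integral_FTC_Icc_real[OF that])
      show "((\<lambda>t. - cos (t * y) / y) has_real_derivative sin (t * y)) (at t)" for t
        using False by (auto intro!: derivative_eq_intros)
      show "isCont (\<lambda>t. sin (t * y)) t" for t by (intro continuous_intros)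
    qed
    then show ?thesis using False by (simp add: k_def diff_divide_distrib)
  qed (simp add: k_def)
  have k_le: "(LINT \<eta>|\<mu>. k l (X \<eta>)) \<le> C * l\<^sup>2 / 2" if l: "0 \<le> l" for l
  proof -
    define L where "L = density lborel (indicator {0..l} :: real \<Rightarrow> ennreal)"
    have L_int: "(LINT t|L. u t) = (LINT t|lborel. u t * indicator {0..l} t)"
      if [measurable]: "u \<in> borel_measurable borel" for u :: "real \<Rightarrow> real"
    proof -
      have "(LINT t|L. u t) = (LINT t|lborel. indicator {0..l} t *\<^sub>R u t)"
        unfolding L_def ennreal_indicator[symmetric] by (rule integral_density) auto
      then show ?thesis by (simp add: mult.commute)
    qed
    have "finite_measure L"
      using l by (intro finite_measureI) (simp add: L_def emeasure_density)
    then interpret L: finite_measure L .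
    interpret pair_sigma_finite \<mu> L ..
    have sL[measurable_cong]: "sets L = sets borel" by (simp add: L_def)
    interpret pf: finite_measure "\<mu> \<Otimes>\<^sub>M L"
      by (intro finite_measureI) (auto simp: space_pair_measure L.emeasure_pair_measure_Times \<mu>.emeasure_space_1 L.emeasure_eq_measure)
    have int2: "integrable (\<mu> \<Otimes>\<^sub>M L) (\<lambda>(\<eta>, t). sin (t * X \<eta>))"
      by (intro pf.integrable_const_bound[of _ 1]) auto
    have "(LINT \<eta>|\<mu>. k l (X \<eta>)) = (LINT \<eta>|\<mu>. (LINT t|L. sin (t * X \<eta>)))"
      by (intro bochner_cong refl) (simp add: L_int k_int[OF l])
    also have "\<dots> = (LINT t|L. (LINT \<eta>|\<mu>. sin (t * X \<eta>)))"
      by (rule Fubini_integral[OF int2, symmetric])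
    \<comment> \<open>On the interval the truncation is \<open>t\<close>; it makes the bound integrable for \<open>L\<close> by boundedness.\<close>
    also have "\<dots> \<le> (LINT t|L. C * max 0 (min l t))"
    proof (rule integral_mono_AE)
      show "integrable L (\<lambda>t. LINT \<eta>|\<mu>. sin (t * X \<eta>))"
        by (rule integrable_snd[OF int2])
      show "integrable L (\<lambda>t. C * max 0 (min l t))"
        by (intro L.integrable_const_bound[of _ "C * l"] AE_I2) (use C_nn l in \<open>auto simp: abs_mult intro!: mult_left_mono\<close>)
      show "AE t in L. (LINT \<eta>|\<mu>. sin (t * X \<eta>)) \<le> C * max 0 (min l t)"
      proof -
        have "(LINT \<eta>|\<mu>. sin (t * X \<eta>)) \<le> C * max 0 (min l t)" if "t \<in> {0..l}" for t
        proof -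
          have "max 0 (min l t) = t" using that by simp
          then show ?thesis using sin_le[of t] that by (simp add: mult.commute)
        qed
        then have "AE t in lborel. 0 < (indicator {0..l} t :: ennreal) \<longrightarrow> (LINT \<eta>|\<mu>. sin (t * X \<eta>)) \<le> C * max 0 (min l t)"
          by (intro AE_I2) (simp add: indicator_def)
        then show ?thesis unfolding L_def by (subst AE_density) auto
      qed
    qed
    also have "\<dots> = (LINT t|lborel. (C * t) * indicator {0..l} t)"
      by (subst L_int) (auto intro!: bochner_cong simp: indicator_def)
    also have "\<dots> = C * l\<^sup>2 / 2 - C * 0\<^sup>2 / 2"
      by (rule integral_FTC_Icc_real[OF l]) (auto intro!: derivative_eq_intros continuous_intros)
    finally show ?thesis by simp
  qed
  have k_nn: "0 \<le> k l y" if "0 \<le> y" for l y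
    using that by (simp add: k_def)
  let ?k = "\<lambda>n y. 2 * (real (Suc n))\<^sup>2 * k (1 / real (Suc n)) y"
  have k_lim: "(\<lambda>n. ?k n y) \<longlonglongrightarrow> y" if "0 \<le> y" for y
  proof (cases "y = 0")
    case False
    with that have "y > 0" by simp
    have "(\<lambda>n. 2 * (real (Suc n))\<^sup>2 * ((1 - cos (1 / real (Suc n) * y)) / y)) \<longlonglongrightarrow> y"
      using \<open>y > 0\<close> by real_asymp
    then show ?thesis using False by (simp add: k_def)
  qed (simp add: k_def)
  have [measurable]: "(\<lambda>y. k l y) \<in> borel_measurable borel" for l
    unfolding k_def by measurable
  have "(\<integral>\<^sup>+\<eta>. ennreal (X \<eta>) \<partial>\<mu>) = (\<integral>\<^sup>+\<eta>. liminf (\<lambda>n. ennreal (?k n (X \<eta>))) \<partial>\<mu>)"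
    by (intro nn_integral_cong lim_imp_Liminf[symmetric] tendsto_ennrealI k_lim X_nn) simp
  also have "\<dots> \<le> liminf (\<lambda>n. \<integral>\<^sup>+\<eta>. ennreal (?k n (X \<eta>)) \<partial>\<mu>)"
    by (intro nn_integral_liminf) measurable
  also have "\<dots> \<le> liminf (\<lambda>n::nat. ennreal C)"
  proof (intro Liminf_mono always_eventually allI)
    fix n
    let ?l = "1 / real (Suc n)"
    have i: "integrable \<mu> (\<lambda>\<eta>. k ?l (X \<eta>))"
    proof (rule \<mu>.integrable_const_bound[of _ ?l])
      show "AE \<eta> in \<mu>. norm (k ?l (X \<eta>)) \<le> ?l"
      proof (rule AE_I2)
        fix \<eta>
        have "\<bar>k ?l (X \<eta>)\<bar> = \<bar>LINT t|lborel. sin (t * X \<eta>) * indicator {0..?l} t\<bar>"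
          by (subst k_int) auto
        also have "\<dots> \<le> (LINT t|lborel. indicator {0..?l} t)"
        proof (rule order_trans[OF integral_abs_bound integral_mono])
          have "integrable lborel (\<lambda>t. sin (t * X \<eta>) * indicator {0..?l} t)"
            by (rule bochner_bound[of _ "indicator {0..?l} :: real \<Rightarrow> real"])
               (auto simp: indicator_def)
          then show "integrable lborel (\<lambda>t. \<bar>sin (t * X \<eta>) * indicator {0..?l} t\<bar>)" by simp
          show "integrable lborel (\<lambda>t. indicator {0..?l} t :: real)" by simp
        qed (auto simp: indicator_def)
        finally show "norm (k ?l (X \<eta>)) \<le> ?l" by simp
      qed
    qed measurable
    have "(\<integral>\<^sup>+\<eta>. ennreal (?k n (X \<eta>)) \<partial>\<mu>) = ennreal (LINT \<eta>|\<mu>. ?k n (X \<eta>))"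
      by (intro nn_integral_eq_integral integrable_mult_right i AE_I2 mult_nonneg_nonneg k_nn X_nn) auto
    also have "\<dots> = ennreal (2 * (real (Suc n))\<^sup>2 * (LINT \<eta>|\<mu>. k ?l (X \<eta>)))"
      using i by simp
    also have "\<dots> \<le> ennreal (2 * (real (Suc n))\<^sup>2 * (C * ?l\<^sup>2 / 2))"
      by (intro ennreal_leI mult_left_mono k_le) auto
    also have "2 * (real (Suc n))\<^sup>2 * (C * ?l\<^sup>2 / 2) = C"
      by (simp add: power_divide del: of_nat_Suc)
    finally show "(\<integral>\<^sup>+\<eta>. ennreal (?k n (X \<eta>)) \<partial>\<mu>) \<le> ennreal C" .
  qed
  also have "\<dots> = ennreal C" by (simp add: Liminf_const)
  finally show ?thesis by (simp add: X_def C_def)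
qed

end

section \<open>The Laplace functional\<close>

context discrete_law
begin

lemma mean_open_le:
  fixes U :: "'a set"
  assumes U: "open U"
  shows "(\<integral>\<^sup>+\<eta>. emeasure \<eta> U \<partial>\<mu>) \<le> emeasure \<Gamma> U"
proof -
  have [measurable]: "bump n U \<in> borel_measurable borel" for n by (rule csc_measurable[OF csc_bump])
  have "(\<integral>\<^sup>+\<eta>. emeasure \<eta> U \<partial>\<mu>) = (\<integral>\<^sup>+\<eta>. (SUP n. ennreal (LINT x|\<eta>. bump n U x)) \<partial>\<mu>)"
    by (intro nn_integral_cong emeasure_open_eq_SUP U radon_\<mu>)
  also have "\<dots> = (SUP n. \<integral>\<^sup>+\<eta>. ennreal (LINT x|\<eta>. bump n U x) \<partial>\<mu>)"
  proof (rule nn_integral_monotone_convergence_SUP_AE)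
    show "AE \<eta> in \<mu>. ennreal (LINT x|\<eta>. bump n U x) \<le> ennreal (LINT x|\<eta>. bump (Suc n) U x)" for n
      by (intro AE_I2 ennreal_leI integral_mono csc_integrable radon_\<mu> csc_bump bump_mono) auto
  qed measurable
  also have "\<dots> \<le> (SUP n. ennreal (LINT x|\<Gamma>. bump n U x))"
    by (intro SUP_mono' mean_csc_le csc_bump bump_bounds)
  also have "\<dots> = emeasure \<Gamma> U"
    by (rule emeasure_open_eq_SUP[OF U radon_\<Gamma>, symmetric])
  finally show ?thesis .
qed

lemma measurable_emeasure_\<mu> [measurable]:
  fixes A :: "'a set"
  shows "A \<in> sets borel \<Longrightarrow> (\<lambda>\<eta>. emeasure \<eta> A) \<in> borel_measurable \<mu>"
  unfolding measurable_\<mu>_iff by (intro measurable_discrete_radon measurable_emeasure_radon)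

text \<open>
Open sets give an upper bound for every Borel set by outer regularity of \<open>\<Gamma>\<close>, restricted to \<open>E n\<close> to have a
finite measure.
\<close>

lemma mean_emeasure_le:
  fixes A :: "'a set"
  assumes A[measurable]: "A \<in> sets borel"
  shows "(\<integral>\<^sup>+\<eta>. emeasure \<eta> A \<partial>\<mu>) \<le> emeasure \<Gamma> A"
proof -
  have local: "(\<integral>\<^sup>+\<eta>. emeasure \<eta> (A \<inter> E n) \<partial>\<mu>) \<le> emeasure \<Gamma> (A \<inter> E n)" for n
  proof -
    define G where "G = density \<Gamma> (indicator (E n))"
    have G: "emeasure G B = emeasure \<Gamma> (B \<inter> E n)" if "B \<in> sets borel" for B
      unfolding G_def using that by (subst emeasure_restricted) (auto simp: sets_\<Gamma> Int_commute)
    have sG: "sets G = sets borel" by (simp add: G_def sets_\<Gamma>)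
    have "space G = UNIV" using sets_eq_imp_space_eq[OF sG] by simp
    then have "emeasure G (space G) \<noteq> \<infinity>"
      using E_finite[OF radon_\<Gamma>, of n] by (simp add: G)
    from outer_regular[OF sG this A] have "emeasure \<Gamma> (A \<inter> E n) = (INF U\<in>{U. A \<subseteq> U \<and> open U}. emeasure G U)"
      by (simp add: G A)
    moreover have "(\<integral>\<^sup>+\<eta>. emeasure \<eta> (A \<inter> E n) \<partial>\<mu>) \<le> emeasure G U" if "A \<subseteq> U" "open U" for U
    proof -
      have "(\<integral>\<^sup>+\<eta>. emeasure \<eta> (A \<inter> E n) \<partial>\<mu>) \<le> (\<integral>\<^sup>+\<eta>. emeasure \<eta> (U \<inter> E n) \<partial>\<mu>)"
        using that open_E by (intro nn_integral_mono emeasure_mono) (auto simp: radon_sets[OF radon_\<mu>])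
      also have "\<dots> \<le> emeasure \<Gamma> (U \<inter> E n)"
        using that open_E by (intro mean_open_le) auto
      finally show ?thesis using that by (simp add: G)
    qed
    ultimately show ?thesis by (auto intro!: INF_greatest)
  qed
  have "(\<integral>\<^sup>+\<eta>. emeasure \<eta> A \<partial>\<mu>) = (\<integral>\<^sup>+\<eta>. (SUP n. emeasure \<eta> (A \<inter> E n)) \<partial>\<mu>)"
    by (intro nn_integral_cong emeasure_eq_SUP_E A radon_\<mu>)
  also have "\<dots> = (SUP n. \<integral>\<^sup>+\<eta>. emeasure \<eta> (A \<inter> E n) \<partial>\<mu>)"
  proof (rule nn_integral_monotone_convergence_SUP_AE)
    show "AE \<eta> in \<mu>. emeasure \<eta> (A \<inter> E n) \<le> emeasure \<eta> (A \<inter> E (Suc n))" for n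
      using E_mono[of n "Suc n"] by (intro AE_I2 emeasure_mono) (auto simp: radon_sets[OF radon_\<mu>])
  qed measurable
  also have "\<dots> \<le> (SUP n. emeasure \<Gamma> (A \<inter> E n))"
    by (intro SUP_mono' local)
  also have "\<dots> = emeasure \<Gamma> A" by (rule emeasure_eq_SUP_E[OF A radon_\<Gamma>, symmetric])
  finally show ?thesis .
qed

lemma mean_nn_integral_le:
  fixes g :: "'a \<Rightarrow> ennreal"
  assumes "g \<in> borel_measurable borel"
  shows "(\<integral>\<^sup>+\<eta>. (\<integral>\<^sup>+x. g x \<partial>\<eta>) \<partial>\<mu>) \<le> (\<integral>\<^sup>+x. g x \<partial>\<Gamma>)"
  using assms
proof (induction rule: borel_measurable_induct)
  case (cong f g)
  have "f = g"
  proof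
    fix x show "f x = g x" using cong(3)[of x] by simp
  qed
  then show ?case using cong(4) by (simp only:)
next
  case (set A)
  have "(\<integral>\<^sup>+\<eta>. (\<integral>\<^sup>+x. indicator A x \<partial>\<eta>) \<partial>\<mu>) = (\<integral>\<^sup>+\<eta>. emeasure \<eta> A \<partial>\<mu>)"
    using set by (intro nn_integral_cong) (simp add: radon_sets[OF radon_\<mu>])
  with mean_emeasure_le[OF set] set show ?case by (simp add: sets_\<Gamma>)
next
  case (mult u c)
  have "(\<integral>\<^sup>+\<eta>. (\<integral>\<^sup>+x. c * u x \<partial>\<eta>) \<partial>\<mu>) = (\<integral>\<^sup>+\<eta>. c * (\<integral>\<^sup>+x. u x \<partial>\<eta>) \<partial>\<mu>)"
    using mult(2) by (intro nn_integral_cong nn_integral_cmult) (simp add: measurable_cong_sets[OF radon_sets[OF radon_\<mu>] refl])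
  also have "\<dots> = c * (\<integral>\<^sup>+\<eta>. (\<integral>\<^sup>+x. u x \<partial>\<eta>) \<partial>\<mu>)"
    using mult(2) by (intro nn_integral_cmult) measurable
  also have "\<dots> \<le> c * (\<integral>\<^sup>+x. u x \<partial>\<Gamma>)" by (intro mult_left_mono mult.IH) simp
  also have "\<dots> = (\<integral>\<^sup>+x. c * u x \<partial>\<Gamma>)"
    using mult(2) by (intro nn_integral_cmult[symmetric]) (simp add: measurable_cong_sets[OF sets_\<Gamma> refl])
  finally show ?case .
next
  case (add u v)
  have m: "u \<in> borel_measurable \<eta>" "v \<in> borel_measurable \<eta>" if "sets \<eta> = sets borel" for \<eta> :: "'a measure"
    using add(1,3) by (simp_all add: measurable_cong_sets[OF that refl])
  have "(\<integral>\<^sup>+\<eta>. (\<integral>\<^sup>+x. v x + u x \<partial>\<eta>) \<partial>\<mu>) = (\<integral>\<^sup>+\<eta>. (\<integral>\<^sup>+x. v x \<partial>\<eta>) + (\<integral>\<^sup>+x. u x \<partial>\<eta>) \<partial>\<mu>)"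
    by (intro nn_integral_cong nn_integral_add m radon_sets radon_\<mu>)
  also have "\<dots> = (\<integral>\<^sup>+\<eta>. (\<integral>\<^sup>+x. v x \<partial>\<eta>) \<partial>\<mu>) + (\<integral>\<^sup>+\<eta>. (\<integral>\<^sup>+x. u x \<partial>\<eta>) \<partial>\<mu>)"
    using add(1,3) by (intro nn_integral_add measurable_nn_integral_\<mu>)
  also have "\<dots> \<le> (\<integral>\<^sup>+x. v x \<partial>\<Gamma>) + (\<integral>\<^sup>+x. u x \<partial>\<Gamma>)" by (intro add_mono add.IH)
  also have "\<dots> = (\<integral>\<^sup>+x. v x + u x \<partial>\<Gamma>)"
    by (intro nn_integral_add[symmetric] m sets_\<Gamma>)
  finally show ?case .
next
  case (seq U)
  have "(\<integral>\<^sup>+\<eta>. (\<integral>\<^sup>+x. (\<Squnion> (range U)) x \<partial>\<eta>) \<partial>\<mu>) = (\<integral>\<^sup>+\<eta>. (SUP i. \<integral>\<^sup>+x. U i x \<partial>\<eta>) \<partial>\<mu>)"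
    using seq(1,3) by (intro nn_integral_cong nn_integral_SUP_borel radon_sets radon_\<mu>)
  also have "\<dots> = (SUP i. \<integral>\<^sup>+\<eta>. (\<integral>\<^sup>+x. U i x \<partial>\<eta>) \<partial>\<mu>)"
    using seq(1,3) by (intro nn_integral_monotone_convergence_SUP measurable_nn_integral_\<mu>)
      (auto simp: incseq_def le_fun_def intro!: nn_integral_mono)
  also have "\<dots> \<le> (SUP i. \<integral>\<^sup>+x. U i x \<partial>\<Gamma>)"
    by (intro SUP_mono' seq.IH)
  also have "\<dots> = (\<integral>\<^sup>+x. (\<Squnion> (range U)) x \<partial>\<Gamma>)" using seq(1,3) by (intro nn_integral_SUP_borel[symmetric] sets_\<Gamma>)
  finally show ?case .
qed

text \<open>
Hence \<open>f \<mapsto> \<integral>f d\<eta>\<close> is a contraction from \<open>L\<^sup>1(\<Gamma>)\<close> to \<open>L\<^sup>1(\<mu>)\<close>.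
\<close>

lemma AE_integrable:
  fixes f :: "'a \<Rightarrow> real"
  assumes f[measurable]: "f \<in> borel_measurable borel" and int: "integrable \<Gamma> f"
  shows "AE \<eta> in \<mu>. integrable \<eta> f"
    and "integrable \<mu> (\<lambda>\<eta>. LINT x|\<eta>. f x)"
    and "(LINT \<eta>|\<mu>. \<bar>LINT x|\<eta>. f x\<bar>) \<le> (LINT x|\<Gamma>. \<bar>f x\<bar>)"
proof -
  have "(\<integral>\<^sup>+\<eta>. (\<integral>\<^sup>+x. ennreal \<bar>f x\<bar> \<partial>\<eta>) \<partial>\<mu>) \<le> (\<integral>\<^sup>+x. ennreal \<bar>f x\<bar> \<partial>\<Gamma>)"
    by (intro mean_nn_integral_le) measurable
  also have "\<dots> = ennreal (LINT x|\<Gamma>. \<bar>f x\<bar>)"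
    using int by (intro nn_integral_eq_integral) auto
  finally have le: "(\<integral>\<^sup>+\<eta>. (\<integral>\<^sup>+x. ennreal \<bar>f x\<bar> \<partial>\<eta>) \<partial>\<mu>) \<le> ennreal (LINT x|\<Gamma>. \<bar>f x\<bar>)" .
  have "AE \<eta> in \<mu>. (\<integral>\<^sup>+x. ennreal \<bar>f x\<bar> \<partial>\<eta>) \<noteq> \<infinity>"
    by (rule nn_integral_PInf_AE) (use le in \<open>auto simp: top_unique\<close>)
  then show "AE \<eta> in \<mu>. integrable \<eta> f"
    using AE_space
  proof eventually_elim
    case (elim \<eta>)
    have "f \<in> borel_measurable \<eta>"
      using f measurable_cong_sets[OF radon_sets[OF radon_\<mu>[OF elim(2)]] refl, of borel] by blast
    with elim(1) show ?case by (simp add: integrable_iff_bounded less_top)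
  qed
  have bound: "(\<integral>\<^sup>+\<eta>. ennreal \<bar>LINT x|\<eta>. f x\<bar> \<partial>\<mu>) \<le> ennreal (LINT x|\<Gamma>. \<bar>f x\<bar>)"
  proof (rule order_trans[OF nn_integral_mono le])
    fix \<eta>
    show "ennreal \<bar>LINT x|\<eta>. f x\<bar> \<le> (\<integral>\<^sup>+x. ennreal \<bar>f x\<bar> \<partial>\<eta>)"
      using integral_norm_bound_ennreal[of \<eta> f] not_integrable_integral_eq[of \<eta> f]
      by (cases "integrable \<eta> f") auto
  qed
  show i: "integrable \<mu> (\<lambda>\<eta>. LINT x|\<eta>. f x)"
    by (rule integrableI_bounded) (use bound in \<open>auto intro: le_less_trans\<close>)
  have "ennreal (LINT \<eta>|\<mu>. \<bar>LINT x|\<eta>. f x\<bar>) = (\<integral>\<^sup>+\<eta>. ennreal \<bar>LINT x|\<eta>. f x\<bar> \<partial>\<mu>)"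
    using i by (intro nn_integral_eq_integral[symmetric]) auto
  with bound have "ennreal (LINT \<eta>|\<mu>. \<bar>LINT x|\<eta>. f x\<bar>) \<le> ennreal (LINT x|\<Gamma>. \<bar>f x\<bar>)"
    by simp
  moreover have "0 \<le> (LINT x|\<Gamma>. \<bar>f x\<bar>)" by (rule bochner_nonneg) simp
  ultimately show "(LINT \<eta>|\<mu>. \<bar>LINT x|\<eta>. f x\<bar>) \<le> (LINT x|\<Gamma>. \<bar>f x\<bar>)"
    by (simp only: ennreal_le_iff)
qed

text \<open>
Both sides are 1-Lipschitz in \<open>f\<close> for the norm of \<open>L\<^sup>1(\<Gamma>)\<close>, and they agree on the dense set of test functions.
\<close>

theorem characteristic_functional_L1:
  fixes f :: "'a \<Rightarrow> real"
  assumes f[measurable]: "f \<in> borel_measurable borel" and int: "integrable \<Gamma> f"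
  shows "(CLINT \<eta>|\<mu>. iexp (LINT x|\<eta>. f x)) = exp (\<Psi> (\<lambda>x. \<i> * f x))"
proof -
  define \<phi> where "\<phi> g = (CLINT \<eta>|\<mu>. iexp (LINT x|\<eta>. g x))" for g :: "'a \<Rightarrow> real"
  have "norm (\<phi> f - exp (\<Psi> (\<lambda>x. \<i> * f x))) \<le> 2 * e" if e: "0 < e" for e
  proof -
    obtain g where g: "g \<in> C\<^sub>c" "(LINT x|\<Gamma>. \<bar>f x - g x\<bar>) < e"
      using csc_dense_L1[OF radon_\<Gamma> int e] by blast
    note [measurable] = csc_measurable[OF g(1)]
    have ig: "integrable \<Gamma> g" by (rule csc_integrable[OF radon_\<Gamma> g(1)])
    have ie: "integrable \<mu> (\<lambda>\<eta>. iexp (LINT x|\<eta>. h x))" if [measurable]: "h \<in> borel_measurable borel" for h :: "'a \<Rightarrow> real"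
      by (intro \<mu>.integrable_const_bound[of _ 1]) auto
    have ifg: "integrable \<Gamma> (\<lambda>x. f x - g x)" using int ig by simp
    have "norm (\<phi> f - \<phi> g)
        = norm (CLINT \<eta>|\<mu>. iexp (LINT x|\<eta>. f x) - iexp (LINT x|\<eta>. g x))"
      unfolding \<phi>_def by (subst bochner_diff) (use ie f csc_measurable[OF g(1)] in auto)
    also have "\<dots> \<le> (LINT \<eta>|\<mu>. norm (iexp (LINT x|\<eta>. f x) - iexp (LINT x|\<eta>. g x)))"
      by (rule integral_norm_bound)
    also have "\<dots> \<le> (LINT \<eta>|\<mu>. \<bar>LINT x|\<eta>. f x - g x\<bar>)"
    proof (rule integral_mono_AE)
      show "integrable \<mu> (\<lambda>\<eta>. norm (iexp (LINT x|\<eta>. f x) - iexp (LINT x|\<eta>. g x)))"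
        by (intro integrable_norm bochner_integrable_diff ie) measurable
      show "integrable \<mu> (\<lambda>\<eta>. \<bar>LINT x|\<eta>. f x - g x\<bar>)"
        by (intro integrable_abs AE_integrable(2) ifg) measurable
      show "AE \<eta> in \<mu>. norm (iexp (LINT x|\<eta>. f x) - iexp (LINT x|\<eta>. g x)) \<le> \<bar>LINT x|\<eta>. f x - g x\<bar>"
        using AE_integrable(1)[OF f int] AE_integrable(1)[OF csc_measurable[OF g(1)] ig]
      proof eventually_elim
        case (elim \<eta>)
        have "norm (iexp (LINT x|\<eta>. f x) - iexp (LINT x|\<eta>. g x)) \<le>
            norm (\<i> * complex_of_real (LINT x|\<eta>. f x) - \<i> * complex_of_real (LINT x|\<eta>. g x))"
          by (rule norm_exp_diff_le) auto
        also have "\<dots> = \<bar>(LINT x|\<eta>. f x) - (LINT x|\<eta>. g x)\<bar>"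
          by (simp add: right_diff_distrib[symmetric] norm_mult of_real_diff[symmetric] del: of_real_diff)
        also have "(LINT x|\<eta>. f x) - (LINT x|\<eta>. g x) = (LINT x|\<eta>. f x - g x)"
          using elim by simp
        finally show ?case .
      qed
    qed
    also have "\<dots> \<le> (LINT x|\<Gamma>. \<bar>f x - g x\<bar>)"
      by (intro AE_integrable(3) ifg) measurable
    finally have 1: "norm (\<phi> f - \<phi> g) < e"
      using g(2) by simp
    have 2: "norm (exp (\<Psi> (\<lambda>x. \<i> * f x)) - exp (\<Psi> (\<lambda>x. \<i> * g x))) < e"
      using norm_exp_\<Psi>_diff_le[OF f csc_measurable[OF g(1)] int ig] g(2) by simp
    show ?thesis
      using norm_triangle_ineq4[of "\<phi> f - \<phi> g"
         "exp (\<Psi> (\<lambda>x. \<i> * f x)) - exp (\<Psi> (\<lambda>x. \<i> * g x))"] 1 2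
      by (simp add: \<phi>_def characteristic_functional_csc[OF g(1)])
  qed
  note le = this
  have "norm (\<phi> f - exp (\<Psi> (\<lambda>x. \<i> * f x))) \<le> 0"
  proof (rule field_le_epsilon)
    fix e :: real assume "0 < e"
    with le[of "e / 2"] show "norm (\<phi> f - exp (\<Psi> (\<lambda>x. \<i> * f x))) \<le> 0 + e"
      by simp
  qed
  then show ?thesis by (simp add: \<phi>_def)
qed

text \<open>
For \<open>z\<close> in the right half plane, replace \<open>k\<close> by \<open>z k\<close>.  On the imaginary axis the exponents are imaginary, so that
the two sides agree by the previous theorem; the equality extends to \<open>z = 1\<close> by uniqueness of analytic continuation.
\<close>

theorem laplace_functional:
  fixes f k :: "'a \<Rightarrow> real"
  assumes f[measurable]: "f \<in> borel_measurable borel" and int_f: "integrable \<Gamma> f"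
    and k[measurable]: "k \<in> borel_measurable borel" and int_k: "integrable \<Gamma> k" and nn: "\<And>x. 0 \<le> k x"
  shows "(CLINT \<eta>|\<mu>. exp (\<i> * (LINT x|\<eta>. f x) - (LINT x|\<eta>. k x))) = exp (\<Psi> (\<lambda>x. \<i> * f x - k x))"
proof -
  define F where "F z = (CLINT \<eta>|\<mu>. exp (\<i> * (LINT x|\<eta>. f x) - z * (LINT x|\<eta>. k x)) - 0)" for z :: complex
  define a where "a p = snd p * f (fst p)" for p
  define b where "b p = snd p * k (fst p)" for p
  have [measurable]: "a \<in> borel_measurable m" "b \<in> borel_measurable m"
    unfolding a_def[abs_def] b_def[abs_def] by measurable
  define H where "H z = (CLINT p|m. exp (\<i> * a p - z * b p) - 1)" for z :: complex
  have dF: "(F has_field_derivative (CLINT \<eta>|\<mu>. - (LINT x|\<eta>. k x) * exp (\<i> * (LINT x|\<eta>. f x) - z * (LINT x|\<eta>. k x))))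
      (at z within {z. 0 \<le> Re z})" if "0 \<le> Re z" for z :: complex
    unfolding F_def
  proof (rule laplace_integral_differentiable(2))
    show "0 \<le> (LINT x|\<eta>. k x)" for \<eta> by (intro bochner_nonneg nn)
    show "integrable \<mu> (\<lambda>\<eta>. LINT x|\<eta>. k x)" by (rule AE_integrable(2)[OF k int_k])
    show "integrable \<mu> (\<lambda>\<eta>. exp (\<i> * (LINT x|\<eta>. f x)) - 0)"
      by (intro \<mu>.integrable_const_bound[of _ 1]) auto
    show "0 \<le> Re z" by fact
  qed measurable
  have int_mk: "integrable m b"
    using moment_integrable(1)[OF int_k] nn by (simp add: b_def[abs_def])
  have int_if: "integrable m (\<lambda>p. exp (\<i> * a p) - 1)"
  proof -
    have "integrable m (\<lambda>p. exp (complex_of_real (snd p) * (\<i> * complex_of_real (f (fst p)))) - 1)"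
      by (rule \<Psi>_Lipschitz(2)[of "\<lambda>x. \<i> * complex_of_real (f x)" "\<lambda>x. \<i> * complex_of_real (f x)"]) (use int_f in auto)
    then show ?thesis by (simp add: a_def mult_ac)
  qed
  have dH: "(H has_field_derivative (CLINT p|m. - b p * exp (\<i> * a p - z * b p)))
      (at z within {z. 0 \<le> Re z})" if "0 \<le> Re z" for z :: complex
    unfolding H_def
  proof (rule laplace_integral_differentiable(2))
    show "0 \<le> b p" if "p \<in> space m" for p
      using snd_pos[OF that] nn by (simp add: b_def)
    show "integrable m b" by (rule int_mk)
    show "integrable m (\<lambda>p. exp (\<i> * a p) - 1)" by (rule int_if)
    show "0 \<le> Re z" by fact
  qed measurable
  have "F 1 = exp (H 1)"
  proof (rule half_plane_boundary_uniqueness[OF dF DERIV_chain2[OF DERIV_exp dH]])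
    show "F (\<i> * of_real t) = exp (H (\<i> * of_real t))" for t
    proof -
      define g where "g x = f x - t * k x" for x
      have g[measurable]: "g \<in> borel_measurable borel" unfolding g_def by measurable
      have int_g: "integrable \<Gamma> g" unfolding g_def using int_f int_k by simp
      have "F (\<i> * of_real t) = (CLINT \<eta>|\<mu>. iexp (LINT x|\<eta>. g x))"
        unfolding F_def
      proof (rule integral_cong_AE)
        show "AE \<eta> in \<mu>. exp (\<i> * (LINT x|\<eta>. f x) - \<i> * of_real t * (LINT x|\<eta>. k x)) - 0 = iexp (LINT x|\<eta>. g x)"
          using AE_integrable(1)[OF f int_f] AE_integrable(1)[OF k int_k]
          by eventually_elim (simp add: g_def algebra_simps)
      qed measurable
      also have "\<dots> = exp (\<Psi> (\<lambda>x. \<i> * g x))"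
        by (rule characteristic_functional_L1[OF g int_g])
      also have "\<Psi> (\<lambda>x. \<i> * g x) = H (\<i> * of_real t)"
        unfolding \<Psi>_def H_def g_def a_def b_def
        by (intro bochner_cong refl) (simp add: algebra_simps)
      finally show ?thesis .
    qed
  qed simp_all
  moreover have "H 1 = \<Psi> (\<lambda>x. \<i> * f x - k x)"
    unfolding \<Psi>_def H_def a_def b_def
    by (intro bochner_cong refl) (simp add: algebra_simps)
  ultimately show ?thesis by (simp add: F_def)
qed

end

section \<open>The Levy measure of the gamma distribution\<close>

abbreviation half_line :: "real measure" where
  "half_line \<equiv> restrict_space lborel {0<..}"

lemma space_half_line [simp]: "space half_line = {0<..}"
  by (simp add: space_restrict_space)

lemma sigma_finite_half_line: "sigma_finite_measure half_line"
  by (rule sigma_finite_measure_restrict_space[OF sigma_finite_lborel]) simp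

lemma measurable_half_line: "f \<in> measurable borel N \<Longrightarrow> f \<in> measurable half_line N"
  by (rule measurable_restrict_space1) simp

text \<open>
Functions of \<open>(x, s)\<close> are given by Borel functions of \<open>s\<close> on the whole line; this rule and the next let them be
read as functions on the product with the half line.
\<close>

lemma measurable_fst_half_line [measurable]: "fst \<in> borel_measurable (half_line \<Otimes>\<^sub>M M)"
  by (rule measurable_compose[OF measurable_fst]) (rule measurable_half_line, simp)

lemma measurable_snd_half_line [measurable]: "snd \<in> borel_measurable (M \<Otimes>\<^sub>M half_line)"
  by (rule measurable_compose[OF measurable_snd]) (rule measurable_half_line, simp)

text \<open>
The endpoint is a null set; including it allows the fundamental theorem of calculus to be applied.
\<close>

lemma nn_integral_half_line: "(\<integral>\<^sup>+s. f s \<partial>half_line) = (\<integral>\<^sup>+s. f s * indicator {0..} s \<partial>lborel)"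
proof -
  have "(\<integral>\<^sup>+s. f s \<partial>half_line) = (\<integral>\<^sup>+s. f s * indicator {0<..} s \<partial>lborel)"
    by (rule nn_integral_restrict_space) simp
  also have "\<dots> = (\<integral>\<^sup>+s. f s * indicator {0..} s \<partial>lborel)"
  proof (rule nn_integral_cong_AE)
    show "AE s in lborel. f s * indicator {0<..} s = f s * indicator {0..} s"
      using AE_lborel_singleton[of 0] by eventually_elim (auto simp: indicator_def)
  qed
  finally show ?thesis .
qed

lemma nn_integral_half_line_exp:
  assumes "0 < a"
  shows "(\<integral>\<^sup>+s. ennreal (exp (- (a * s))) \<partial>half_line) = ennreal (1 / a)"
proof -
  have "(\<integral>\<^sup>+s. ennreal (exp (- (a * s))) * indicator {0..} s \<partial>lborel) = ennreal (0 - (- exp (- (a * 0)) / a))"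
  proof (rule nn_integral_FTC_atLeast[where F = "\<lambda>s. - exp (- (a * s)) / a"])
    show "((\<lambda>s. - exp (- (a * s)) / a) has_real_derivative exp (- (a * s))) (at s)" for s
      using assms by (auto intro!: derivative_eq_intros)
    show "((\<lambda>s. - exp (- (a * s)) / a) \<longlongrightarrow> 0) at_top"
      using assms by real_asymp
  qed auto
  then show ?thesis by (simp add: nn_integral_half_line)
qed

text \<open>
Frullani's integral: \<open>(exp(-a s) - exp(-b s))/s\<close> is the integral of \<open>exp(-u s)\<close> over \<open>a \<le> u \<le> b\<close>, and by Tonelli's
theorem the integral over \<open>s\<close> becomes that of \<open>1/u\<close>.
\<close>

lemma frullani_nn:
  assumes a: "0 < a" and ab: "a \<le> b"
  shows "(\<integral>\<^sup>+s. ennreal ((exp (- (a * s)) - exp (- (b * s))) / s) \<partial>half_line) = ennreal (ln b - ln a)"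
proof -
  interpret H: sigma_finite_measure half_line by (rule sigma_finite_half_line)
  interpret pair_sigma_finite half_line lborel ..
  have inner: "(\<integral>\<^sup>+u. ennreal (exp (- (u * s))) * indicator {a..b} u \<partial>lborel) = ennreal ((exp (- (a * s)) - exp (- (b * s))) / s)"
    if "0 < s" for s
  proof -
    have "(\<integral>\<^sup>+u. ennreal (exp (- (u * s))) * indicator {a..b} u \<partial>lborel) = ennreal (- exp (- (b * s)) / s - (- exp (- (a * s)) / s))"
    proof (rule nn_integral_FTC_Icc[where F = "\<lambda>u. - exp (- (u * s)) / s"])
      show "((\<lambda>u. - exp (- (u * s)) / s) has_real_derivative exp (- (u * s))) (at u)" for u
        using that by (auto intro!: derivative_eq_intros)
    qed (use ab in auto)
    then show ?thesis by (simp add: diff_divide_distrib)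
  qed
  have "(\<integral>\<^sup>+s. ennreal ((exp (- (a * s)) - exp (- (b * s))) / s) \<partial>half_line)
      = (\<integral>\<^sup>+s. (\<integral>\<^sup>+u. ennreal (exp (- (u * s))) * indicator {a..b} u \<partial>lborel) \<partial>half_line)"
    by (intro nn_integral_cong) (simp add: inner)
  also have "\<dots> = (\<integral>\<^sup>+u. (\<integral>\<^sup>+s. ennreal (exp (- (u * s))) * indicator {a..b} u \<partial>half_line) \<partial>lborel)"
    by (rule Fubini'[symmetric]) (unfold case_prod_beta, measurable)
  also have "\<dots> = (\<integral>\<^sup>+u. ennreal (1 / u) * indicator {a..b} u \<partial>lborel)"
  proof (rule nn_integral_cong)
    fix u
    show "(\<integral>\<^sup>+s. ennreal (exp (- (u * s))) * indicator {a..b} u \<partial>half_line) = ennreal (1 / u) * indicator {a..b} u"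
      using a nn_integral_half_line_exp[of u] by (cases "u \<in> {a..b}") auto
  qed
  also have "\<dots> = ennreal (ln b - ln a)"
  proof (rule nn_integral_FTC_Icc[where F = ln])
    show "(ln has_real_derivative 1 / u) (at u)" if "u \<in> {a..b}" for u
      using that a by (auto intro!: derivative_eq_intros)
  qed (use a ab in auto)
  finally show ?thesis .
qed

lemma frullani:
  assumes a: "0 < a" and b: "0 < b"
  shows "integrable half_line (\<lambda>s. (exp (- (a * s)) - exp (- (b * s))) / s)"
    and "(LINT s|half_line. (exp (- (a * s)) - exp (- (b * s))) / s) = ln b - ln a"
proof -
  let ?f = "\<lambda>a b s. (exp (- (a * s)) - exp (- (b * s))) / s :: real"
  have le: "integrable half_line (?f a b) \<and> (LINT s|half_line. ?f a b s) = ln b - ln a"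
    if "0 < a" "a \<le> b" for a b :: real
  proof -
    have m: "?f a b \<in> borel_measurable half_line"
      by (intro measurable_half_line) measurable
    have nn: "AE s in half_line. 0 \<le> ?f a b s"
      using that by (intro AE_I2) simp
    have i: "integrable half_line (?f a b)"
      by (rule integrableI_nonneg[OF m nn]) (simp add: frullani_nn[OF that])
    have "ennreal (LINT s|half_line. ?f a b s) = ennreal (ln b - ln a)"
      using nn_integral_eq_integral[OF i nn] frullani_nn[OF that] by simp
    moreover have "0 \<le> (LINT s|half_line. ?f a b s)"
      by (rule integral_nonneg_AE[OF nn])
    ultimately show ?thesis using i that by simp
  qed
  have "integrable half_line (?f a b) \<and> (LINT s|half_line. ?f a b s) = ln b - ln a"
  proof (cases "a \<le> b")
    case True
    then show ?thesis using le a by simp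
  next
    case False
    then have *: "integrable half_line (?f b a)" "(LINT s|half_line. ?f b a s) = ln a - ln b"
      using le[of b a] b by auto
    have eq: "?f a b s = - ?f b a s" for s
      by (simp add: minus_divide_left)
    show ?thesis unfolding eq using * by simp
  qed
  then show "integrable half_line (?f a b)" "(LINT s|half_line. ?f a b s) = ln b - ln a"
    by auto
qed

lemma integral_half_line_scale:
  fixes F :: "real \<Rightarrow> complex"
  assumes t: "0 < t"
  shows "(CLINT s|half_line. F s) = (CLINT s|half_line. t *\<^sub>R F (t * s))"
proof -
  have "(CLINT s|half_line. F s) = (CLINT s|lborel. indicator {0<..} s *\<^sub>R F s)"
    by (rule integral_restrict_space) simp
  also have "\<dots> = \<bar>t\<bar> *\<^sub>R (CLINT s|lborel. indicator {0<..} (0 + t * s) *\<^sub>R F (0 + t * s))"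
    by (rule lborel_integral_real_affine) (use t in simp)
  also have "(CLINT s|lborel. indicator {0<..} (0 + t * s) *\<^sub>R F (0 + t * s)) = (CLINT s|lborel. indicator {0<..} s *\<^sub>R F (t * s))"
    using t by (intro bochner_cong refl) (simp add: indicator_def zero_less_mult_iff)
  also have "\<dots> = (CLINT s|half_line. F (t * s))"
    by (rule integral_restrict_space[symmetric]) simp
  also have "\<bar>t\<bar> *\<^sub>R \<dots> = (CLINT s|half_line. t *\<^sub>R F (t * s))"
    using t by simp
  finally show ?thesis .
qed

lemma integrable_exp_levy_gamma:
  fixes v :: complex
  assumes a: "0 < a" and v: "Re v \<le> 0"
  shows "integrable half_line (\<lambda>s. (exp (- (a * s)) / s) *\<^sub>R (exp (s * v) - 1))"
proof (rule bochner_bound)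
  have "integrable half_line (\<lambda>s. exp (- (a * s)))"
    by (rule integrableI_nonneg[OF measurable_half_line]) (use nn_integral_half_line_exp[OF a] in auto)
  then show "integrable half_line (\<lambda>s. norm v * exp (- (a * s)))" by simp
  show "(\<lambda>s. (exp (- (a * s)) / s) *\<^sub>R (exp (complex_of_real s * v) - 1)) \<in> borel_measurable half_line"
    by (intro measurable_half_line) measurable
  show "AE s in half_line. norm ((exp (- (a * s)) / s) *\<^sub>R (exp (complex_of_real s * v) - 1)) \<le> norm (norm v * exp (- (a * s)))"
  proof (rule AE_I2)
    fix s assume "s \<in> space half_line"
    then have s: "0 < s" by simp
    have "norm (exp (complex_of_real s * v) - 1) \<le> norm (complex_of_real s * v)"
      using s v by (intro norm_exp_minus_one_le) (simp add: mult_nonneg_nonpos)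
    then have "norm (exp (complex_of_real s * v) - 1) \<le> s * norm v"
      using s by (simp add: norm_mult)
    then have "exp (- (a * s)) / s * norm (exp (complex_of_real s * v) - 1) \<le> exp (- (a * s)) / s * (s * norm v)"
      using s by (intro mult_left_mono) auto
    then show "norm ((exp (- (a * s)) / s) *\<^sub>R (exp (complex_of_real s * v) - 1)) \<le> norm (norm v * exp (- (a * s)))"
      using s by (simp add: mult.commute)
  qed
qed

text \<open>
The heart of the computation.  Here \<open>a = 1/\<alpha>(x)\<close>, \<open>t = \<theta>(x)\<close> and \<open>p - q = h(x)\<close>.  Substituting \<open>s/t\<close> for \<open>s\<close> turns the
rate \<open>a\<close> into \<open>a/t = a - p + q\<close>; the factor \<open>exp(s p)\<close> cancels the one from the exponent, and there remains a Frullani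
integral with rates \<open>a\<close> and \<open>a/t\<close>.
\<close>

lemma gamma_exponent_scaling:
  fixes t a y p q :: real
  assumes t: "0 < t" and a: "0 < a" and p: "0 \<le> p" and q: "0 \<le> q" and pq: "p - q = (1 - 1 / t) * a"
  shows "(CLINT s|half_line. (exp (- (a * s)) / s) *\<^sub>R (exp (complex_of_real s * (\<i> * (t * y) - t * p)) - 1)) =
    (CLINT s|half_line. (exp (- (a * s)) / s) *\<^sub>R (exp (complex_of_real s * (\<i> * y - q)) - 1)) - ln t"
proof -
  have at: "a / t = a - p + q" using pq t by (simp add: field_simps)
  \<comment> \<open>The exponent is \<open>t (i y - p)\<close>, so the substitution moves the factor \<open>t\<close> into the rate.\<close>
  have "(CLINT s|half_line. (exp (- (a / t * s)) / s) *\<^sub>R (exp (complex_of_real s * (\<i> * y - p)) - 1))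
    = (CLINT s|half_line. t *\<^sub>R (exp (- (a / t * (t * s))) / (t * s)) *\<^sub>R (exp (complex_of_real (t * s) * (\<i> * y - p)) - 1))"
    by (rule integral_half_line_scale[OF t])
  also have "\<dots> = (CLINT s|half_line. (exp (- (a * s)) / s) *\<^sub>R (exp (complex_of_real s * (\<i> * (t * y) - t * p)) - 1))"
    using t by (intro bochner_cong refl) (simp add: algebra_simps)
  finally have "(CLINT s|half_line. (exp (- (a * s)) / s) *\<^sub>R (exp (complex_of_real s * (\<i> * (t * y) - t * p)) - 1))
    = (CLINT s|half_line. (exp (- (a / t * s)) / s) *\<^sub>R (exp (complex_of_real s * (\<i> * y - p)) - 1))" ..
  also have "\<dots> = (CLINT s|half_line. (exp (- (a * s)) / s) *\<^sub>R (exp (complex_of_real s * (\<i> * y - q)) - 1)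
        + complex_of_real ((exp (- (a * s)) - exp (- (a / t * s))) / s))"
  proof (rule bochner_cong[OF refl])
    fix s
    have "exp (- (a / t * s)) *\<^sub>R exp (complex_of_real s * (\<i> * y - p)) = exp (- (a * s)) *\<^sub>R exp (complex_of_real s * (\<i> * y - q))"
    proof -
      have "exp (- (a / t * s)) *\<^sub>R exp (complex_of_real s * (\<i> * y - p)) =
          exp (complex_of_real (- (a / t * s)) + complex_of_real s * (\<i> * y - p))"
        by (simp only: scaleR_conv_of_real exp_of_real[symmetric] exp_add)
      also have "complex_of_real (- (a / t * s)) + complex_of_real s * (\<i> * y - p) =
          complex_of_real (- (a * s)) + complex_of_real s * (\<i> * y - q)"
        unfolding at by (simp add: algebra_simps)
      also have "exp \<dots> = exp (- (a * s)) *\<^sub>R exp (complex_of_real s * (\<i> * y - q))"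
        by (simp only: scaleR_conv_of_real exp_of_real[symmetric] exp_add)
      finally show ?thesis .
    qed
    then show "(exp (- (a / t * s)) / s) *\<^sub>R (exp (complex_of_real s * (\<i> * y - p)) - 1) =
       (exp (- (a * s)) / s) *\<^sub>R (exp (complex_of_real s * (\<i> * y - q)) - 1)
        + complex_of_real ((exp (- (a * s)) - exp (- (a / t * s))) / s)"
      by (simp add: scaleR_conv_of_real right_diff_distrib diff_divide_distrib)
  qed
  also have "\<dots> = (CLINT s|half_line. (exp (- (a * s)) / s) *\<^sub>R (exp (complex_of_real s * (\<i> * y - q)) - 1))
       + (CLINT s|half_line. complex_of_real ((exp (- (a * s)) - exp (- (a / t * s))) / s))"
    using frullani(1)[of a "a / t"] integrable_exp_levy_gamma[OF a, of "\<i> * y - q"] a t q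
    by (intro bochner_add integrable_of_real) auto
  also have "(CLINT s|half_line. complex_of_real ((exp (- (a * s)) - exp (- (a / t * s))) / s)) = - ln t"
    using frullani(2)[of a "a / t"] a t by (simp only: integral_complex_of_real) (simp add: ln_div)
  finally show ?thesis by simp
qed

section \<open>The random measure with gamma intensity\<close>

context exhaustion
begin

lemma sigma_finite_radon:
  assumes "\<sigma> \<in> \<M>"
  shows "sigma_finite_measure (\<sigma> :: 'a measure)"
proof
  show "\<exists>A. countable A \<and> A \<subseteq> sets \<sigma> \<and> \<Union>A = space \<sigma> \<and> (\<forall>a\<in>A. emeasure \<sigma> a \<noteq> \<infinity>)"
    using E_finite[OF assms] UN_E
    by (intro exI[of _ "range E"]) (auto simp: radon_sets[OF assms] radon_space'[OF assms] less_top[symmetric])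
qed

lemma act_radon:
  assumes \<theta>: "\<theta> \<in> C0_pos" and \<eta>: "(\<eta> :: 'a measure) \<in> \<M>"
  shows "act \<theta> \<eta> \<in> \<M>"
proof -
  have cont: "continuous_on UNIV \<theta>" using \<theta> by (simp add: C0_pos_def)
  then have [measurable]: "\<theta> \<in> borel_measurable borel" by (rule borel_measurable_continuous_onI)
  note [measurable_cong] = radon_sets[OF \<eta>]
  have "emeasure (act \<theta> \<eta>) K < \<infinity>" if K: "compact K" for K
  proof -
    have Kb[measurable]: "K \<in> sets borel" using K by (intro borel_closed compact_imp_closed)
    have "bounded (\<theta> ` K)"
      using K cont by (intro compact_imp_bounded compact_continuous_image) (auto intro: continuous_on_subset)
    then obtain C where "\<And>x. x \<in> K \<Longrightarrow> \<bar>\<theta> x\<bar> \<le> C" by (auto simp: bounded_iff)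
    then have C: "\<theta> x \<le> C" if "x \<in> K" for x using that abs_le_D1 by blast
    have "emeasure (act \<theta> \<eta>) K = (\<integral>\<^sup>+x. ennreal (\<theta> x) * indicator K x \<partial>\<eta>)"
      unfolding act_def by (rule emeasure_density) measurable
    also have "\<dots> \<le> (\<integral>\<^sup>+x. ennreal C * indicator K x \<partial>\<eta>)"
      using C by (intro nn_integral_mono) (simp add: indicator_def ennreal_leI)
    also have "\<dots> = ennreal C * emeasure \<eta> K"
      by (rule nn_integral_cmult_indicator) (use Kb radon_sets[OF \<eta>] in simp)
    also have "\<dots> < \<infinity>" using \<eta> K by (auto simp: radon_measures_def ennreal_mult_less_top)
    finally show ?thesis .
  qed
  then show ?thesis by (simp add: radon_measures_def act_def radon_sets[OF \<eta>])
qed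

text \<open>
The action multiplies the weights \<open>s\<close> of the atoms by \<open>\<theta>\<close>.
\<close>

lemma act_discrete:
  assumes \<theta>: "\<theta> \<in> C0_pos" and \<eta>: "(\<eta> :: 'a measure) \<in> \<K>"
  shows "act \<theta> \<eta> \<in> \<K>"
proof -
  have pos: "\<And>x. 0 < \<theta> x" using \<theta> by (simp add: C0_pos_def)
  have [measurable]: "\<theta> \<in> borel_measurable borel"
    using \<theta> by (auto simp: C0_pos_def intro: borel_measurable_continuous_onI)
  obtain D s where D: "countable D" "\<forall>x\<in>D. 0 < s x"
      "\<eta> = distr (point_measure D (\<lambda>x. ennreal (s x))) borel (\<lambda>x. x)"
    using \<eta> by (auto simp: discrete_radon_measures_def)
  have "act \<theta> \<eta> = distr (density (point_measure D (\<lambda>x. ennreal (s x))) (\<lambda>x. ennreal (\<theta> x))) borel (\<lambda>x. x)"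
    unfolding act_def D(3)
  proof (rule density_distr)
    show "(\<lambda>x. ennreal (\<theta> x)) \<in> borel_measurable borel" by measurable
    show "(\<lambda>x. x) \<in> measurable (point_measure D (\<lambda>x. ennreal (s x))) borel"
      by (simp add: measurable_def space_point_measure sets_point_measure)
  qed
  also have "density (point_measure D (\<lambda>x. ennreal (s x))) (\<lambda>x. ennreal (\<theta> x)) =
      point_measure D (\<lambda>x. ennreal (s x) * ennreal (\<theta> x))"
    unfolding point_measure_def by (rule density_density_eq) simp_all
  also have "\<dots> = point_measure D (\<lambda>x. ennreal (s x * \<theta> x))"
    unfolding point_measure_def
    using D(2) pos by (intro density_cong) (auto simp: AE_count_space ennreal_mult less_imp_le)
  finally have eq: "act \<theta> \<eta> = distr (point_measure D (\<lambda>x. ennreal (s x * \<theta> x))) borel (\<lambda>x. x)" .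
  have "\<eta> \<in> \<M>" using \<eta> by (simp add: discrete_radon_measures_def)
  then have "act \<theta> \<eta> \<in> \<M>" by (rule act_radon[OF \<theta>])
  moreover have "\<forall>x\<in>D. 0 < s x * \<theta> x" using D(2) pos by simp
  moreover have "\<exists>D s. countable D \<and> (\<forall>x\<in>D. 0 < s x) \<and>
      act \<theta> \<eta> = distr (point_measure D (\<lambda>x. ennreal (s x))) borel (\<lambda>x. x)"
    by (intro exI[of _ D] exI[of _ "\<lambda>x. s x * \<theta> x"] conjI D(1) eq) fact
  ultimately show ?thesis
    unfolding discrete_radon_measures_def by (intro CollectI conjI)
qed

lemma integral_act:
  fixes f :: "'a \<Rightarrow> real"
  assumes \<theta>: "\<theta> \<in> C0_pos" and \<eta>: "\<eta> \<in> \<M>" and f: "f \<in> borel_measurable borel"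
  shows "(LINT x|act \<theta> \<eta>. f x) = (LINT x|\<eta>. \<theta> x * f x)"
proof -
  note [measurable] = f
  note [measurable_cong] = radon_sets[OF \<eta>]
  have [measurable]: "\<theta> \<in> borel_measurable borel"
    using \<theta> by (auto simp: C0_pos_def intro: borel_measurable_continuous_onI)
  have "(LINT x|act \<theta> \<eta>. f x) = (LINT x|\<eta>. \<theta> x *\<^sub>R f x)"
    unfolding act_def using \<theta> by (intro integral_density) (auto simp: C0_pos_def less_imp_le)
  then show ?thesis by simp
qed

lemma measurable_act:
  assumes \<theta>: "\<theta> \<in> C0_pos"
  shows "act \<theta> \<in> measurable (discrete_radon_space :: 'a measure measure) discrete_radon_space"
proof -
  have "act \<theta> \<in> measurable (discrete_radon_space :: 'a measure measure) radon_space"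
  proof (rule measurable_into_radon_space)
    show "act \<theta> \<in> space discrete_radon_space \<rightarrow> (\<M> :: 'a measure set)"
      using act_discrete[OF \<theta>] by (auto simp: discrete_radon_measures_def)
    fix f :: "'a \<Rightarrow> real" assume f: "f \<in> C\<^sub>c"
    have "(\<lambda>x. \<theta> x * f x) \<in> C\<^sub>c"
      using \<theta> f by (intro csc_mult) (auto simp: C0_pos_def)
    from measurable_discrete_radon[OF measurable_eval_csc[OF this]]
    show "(\<lambda>\<omega>. LINT x|act \<theta> \<omega>. f x) \<in> borel_measurable discrete_radon_space"
      by (subst measurable_cong[OF integral_act[OF \<theta> _ csc_measurable[OF f]]])
         (auto simp: discrete_radon_measures_def)
  qed
  then show ?thesis
    unfolding discrete_radon_space_def[of] 
    by (intro measurable_restrict_space2) (use act_discrete[OF \<theta>] in \<open>auto simp: discrete_radon_space_def[symmetric]\<close>)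
qed

end

text \<open>
Functions of \<open>\<theta>\<close> that vanish at 1 are test functions; this is used for \<open>log \<theta>\<close>, \<open>1 - 1/\<theta>\<close> and \<open>\<theta> - 1\<close>.
\<close>

lemma C0_pos_csc:
  fixes \<theta> :: "'a::t2_space \<Rightarrow> real"
  assumes "\<theta> \<in> C0_pos" "continuous_on {0<..} \<phi>" "\<phi> 1 = (0::real)"
  shows "(\<lambda>x. \<phi> (\<theta> x)) \<in> C\<^sub>c"
proof -
  obtain K where K: "continuous_on UNIV \<theta>" "\<And>x. 0 < \<theta> x" "compact K" "\<And>x. x \<notin> K \<Longrightarrow> \<theta> x = 1"
    using assms(1) by (auto simp: C0_pos_def)
  have "continuous_on UNIV (\<lambda>x. \<phi> (\<theta> x))"
    by (rule continuous_on_compose2[OF assms(2) K(1)]) (use K in auto)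
  then show ?thesis using K assms(3) by (intro cscI[where K = K]) auto
qed

lemma integrable_csc_mult_L1_loc:
  fixes f g :: "'a::t2_space \<Rightarrow> real"
  assumes \<sigma>: "\<sigma> \<in> \<M>" and f: "f \<in> C\<^sub>c" and g: "g \<in> L1_loc \<sigma>"
  shows "integrable \<sigma> (\<lambda>x. f x * g x)"
proof (rule integrableI_bounded)
  note [measurable_cong] = radon_sets[OF \<sigma>]
  have [measurable]: "g \<in> borel_measurable borel" "f \<in> borel_measurable borel"
    using g csc_measurable[OF f] by (auto simp: L1_loc_def)
  show "(\<lambda>x. f x * g x) \<in> borel_measurable \<sigma>" by measurable
  obtain C where C: "0 < C" "\<And>x. \<bar>f x\<bar> \<le> C" using csc_bounded[OF f] by metis
  obtain K where K: "compact K" "\<And>x. x \<notin> K \<Longrightarrow> f x = 0" using cscE[OF f] by metis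
  have [measurable]: "K \<in> sets borel" using K by (intro borel_closed compact_imp_closed)
  have "K \<in> rel_compact_borel" using K by (auto simp: rel_compact_borel_def closure_closed compact_imp_closed)
  then have fin: "(\<integral>\<^sup>+x. ennreal \<bar>g x\<bar> * indicator K x \<partial>\<sigma>) < \<infinity>"
    using g by (auto simp: L1_loc_def)
  have "(\<integral>\<^sup>+x. ennreal (norm (f x * g x)) \<partial>\<sigma>) \<le> (\<integral>\<^sup>+x. ennreal C * (ennreal \<bar>g x\<bar> * indicator K x) \<partial>\<sigma>)"
  proof (rule nn_integral_mono)
    fix x
    show "ennreal (norm (f x * g x)) \<le> ennreal C * (ennreal \<bar>g x\<bar> * indicator K x)"
    proof (cases "x \<in> K")
      case True
      have "norm (f x * g x) \<le> C * \<bar>g x\<bar>"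
        using C(2)[of x] by (simp add: abs_mult mult_right_mono)
      then show ?thesis using True C by (simp add: ennreal_mult[symmetric] ennreal_leI)
    qed (use K in simp)
  qed
  also have "\<dots> = ennreal C * (\<integral>\<^sup>+x. ennreal \<bar>g x\<bar> * indicator K x \<partial>\<sigma>)"
    by (intro nn_integral_cmult) measurable
  also have "\<dots> < \<infinity>" using fin by (simp add: ennreal_mult_less_top)
  finally show "(\<integral>\<^sup>+x. ennreal (norm (f x * g x)) \<partial>\<sigma>) < \<infinity>" .
qed

locale gamma_law = exhaustion E
  for E :: "nat \<Rightarrow> 'a::polish_space set" +
  fixes \<sigma> :: "'a measure" and \<alpha> \<beta> :: "'a \<Rightarrow> real" and \<mu> :: "'a measure measure"
  assumes radon_\<sigma>: "\<sigma> \<in> \<M>"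
    and \<alpha>_meas [measurable]: "\<alpha> \<in> borel_measurable borel" and \<alpha>_pos: "\<And>x. 0 < \<alpha> x"
    and \<beta>_meas [measurable]: "\<beta> \<in> borel_measurable borel" and \<beta>_nonneg: "\<And>x. 0 \<le> \<beta> x"
    and \<alpha>\<beta>_L1: "(\<lambda>x. \<alpha> x * \<beta> x) \<in> L1_loc \<sigma>" and \<beta>_L1: "\<beta> \<in> L1_loc \<sigma>"
    and law_\<mu>: "is_mu (gamma_intensity \<alpha> \<beta> \<sigma>) \<mu>"
begin

abbreviation (input) m :: "('a \<times> real) measure" where
  "m \<equiv> gamma_intensity \<alpha> \<beta> \<sigma>"

definition \<Gamma> :: "'a measure" where
  "\<Gamma> = density \<sigma> (\<lambda>x. ennreal (\<alpha> x * \<beta> x))"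

lemma sets_\<sigma> [measurable_cong]: "sets \<sigma> = sets borel"
  by (rule radon_sets[OF radon_\<sigma>])

sublocale \<sigma>: sigma_finite_measure \<sigma>
  by (rule sigma_finite_radon[OF radon_\<sigma>])

sublocale half_line: sigma_finite_measure half_line
  by (rule sigma_finite_half_line)

sublocale pair: pair_sigma_finite \<sigma> half_line ..

lemma \<alpha>\<beta>_nonneg: "0 \<le> \<alpha> x * \<beta> x"
  using \<alpha>_pos[of x] \<beta>_nonneg[of x] by simp

definition rate :: "'a \<times> real \<Rightarrow> real" where
  "rate p = \<beta> (fst p) * exp (- snd p / \<alpha> (fst p)) / snd p"

lemma rate_meas [measurable]: "rate \<in> borel_measurable (\<sigma> \<Otimes>\<^sub>M half_line)"
  unfolding rate_def[abs_def] by measurable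

lemma gamma_intensity_eq: "m = density (\<sigma> \<Otimes>\<^sub>M half_line) (\<lambda>p. ennreal (rate p))"
  unfolding gamma_intensity_def rate_def by (simp add: case_prod_beta')

lemma rate_nonneg: "p \<in> space (\<sigma> \<Otimes>\<^sub>M half_line) \<Longrightarrow> 0 \<le> rate p"
  using \<beta>_nonneg by (auto simp: rate_def space_pair_measure intro!: divide_nonneg_pos)

lemma radon_\<Gamma>: "\<Gamma> \<in> \<M>"
proof -
  have "emeasure \<Gamma> K < \<infinity>" if K: "compact K" for K
  proof -
    have [measurable]: "K \<in> sets borel" using K by (intro borel_closed compact_imp_closed)
    have "K \<in> rel_compact_borel" using K by (auto simp: rel_compact_borel_def closure_closed compact_imp_closed)
    then have "(\<integral>\<^sup>+x. ennreal \<bar>\<alpha> x * \<beta> x\<bar> * indicator K x \<partial>\<sigma>) < \<infinity>"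
      using \<alpha>\<beta>_L1 by (auto simp: L1_loc_def)
    then show ?thesis
      unfolding \<Gamma>_def by (subst emeasure_density) (simp_all add: \<alpha>\<beta>_nonneg)
  qed
  then show ?thesis by (simp add: radon_measures_def \<Gamma>_def sets_\<sigma>)
qed

text \<open>
The factor \<open>s\<close> cancels the singularity of the density, and the integral of \<open>exp(-s/\<alpha>)\<close> is \<open>\<alpha>\<close>.
\<close>

lemma gamma_moment:
  assumes [measurable]: "g \<in> borel_measurable borel"
  shows "(\<integral>\<^sup>+p. ennreal (snd p) * g (fst p) \<partial>m) = (\<integral>\<^sup>+x. g x \<partial>\<Gamma>)"
proof -
  have "(\<integral>\<^sup>+p. ennreal (snd p) * g (fst p) \<partial>m) =
      (\<integral>\<^sup>+p. ennreal (rate p) * (ennreal (snd p) * g (fst p)) \<partial>(\<sigma> \<Otimes>\<^sub>M half_line))"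
    unfolding gamma_intensity_eq by (rule nn_integral_density) measurable
  also have "\<dots> = (\<integral>\<^sup>+x. (\<integral>\<^sup>+s. ennreal (rate (x, s)) * (ennreal s * g x) \<partial>half_line) \<partial>\<sigma>)"
    by (subst half_line.nn_integral_fst[symmetric]) simp_all
  also have "\<dots> = (\<integral>\<^sup>+x. ennreal (\<alpha> x * \<beta> x) * g x \<partial>\<sigma>)"
  proof (rule nn_integral_cong)
    fix x
    have "(\<integral>\<^sup>+s. ennreal (rate (x, s)) * (ennreal s * g x) \<partial>half_line) =
        (\<integral>\<^sup>+s. (ennreal (\<beta> x) * g x) * ennreal (exp (- ((1 / \<alpha> x) * s))) \<partial>half_line)"
    proof (rule nn_integral_cong)
      fix s assume "s \<in> space half_line"
      then have s: "0 < s" by simp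
      have "ennreal (rate (x, s)) * ennreal s = ennreal (\<beta> x * exp (- s / \<alpha> x) / s * s)"
        using s \<beta>_nonneg[of x] by (subst ennreal_mult[symmetric]) (auto simp: rate_def)
      also have "\<dots> = ennreal (\<beta> x) * ennreal (exp (- ((1 / \<alpha> x) * s)))"
        using s \<beta>_nonneg[of x] by (simp add: ennreal_mult)
      finally show "ennreal (rate (x, s)) * (ennreal s * g x) = (ennreal (\<beta> x) * g x) * ennreal (exp (- ((1 / \<alpha> x) * s)))"
        by (simp only: mult.assoc[symmetric]) (simp only: mult_ac)
    qed
    also have "\<dots> = (ennreal (\<beta> x) * g x) * (\<integral>\<^sup>+s. ennreal (exp (- ((1 / \<alpha> x) * s))) \<partial>half_line)"
      by (intro nn_integral_cmult measurable_half_line) measurable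
    also have "(\<integral>\<^sup>+s. ennreal (exp (- ((1 / \<alpha> x) * s))) \<partial>half_line) = ennreal (\<alpha> x)"
      using nn_integral_half_line_exp[of "1 / \<alpha> x"] \<alpha>_pos[of x] by simp
    also have "(ennreal (\<beta> x) * g x) * ennreal (\<alpha> x) = ennreal (\<alpha> x * \<beta> x) * g x"
      using \<alpha>_pos[of x] \<beta>_nonneg[of x] by (simp add: ennreal_mult mult_ac)
    finally show "(\<integral>\<^sup>+s. ennreal (rate (x, s)) * (ennreal s * g x) \<partial>half_line) = ennreal (\<alpha> x * \<beta> x) * g x" .
  qed
  also have "\<dots> = (\<integral>\<^sup>+x. g x \<partial>\<Gamma>)"
    unfolding \<Gamma>_def by (rule nn_integral_density[symmetric]) measurable
  finally show ?thesis .
qed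

sublocale discrete_law E m \<mu> \<Gamma>
proof
  show "fst \<in> measurable (m) borel"
    unfolding gamma_intensity_eq by measurable
  show "snd \<in> borel_measurable (m)"
    unfolding gamma_intensity_eq by measurable
  show "0 < snd p" if "p \<in> space (m)" for p
    using that by (auto simp: gamma_intensity_eq space_pair_measure)
qed (fact gamma_moment radon_\<Gamma> law_\<mu>)+

lemma integrable_\<Gamma>_iff:
  fixes g :: "'a \<Rightarrow> real"
  assumes [measurable]: "g \<in> borel_measurable borel"
  shows "integrable \<Gamma> g \<longleftrightarrow> integrable \<sigma> (\<lambda>x. \<alpha> x * \<beta> x * g x)"
  unfolding \<Gamma>_def by (subst integrable_density) (auto simp: \<alpha>\<beta>_nonneg)

definition levy_exponent :: "'a \<Rightarrow> complex \<Rightarrow> complex" where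
  "levy_exponent x w = (CLINT s|half_line. (exp (- (1 / \<alpha> x * s)) / s) *\<^sub>R (exp (complex_of_real s * w) - 1))"

text \<open>
Fubini's theorem reduces the exponent to one-dimensional integrals, one for each \<open>x\<close>.
\<close>

lemma \<Psi>_eq:
  assumes [measurable]: "w \<in> borel_measurable borel" and w: "\<And>x. Re (w x) \<le> 0" "integrable \<Gamma> w"
  shows "\<Psi> w = (CLINT x|\<sigma>. \<beta> x *\<^sub>R levy_exponent x (w x))"
    and "integrable \<sigma> (\<lambda>x. \<beta> x *\<^sub>R levy_exponent x (w x))"
proof -
  define G where "G p = rate p *\<^sub>R (exp (complex_of_real (snd p) * w (fst p)) - 1)" for p
  have "integrable (m) (\<lambda>p. exp (complex_of_real (snd p) * w (fst p)) - 1)"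
    by (rule \<Psi>_Lipschitz(2)[of w w]) (use w in auto)
  then have G: "integrable (\<sigma> \<Otimes>\<^sub>M half_line) G"
    unfolding gamma_intensity_eq G_def
    by (subst (asm) integrable_density) (auto intro!: AE_I2 rate_nonneg)
  have inner: "(CLINT s|half_line. G (x, s)) = \<beta> x *\<^sub>R levy_exponent x (w x)" for x
  proof -
    have "(CLINT s|half_line. G (x, s)) =
        (CLINT s|half_line. \<beta> x *\<^sub>R (exp (- (1 / \<alpha> x * s)) / s) *\<^sub>R (exp (complex_of_real s * w x) - 1))"
      by (intro bochner_cong refl) (simp add: G_def rate_def)
    then show ?thesis by (simp only: levy_exponent_def integral_scaleR_right)
  qed
  have "\<Psi> w = (CLINT p|\<sigma> \<Otimes>\<^sub>M half_line. G p)"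
  proof -
    have "\<Psi> w = (CLINT p|density (\<sigma> \<Otimes>\<^sub>M half_line) (\<lambda>p. ennreal (rate p)).
        exp (complex_of_real (snd p) * w (fst p)) - 1)"
      unfolding \<Psi>_def by (simp only: gamma_intensity_eq)
    also have "\<dots> = (CLINT p|\<sigma> \<Otimes>\<^sub>M half_line. G p)"
      unfolding G_def by (intro integral_density) (auto intro!: AE_I2 rate_nonneg)
    finally show ?thesis .
  qed
  also have "\<dots> = (CLINT x|\<sigma>. CLINT s|half_line. G (x, s))"
    by (rule pair.integral_fst'[symmetric, OF G])
  finally show "\<Psi> w = (CLINT x|\<sigma>. \<beta> x *\<^sub>R levy_exponent x (w x))" by (simp add: inner)
  show "integrable \<sigma> (\<lambda>x. \<beta> x *\<^sub>R levy_exponent x (w x))"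
    using pair.integrable_fst'[OF G] by (simp add: inner)
qed

text \<open>
The exponent at \<open>\<theta>(i f - p)\<close> belongs to the measure with density \<open>exp(-\<integral>p d\<eta>)\<close> for the image law, the one at \<open>i f - q\<close> to
the measure with density \<open>exp(-\<integral>q d\<eta>)\<close> for the original law.
\<close>

lemma \<Psi>_scaling:
  fixes f p q :: "'a \<Rightarrow> real"
  assumes \<theta>: "\<theta> \<in> C0_pos"
    and [measurable]: "f \<in> borel_measurable borel" "p \<in> borel_measurable borel" "q \<in> borel_measurable borel"
    and int: "integrable \<Gamma> f" "integrable \<Gamma> (\<lambda>x. \<theta> x * f x)" "integrable \<Gamma> (\<lambda>x. \<theta> x * p x)" "integrable \<Gamma> q"
    and nn: "\<And>x. 0 \<le> p x" "\<And>x. 0 \<le> q x"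
    and pq: "\<And>x. 0 < \<beta> x \<Longrightarrow> p x - q x = (1 - 1 / \<theta> x) * (1 / \<alpha> x)"
  shows "\<Psi> (\<lambda>x. \<i> * (\<theta> x * f x) - \<theta> x * p x) = \<Psi> (\<lambda>x. \<i> * f x - q x) - (LINT x|\<sigma>. ln (\<theta> x) * \<beta> x)"
proof -
  have \<theta>_pos: "\<And>x. 0 < \<theta> x" and [measurable]: "\<theta> \<in> borel_measurable borel"
    using \<theta> by (auto simp: C0_pos_def intro: borel_measurable_continuous_onI)
  have ln: "integrable \<sigma> (\<lambda>x. ln (\<theta> x) * \<beta> x)"
    by (rule integrable_csc_mult_L1_loc[OF radon_\<sigma> C0_pos_csc[OF \<theta>] \<beta>_L1])
       (auto intro!: continuous_intros)
  have "\<beta> x *\<^sub>R levy_exponent x (\<i> * (\<theta> x * f x) - \<theta> x * p x) =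
      \<beta> x *\<^sub>R levy_exponent x (\<i> * f x - q x) - complex_of_real (ln (\<theta> x) * \<beta> x)" for x
  proof (cases "\<beta> x = 0")
    case False
    with \<beta>_nonneg[of x] have "0 < \<beta> x" by simp
    have eq: "levy_exponent x (\<i> * (\<theta> x * f x) - \<theta> x * p x) = levy_exponent x (\<i> * f x - q x) - ln (\<theta> x)"
      unfolding levy_exponent_def
      by (rule gamma_exponent_scaling) (use \<theta>_pos \<alpha>_pos nn pq[OF \<open>0 < \<beta> x\<close>] in auto)
    show ?thesis
      unfolding eq by (simp add: scaleR_conv_of_real right_diff_distrib mult.commute)
  qed simp
  then have "\<Psi> (\<lambda>x. \<i> * (\<theta> x * f x) - \<theta> x * p x) =
      (CLINT x|\<sigma>. \<beta> x *\<^sub>R levy_exponent x (\<i> * f x - q x) - complex_of_real (ln (\<theta> x) * \<beta> x))"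
    using int nn \<theta>_pos by (subst \<Psi>_eq(1)) (auto simp: mult_nonneg_nonneg less_imp_le simp del: of_real_mult)
  also have "\<dots> = (CLINT x|\<sigma>. \<beta> x *\<^sub>R levy_exponent x (\<i> * f x - q x)) - (CLINT x|\<sigma>. complex_of_real (ln (\<theta> x) * \<beta> x))"
    using int nn by (intro bochner_diff \<Psi>_eq(2) integrable_of_real ln) auto
  also have "(CLINT x|\<sigma>. \<beta> x *\<^sub>R levy_exponent x (\<i> * f x - q x)) = \<Psi> (\<lambda>x. \<i> * f x - q x)"
    using int nn by (intro \<Psi>_eq(1)[symmetric]) auto
  also have "(CLINT x|\<sigma>. complex_of_real (ln (\<theta> x) * \<beta> x)) = (LINT x|\<sigma>. ln (\<theta> x) * \<beta> x)"
    by (rule integral_complex_of_real)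
  finally show ?thesis .
qed

end

section \<open>Quasi-invariance\<close>

context gamma_law
begin

text \<open>
The measures \<open>M1\<close> and \<open>M2\<close> of the proof are the two sides of the equality announced at the beginning.  The functions \<open>h\<close>,
\<open>\<theta> h\<close> and \<open>log \<theta>\<close> are integrable as needed because \<open>\<alpha>\<beta>h = (1 - 1/\<theta>)\<beta>\<close> and \<open>\<alpha>\<beta>\<theta>h = (\<theta> - 1)\<beta>\<close>: the weight \<open>\<alpha>\<close> in
\<open>\<Gamma> = \<alpha>\<beta>\<sigma>\<close> compensates a possibly unbounded \<open>1/\<alpha>\<close>.
\<close>

theorem pushforward_act_eq_density:
  assumes \<theta>: "\<theta> \<in> C0_pos"
    and h_def: "\<And>x. h x = indicator {x. 0 < \<beta> x} x *\<^sub>R ((1 - inverse (\<theta> x)) * (1 / \<alpha> x))"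
    and c_def: "c = (LINT x|\<sigma>. ln (\<theta> x) * \<beta> x)"
  shows "h \<in> borel_measurable borel" and "integrable \<Gamma> h"
    and "pushforward_act \<theta> \<mu> = density \<mu> (\<lambda>\<eta>. ennreal (exp ((LINT x|\<eta>. max 0 (h x)) - (LINT x|\<eta>. max 0 (- h x)) - c)))"
proof -
  have \<theta>_pos: "\<And>x. 0 < \<theta> x" and \<theta>_meas[measurable]: "\<theta> \<in> borel_measurable borel"
    using \<theta> by (auto simp: C0_pos_def intro: borel_measurable_continuous_onI)
  show h[measurable]: "h \<in> borel_measurable borel"
    unfolding h_def[abs_def] by measurable
  define p where "p x = max 0 (h x)" for x
  define q where "q x = max 0 (- h x)" for x
  have pq_meas[measurable]: "p \<in> borel_measurable borel" "q \<in> borel_measurable borel"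
    unfolding p_def q_def by measurable
  have pq: "p x - q x = h x" "0 \<le> p x" "0 \<le> q x" for x by (auto simp: p_def q_def)
  have h_weight: "\<alpha> x * \<beta> x * h x = (1 - inverse (\<theta> x)) * \<beta> x" for x
    using \<alpha>_pos[of x] \<beta>_nonneg[of x] by (cases "\<beta> x = 0") (auto simp: h_def)
  have csc1: "(\<lambda>x. 1 - inverse (\<theta> x)) \<in> C\<^sub>c"
    by (rule C0_pos_csc[OF \<theta>]) (auto intro!: continuous_intros)
  have csc2: "(\<lambda>x. \<theta> x - 1) \<in> C\<^sub>c"
    by (rule C0_pos_csc[OF \<theta>]) (auto intro!: continuous_intros)
  show int_h: "integrable \<Gamma> h"
    unfolding integrable_\<Gamma>_iff[OF h] h_weight by (rule integrable_csc_mult_L1_loc[OF radon_\<sigma> csc1 \<beta>_L1])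
  have int_\<theta>h: "integrable \<Gamma> (\<lambda>x. \<theta> x * h x)"
  proof -
    have eq: "\<alpha> x * \<beta> x * (\<theta> x * h x) = (\<theta> x - 1) * \<beta> x" for x
    proof -
      have "\<alpha> x * \<beta> x * (\<theta> x * h x) = \<theta> x * (\<alpha> x * \<beta> x * h x)" by simp
      also have "\<dots> = (\<theta> x - 1) * \<beta> x"
        unfolding h_weight using \<theta>_pos[of x] by (simp add: field_simps)
      finally show ?thesis .
    qed
    have m: "(\<lambda>x. \<theta> x * h x) \<in> borel_measurable borel" by measurable
    show ?thesis
      unfolding integrable_\<Gamma>_iff[OF m] eq by (rule integrable_csc_mult_L1_loc[OF radon_\<sigma> csc2 \<beta>_L1])
  qed
  have int_q: "integrable \<Gamma> q" unfolding q_def using int_h by simp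
  have int_\<theta>p: "integrable \<Gamma> (\<lambda>x. \<theta> x * p x)"
  proof -
    have "\<theta> x * p x = max 0 (\<theta> x * h x)" for x
      using \<theta>_pos[of x] by (simp add: p_def max_def zero_le_mult_iff)
    then show ?thesis using int_\<theta>h by simp
  qed
  define \<nu> where "\<nu> = pushforward_act \<theta> \<mu>"
  have act_meas: "act \<theta> \<in> measurable \<mu> discrete_radon_space"
    unfolding measurable_\<mu>_iff by (rule measurable_act[OF \<theta>])
  have sets_\<nu>: "sets \<nu> = sets discrete_radon_space" by (simp add: \<nu>_def pushforward_act_def)
  have prob_\<nu>: "prob_space \<nu>"
    unfolding \<nu>_def pushforward_act_def by (rule \<mu>.prob_space_distr[OF act_meas])
  define P where "P \<eta> = (LINT x|\<eta>. p x)" for \<eta>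
  define Q where "Q \<eta> = (LINT x|\<eta>. q x)" for \<eta>
  have PQ_nn: "0 \<le> P \<eta>" "0 \<le> Q \<eta>" for \<eta>
    unfolding P_def Q_def by (auto intro!: bochner_nonneg pq)
  have meas_d: "(\<lambda>\<eta>. LINT x|\<eta>. f x) \<in> borel_measurable discrete_radon_space"
    if "f \<in> borel_measurable borel" for f :: "'a \<Rightarrow> real"
    using that by (intro measurable_discrete_radon measurable_integral_radon)
  have PQ_d[measurable]: "P \<in> borel_measurable discrete_radon_space" "Q \<in> borel_measurable discrete_radon_space"
    unfolding P_def[abs_def] Q_def[abs_def] by (auto intro: meas_d)
  have PQ_\<mu>[measurable]: "P \<in> borel_measurable \<mu>" "Q \<in> borel_measurable \<mu>"
    using PQ_d by (simp_all add: measurable_\<mu>_iff)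
  have PQ_\<nu>[measurable]: "P \<in> borel_measurable \<nu>" "Q \<in> borel_measurable \<nu>"
    using PQ_d by (simp_all add: measurable_cong_sets[OF sets_\<nu> refl])
  \<comment> \<open>Both densities are bounded because \<open>P\<close> and \<open>Q\<close> are nonnegative.\<close>
  define M1 where "M1 = density \<nu> (\<lambda>\<eta>. ennreal (exp (- P \<eta>)))"
  define M2 where "M2 = density \<mu> (\<lambda>\<eta>. ennreal (exp (- Q \<eta> - c)))"
  have fin: "finite_measure (density M (\<lambda>\<eta>. ennreal (u \<eta>)))"
    if M: "prob_space M" and [measurable]: "u \<in> borel_measurable M" and u: "\<And>\<eta>. u \<eta> \<le> K" for M u and K :: real
  proof -
    interpret M: prob_space M by (rule M)
    have "(\<integral>\<^sup>+\<eta>. ennreal (u \<eta>) \<partial>M) \<le> (\<integral>\<^sup>+\<eta>. ennreal K \<partial>M)"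
      by (intro nn_integral_mono ennreal_leI u)
    also have "\<dots> < \<infinity>" by (simp add: M.emeasure_space_1)
    finally show ?thesis
      by (intro finite_measureI) (simp add: emeasure_density cong: nn_integral_cong_simp)
  qed
  have "M1 = M2"
  proof (rule characteristic_functional_unique)
    show "finite_measure M1" unfolding M1_def
      by (rule fin[OF prob_\<nu>, of _ 1]) (use PQ_nn in auto)
    show "finite_measure M2" unfolding M2_def
      by (rule fin[OF prob_\<mu>, of _ "exp (- c)"]) (use PQ_nn in auto)
    show "sets M1 = sets discrete_radon_space" by (simp add: M1_def sets_\<nu>)
    show "sets M2 = sets discrete_radon_space" by (simp add: M2_def sets_\<mu>)
    fix f :: "'a \<Rightarrow> real" assume f: "f \<in> C\<^sub>c"
    have f_meas[measurable]: "f \<in> borel_measurable borel" by (rule csc_measurable[OF f])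
    define F where "F \<eta> = (LINT x|\<eta>. f x)" for \<eta>
    have F_d[measurable]: "F \<in> borel_measurable discrete_radon_space"
      unfolding F_def[abs_def] by (rule meas_d) measurable
    have [measurable]: "F \<in> borel_measurable \<mu>" "F \<in> borel_measurable \<nu>"
      using F_d by (simp_all add: measurable_\<mu>_iff measurable_cong_sets[OF sets_\<nu> refl])
    have \<theta>f: "(\<lambda>x. \<theta> x * f x) \<in> C\<^sub>c"
      using \<theta> f by (intro csc_mult) (auto simp: C0_pos_def)
    have int_f: "integrable \<Gamma> f" "integrable \<Gamma> (\<lambda>x. \<theta> x * f x)"
      using f \<theta>f by (auto intro: csc_integrable[OF radon_\<Gamma>])
    have "(CLINT \<eta>|M1. iexp (F \<eta>)) = (CLINT \<eta>|\<nu>. exp (- P \<eta>) *\<^sub>R iexp (F \<eta>))"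
      unfolding M1_def by (rule integral_density) auto
    also have "\<dots> = (CLINT \<eta>|\<mu>. exp (- P (act \<theta> \<eta>)) *\<^sub>R iexp (F (act \<theta> \<eta>)))"
      unfolding \<nu>_def pushforward_act_def by (rule integral_distr[OF act_meas]) measurable
    also have "\<dots> = (CLINT \<eta>|\<mu>. exp (\<i> * (LINT x|\<eta>. \<theta> x * f x) - (LINT x|\<eta>. \<theta> x * p x)))"
    proof (rule bochner_cong[OF refl])
      fix \<eta> assume "\<eta> \<in> space \<mu>"
      then have \<eta>: "\<eta> \<in> \<M>" by (rule radon_\<mu>)
      have "exp (- P (act \<theta> \<eta>)) *\<^sub>R iexp (F (act \<theta> \<eta>)) = exp (\<i> * F (act \<theta> \<eta>) - P (act \<theta> \<eta>))"
        by (simp add: scaleR_conv_of_real exp_of_real[symmetric] exp_diff exp_minus divide_inverse)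
      then show "exp (- P (act \<theta> \<eta>)) *\<^sub>R iexp (F (act \<theta> \<eta>)) = exp (\<i> * (LINT x|\<eta>. \<theta> x * f x) - (LINT x|\<eta>. \<theta> x * p x))"
        by (simp only: P_def F_def integral_act[OF \<theta> \<eta> f_meas] integral_act[OF \<theta> \<eta> pq_meas(1)])
    qed
    also have "\<dots> = exp (\<Psi> (\<lambda>x. \<i> * complex_of_real (\<theta> x * f x) - complex_of_real (\<theta> x * p x)))"
      using int_f(2) int_\<theta>p \<theta>_pos pq
      by (intro laplace_functional) (auto simp: less_imp_le)
    also have "\<Psi> (\<lambda>x. \<i> * (\<theta> x * f x) - \<theta> x * p x) = \<Psi> (\<lambda>x. \<i> * f x - q x) - c"
      unfolding c_def using int_f int_\<theta>p int_q pq
      by (intro \<Psi>_scaling[OF \<theta>]) (auto simp: h_def inverse_eq_divide)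
    also have "exp (\<Psi> (\<lambda>x. \<i> * f x - q x) - c) = exp (\<Psi> (\<lambda>x. \<i> * f x - q x)) * exp (- complex_of_real c)"
      by (simp add: exp_diff exp_minus divide_inverse)
    also have "exp (\<Psi> (\<lambda>x. \<i> * f x - q x)) = (CLINT \<eta>|\<mu>. exp (\<i> * (LINT x|\<eta>. f x) - (LINT x|\<eta>. q x)))"
      using int_f(1) int_q pq by (intro laplace_functional[symmetric]) auto
    also have "\<dots> * exp (- complex_of_real c) = (CLINT \<eta>|\<mu>. exp (\<i> * (LINT x|\<eta>. f x) - (LINT x|\<eta>. q x)) * exp (- complex_of_real c))"
      by (rule integral_mult_left_zero[symmetric])
    also have "\<dots> = (CLINT \<eta>|\<mu>. exp (- Q \<eta> - c) *\<^sub>R iexp (F \<eta>))"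
      by (intro bochner_cong refl)
         (simp add: scaleR_conv_of_real exp_of_real[symmetric] exp_diff exp_minus divide_inverse F_def Q_def)
    also have "\<dots> = (CLINT \<eta>|M2. iexp (F \<eta>))"
      unfolding M2_def by (rule integral_density[symmetric]) auto
    finally show "(CLINT \<eta>|M1. iexp (LINT x|\<eta>. f x)) = (CLINT \<eta>|M2. iexp (LINT x|\<eta>. f x))"
      by (simp only: F_def)
  qed
  \<comment> \<open>The factor \<open>exp(- P)\<close> is positive everywhere and can be divided out.\<close>
  have "\<nu> = density M1 (\<lambda>\<eta>. ennreal (exp (P \<eta>)))"
    unfolding M1_def by (subst density_density_eq) (auto simp: ennreal_mult[symmetric] exp_add[symmetric] density_1)
  also have "\<dots> = density \<mu> (\<lambda>\<eta>. ennreal (exp (P \<eta> - Q \<eta> - c)))"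
    unfolding \<open>M1 = M2\<close> M2_def
    by (subst density_density_eq) (auto simp: ennreal_mult[symmetric] exp_add[symmetric] intro!: density_cong)
  finally show "pushforward_act \<theta> \<mu> = density \<mu> (\<lambda>\<eta>. ennreal (exp ((LINT x|\<eta>. max 0 (h x)) - (LINT x|\<eta>. max 0 (- h x)) - c)))"
    by (simp add: \<nu>_def P_def Q_def p_def q_def)
qed

end

theorem theorem22:
  fixes \<sigma> :: "'a::polish_space measure"
    and \<alpha> \<beta> :: "'a \<Rightarrow> real"
    and \<mu> :: "'a measure measure"
    and Y :: "'a set"
  assumes "locally_compact_space (euclidean :: 'a topology)"
    and "\<sigma> \<in> radon_measures" and "nonatomic \<sigma>"
    and "\<alpha> \<in> borel_measurable borel" and "\<And>x. 0 < \<alpha> x"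
    and "\<beta> \<in> borel_measurable borel" and "\<And>x. 0 \<le> \<beta> x"
    and "(\<lambda>x. \<alpha> x * \<beta> x) \<in> L1_loc \<sigma>" and "\<beta> \<in> L1_loc \<sigma>"
    and "is_mu (gamma_intensity \<alpha> \<beta> \<sigma>) \<mu>"
    and "Y = {x. 0 < \<beta> x}"
  shows "\<forall>\<theta> \<in> C0_pos.
    absolutely_continuous \<mu> (pushforward_act \<theta> \<mu>) \<and>
    set_integrable \<sigma> Y (\<lambda>x. ln (\<theta> x) * \<beta> x) \<and>
    (AE \<eta> in \<mu>.
       set_integrable \<eta> Y (\<lambda>x. (1 - inverse (\<theta> x)) * (1 / \<alpha> x)) \<and>
       RN_deriv \<mu> (pushforward_act \<theta> \<mu>) \<eta> =
         ennreal (exp ((LINT x:Y|\<eta>. (1 - inverse (\<theta> x)) * (1 / \<alpha> x))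
                       - (LINT x:Y|\<sigma>. ln (\<theta> x) * \<beta> x))))"
proof (intro ballI conjI)
  fix \<theta> :: "'a \<Rightarrow> real" assume \<theta>: "\<theta> \<in> C0_pos"
  obtain E :: "nat \<Rightarrow> 'a set" where E: "\<And>n. open (E n)" "\<And>n. compact (closure (E n))" "incseq E" "(\<Union>n. E n) = UNIV"
    using locally_compact_exhaustion[OF assms(1)] by metis
  interpret gamma_law E \<sigma> \<alpha> \<beta> \<mu>
    by unfold_locales (use E assms in auto)
  define h where "h x = indicator {x. 0 < \<beta> x} x *\<^sub>R ((1 - inverse (\<theta> x)) * (1 / \<alpha> x))" for x
  define c where "c = (LINT x|\<sigma>. ln (\<theta> x) * \<beta> x)"
  note density = pushforward_act_eq_density[OF \<theta> h_def c_def]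
  note h_meas[measurable] = density(1)
  define J where "J \<eta> = (LINT x|\<eta>. max 0 (h x)) - (LINT x|\<eta>. max 0 (- h x)) - c" for \<eta>
  have J_meas: "J \<in> borel_measurable \<mu>" unfolding J_def[abs_def] by measurable
  have push: "density \<mu> (\<lambda>\<eta>. ennreal (exp (J \<eta>))) = pushforward_act \<theta> \<mu>"
    unfolding J_def by (rule density(3)[symmetric])
  have Y_\<beta>: "indicator Y x *\<^sub>R (ln (\<theta> x) * \<beta> x) = ln (\<theta> x) * \<beta> x" for x
    using \<beta>_nonneg[of x] assms(11) by (auto simp: indicator_def)
  show "absolutely_continuous \<mu> (pushforward_act \<theta> \<mu>)"
    unfolding push[symmetric] by (rule absolutely_continuousI_density) (use J_meas in measurable)
  show "set_integrable \<sigma> Y (\<lambda>x. ln (\<theta> x) * \<beta> x)"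
    unfolding set_integrable_def Y_\<beta>
    by (rule integrable_csc_mult_L1_loc[OF radon_\<sigma> C0_pos_csc[OF \<theta>] \<beta>_L1])
       (auto intro!: continuous_intros)
  have "AE \<eta> in \<mu>. ennreal (exp (J \<eta>)) = RN_deriv \<mu> (pushforward_act \<theta> \<mu>) \<eta>"
    by (rule \<mu>.RN_deriv_unique[OF _ push]) (use J_meas in measurable)
  then show "AE \<eta> in \<mu>.
       set_integrable \<eta> Y (\<lambda>x. (1 - inverse (\<theta> x)) * (1 / \<alpha> x)) \<and>
       RN_deriv \<mu> (pushforward_act \<theta> \<mu>) \<eta> =
         ennreal (exp ((LINT x:Y|\<eta>. (1 - inverse (\<theta> x)) * (1 / \<alpha> x))
                       - (LINT x:Y|\<sigma>. ln (\<theta> x) * \<beta> x)))"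
    using AE_integrable(1)[OF density(1,2)]
  proof eventually_elim
    case (elim \<eta>)
    have Yh: "indicator Y x *\<^sub>R ((1 - inverse (\<theta> x)) * (1 / \<alpha> x)) = h x" for x
      by (simp add: h_def assms(11))
    have "(LINT x|\<eta>. max 0 (h x)) - (LINT x|\<eta>. max 0 (- h x)) = (LINT x|\<eta>. max 0 (h x) - max 0 (- h x))"
      using elim(2) by (intro bochner_diff[symmetric]) auto
    also have "\<dots> = (LINT x|\<eta>. h x)"
      by (intro bochner_cong refl) auto
    finally have "J \<eta> = (LINT x|\<eta>. h x) - c" by (simp add: J_def)
    with elim show ?case
      unfolding set_integrable_def set_lebesgue_integral_def Yh Y_\<beta> by (simp add: c_def)
  qed
qed

end
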